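(* Let $I$ be an index set and let $A=[a_{ij}]_{i,j\in I}$ be an $I\times I$ matrix with entries in $\mathbb{C}$. For any $t\geq 0$, let $T_t$ be the unbounded Schur multiplier on $B(\ell^2_I)$ associated with the matrix $$\big[e^{-ta_{ij}}\big]_{i,j \in I}.$$ The semigroup $(T_t)_{t\geq 0}$ extends to a semigroup of selfadjoint contractive Schur multipliers $T_t \colon B(\ell^2_I) \to B(\ell^2_I)$ if and only if there exist a Hilbert space $H$ and two families $(\alpha_i)_{i \in I}$ and $(\beta_j)_{j \in I}$ of elements of $H$ such that $a_{ij}=\|\alpha_i-\beta_j\|_{H}^2$ for any $i,j \in I$. In this case, the Hilbert space may be chosen as a real Hilbert space and moreover, $(T_t)_{t\geq 0}$ is a $w^*$-continuous semigroup.
   Context: Elements of $B(\ell^2_I)$ are identified with their matrices $[b_{ij}]_{i,j\in I}$. For a matrix $C=[c_{ij}]_{i,j\in I}$ with complex entries, the (unbounded) Schur multiplier on $B(\ell^2_I)$ associated with $C$ is the linear operator $M_C$ whose domain is the space of all $B=[b_{ij}]_{i,j\in I}\in B(\ell^2_I)$ such that $[c_{ij}b_{ij}]_{i,j\in I}$ belongs to $B(\ell^2_I)$, with $M_C(B)=[c_{ij}b_{ij}]_{i,j\in I}$. It is a bounded Schur multiplier $M_C\colon B(\ell^2_I)\to B(\ell^2_I)$ when its domain is all of $B(\ell^2_I)$ (boundedness then follows from the closed graph theorem), and contractive if moreover its operator norm is at most $1$. A normal contraction $T\colon B(\ell^2_I)\to B(\ell^2_I)$ is selfadjoint if $\mathrm{Tr}\big(T(x)y^*\big)=\mathrm{Tr}\big(x(T(y))^*\big)$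 for all trace class $x,y$, where $\mathrm{Tr}$ is the canonical trace; a contractive Schur multiplier $M_C$ is selfadjoint if and only if $C$ is a real matrix. The semigroup $(T_t)_{t\ge0}$ is $w^*$-continuous if $t\mapsto T_t x$ is continuous for the weak* topology of $B(\ell^2_I)$ for every $x\in B(\ell^2_I)$. *)

theory Defs
  imports "HOL-Analysis.Analysis"
begin

section \<open>The spaces of square-summable families\<close>

text \<open>
  The type \<open>('i, 'a) ell2\<close> is the space of square-summable families indexed by \<open>'i\<close> with values
  in \<open>'a\<close>; thus \<open>('i, complex) ell2\<close> is the complex Hilbert space on \<open>'i\<close> and \<open>('i, real) ell2\<close>
  the real one.  The class \<open>real_inner\<close> only sees the real part of a complex inner product,
  which determines the same norm.
  Two families indexed by \<open>'i\<close> in any Hilbert space lie in a closed subspace whose dimension is at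
  most that of \<open>('i + 'i, _) ell2\<close>; this space can therefore stand for an existentially quantified
  Hilbert space.
\<close>

typedef (overloaded) ('i, 'a::real_inner) ell2 =
    "{x :: 'i \<Rightarrow> 'a. (\<lambda>i. (norm (x i))\<^sup>2) summable_on UNIV}"
  morphisms coord Abs_ell2
  by (rule exI[of _ "\<lambda>_. 0"]) simp

lemma coord_summable: "(\<lambda>i. (norm (coord x i))\<^sup>2) summable_on UNIV"
  using coord[of x] by simp

lemma ell2_eqI: "(\<And>i. coord x i = coord y i) \<Longrightarrow> x = y"
  by (simp add: coord_inject[symmetric] fun_eq_iff)

lemma square_summable_add:
  fixes x y :: "'i \<Rightarrow> 'a::real_inner"
  assumes "(\<lambda>i. (norm (x i))\<^sup>2) summable_on UNIV" "(\<lambda>i. (norm (y i))\<^sup>2) summable_on UNIV"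
  shows "(\<lambda>i. (norm (x i + y i))\<^sup>2) summable_on UNIV"
proof (rule summable_on_comparison_test)
  show "(\<lambda>i. 2 * (norm (x i))\<^sup>2 + 2 * (norm (y i))\<^sup>2) summable_on UNIV"
    by (intro summable_on_add summable_on_cmult_right assms)
  show "(norm (x i + y i))\<^sup>2 \<le> 2 * (norm (x i))\<^sup>2 + 2 * (norm (y i))\<^sup>2" for i
  proof -
    have "(norm (x i + y i))\<^sup>2 \<le> (norm (x i) + norm (y i))\<^sup>2"
      by (intro power_mono norm_triangle_ineq) auto
    also have "\<dots> \<le> 2 * (norm (x i))\<^sup>2 + 2 * (norm (y i))\<^sup>2"
      using sum_squares_bound[of "norm (x i)" "norm (y i)"] by (simp add: power2_sum)
    finally show ?thesis .
  qed
qed auto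

lemma square_summable_scale:
  fixes x :: "'i \<Rightarrow> 'a::real_inner"
  assumes "(\<lambda>i. (norm (x i))\<^sup>2) summable_on UNIV"
  shows "(\<lambda>i. (norm (r *\<^sub>R x i))\<^sup>2) summable_on UNIV"
  using summable_on_cmult_right[OF assms, of "r\<^sup>2"] by (simp add: power_mult_distrib)

lemma inner_summable:
  fixes x y :: "'i \<Rightarrow> 'a::real_inner"
  assumes "(\<lambda>i. (norm (x i))\<^sup>2) summable_on UNIV" "(\<lambda>i. (norm (y i))\<^sup>2) summable_on UNIV"
  shows "(\<lambda>i. inner (x i) (y i)) summable_on UNIV"
proof -
  have "(\<lambda>i. norm (inner (x i) (y i))) summable_on UNIV"
  proof (rule summable_on_comparison_test)
    show "(\<lambda>i. (norm (x i))\<^sup>2 + (norm (y i))\<^sup>2) summable_on UNIV"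
      by (intro summable_on_add assms)
    show "norm (inner (x i) (y i)) \<le> (norm (x i))\<^sup>2 + (norm (y i))\<^sup>2" for i
    proof -
      have "\<bar>inner (x i) (y i)\<bar> \<le> norm (x i) * norm (y i)"
        by (rule Cauchy_Schwarz_ineq2)
      moreover have "2 * norm (x i) * norm (y i) \<le> (norm (x i))\<^sup>2 + (norm (y i))\<^sup>2"
        by (rule sum_squares_bound)
      moreover have "0 \<le> norm (x i) * norm (y i)" by simp
      ultimately show ?thesis unfolding real_norm_def by linarith
    qed
  qed auto
  then show ?thesis by (rule abs_summable_summable)
qed

instantiation ell2 :: (type, real_inner) real_inner
begin

definition zero_ell2 :: "('a, 'b) ell2" where "0 = Abs_ell2 (\<lambda>_. 0)"
definition plus_ell2 :: "('a, 'b) ell2 \<Rightarrow> ('a, 'b) ell2 \<Rightarrow> ('a, 'b) ell2"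
  where "x + y = Abs_ell2 (\<lambda>i. coord x i + coord y i)"
definition scaleR_ell2 :: "real \<Rightarrow> ('a, 'b) ell2 \<Rightarrow> ('a, 'b) ell2"
  where "r *\<^sub>R x = Abs_ell2 (\<lambda>i. r *\<^sub>R coord x i)"
definition uminus_ell2 :: "('a, 'b) ell2 \<Rightarrow> ('a, 'b) ell2" where "- x = (-1) *\<^sub>R x"
  for x :: "('a, 'b) ell2"
definition minus_ell2 :: "('a, 'b) ell2 \<Rightarrow> ('a, 'b) ell2 \<Rightarrow> ('a, 'b) ell2"
  where "x - y = x + (- y)" for x y :: "('a, 'b) ell2"
definition inner_ell2 :: "('a, 'b) ell2 \<Rightarrow> ('a, 'b) ell2 \<Rightarrow> real"
  where "inner x y = (\<Sum>\<^sub>\<infinity>i. inner (coord x i) (coord y i))"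
definition norm_ell2 :: "('a, 'b) ell2 \<Rightarrow> real" where "norm x = sqrt (inner x x)" for x :: "('a, 'b) ell2"
definition dist_ell2 :: "('a, 'b) ell2 \<Rightarrow> ('a, 'b) ell2 \<Rightarrow> real"
  where "dist x y = norm (x - y)" for x y :: "('a, 'b) ell2"
definition sgn_ell2 :: "('a, 'b) ell2 \<Rightarrow> ('a, 'b) ell2"
  where "sgn x = inverse (norm x) *\<^sub>R x" for x :: "('a, 'b) ell2"
definition uniformity_ell2 :: "(('a, 'b) ell2 \<times> ('a, 'b) ell2) filter"
  where "uniformity = (INF e\<in>{0<..}. principal {(x :: ('a, 'b) ell2, y). dist x y < e})"
definition open_ell2 :: "('a, 'b) ell2 set \<Rightarrow> bool"
  where "open U = (\<forall>x\<in>U. eventually (\<lambda>(x', y). x' = x \<longrightarrow> y \<in> U) uniformity)"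
  for U :: "('a, 'b) ell2 set"

lemma coord_zero [simp]: "coord (0 :: ('a, 'b) ell2) i = 0"
  by (simp add: zero_ell2_def Abs_ell2_inverse)

lemma coord_plus [simp]: "coord (x + y) i = coord x i + coord y i" for x y :: "('a, 'b) ell2"
  by (simp add: plus_ell2_def Abs_ell2_inverse square_summable_add coord_summable)

lemma coord_scaleR [simp]: "coord (r *\<^sub>R x) i = r *\<^sub>R coord x i" for x :: "('a, 'b) ell2"
  using square_summable_scale[OF coord_summable[of x], of r]
  by (simp add: scaleR_ell2_def Abs_ell2_inverse)

lemma coord_uminus [simp]: "coord (- x) i = - coord x i" for x :: "('a, 'b) ell2"
  by (simp add: uminus_ell2_def)

lemma coord_minus [simp]: "coord (x - y) i = coord x i - coord y i" for x y :: "('a, 'b) ell2"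
  by (simp add: minus_ell2_def)

instance
proof
  fix x y z :: "('a, 'b) ell2" and a b r :: real
  show "x + y + z = x + (y + z)" by (rule ell2_eqI) (simp add: add.assoc)
  show "x + y = y + x" by (rule ell2_eqI) (simp add: add.commute)
  show "0 + x = x" by (rule ell2_eqI) simp
  show "- x + x = 0" by (rule ell2_eqI) simp
  show "x - y = x + - y" by (simp add: minus_ell2_def)
  show "a *\<^sub>R (x + y) = a *\<^sub>R x + a *\<^sub>R y" by (rule ell2_eqI) (simp add: scaleR_add_right)
  show "(a + b) *\<^sub>R x = a *\<^sub>R x + b *\<^sub>R x" by (rule ell2_eqI) (simp add: scaleR_add_left)
  show "a *\<^sub>R b *\<^sub>R x = (a * b) *\<^sub>R x" by (rule ell2_eqI) simp
  show "1 *\<^sub>R x = x" by (rule ell2_eqI) simp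
  show "sgn x = inverse (norm x) *\<^sub>R x" by (rule sgn_ell2_def)
  show "dist x y = norm (x - y)" by (rule dist_ell2_def)
  show "uniformity = (INF e\<in>{0<..}. principal {(x :: ('a, 'b) ell2, y). dist x y < e})"
    by (rule uniformity_ell2_def)
  show "open U = (\<forall>x\<in>U. eventually (\<lambda>(x', y). x' = x \<longrightarrow> y \<in> U) uniformity)"
    for U :: "('a, 'b) ell2 set" by (rule open_ell2_def)
  show "inner x y = inner y x" by (simp add: inner_ell2_def inner_commute)
  show "inner (x + y) z = inner x z + inner y z"
    by (simp add: inner_ell2_def inner_add_left infsum_add inner_summable coord_summable)
  show "inner (r *\<^sub>R x) y = r * inner x y"
    by (simp add: inner_ell2_def infsum_cmult_right')
  show "0 \<le> inner x x" by (simp add: inner_ell2_def infsum_nonneg)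
  show "inner x x = 0 \<longleftrightarrow> x = 0"
  proof
    assume *: "inner x x = 0"
    have "inner (coord x i) (coord x i) = 0" for i
      by (rule nonneg_infsum_le_0D[where A = UNIV and f = "\<lambda>i. inner (coord x i) (coord x i)"])
         (use * in \<open>auto simp: inner_ell2_def intro!: inner_summable coord_summable\<close>)
    then show "x = 0" by (intro ell2_eqI) simp
  qed (simp add: inner_ell2_def)
  show "norm x = sqrt (inner x x)" by (rule norm_ell2_def)
qed

end

lemma norm_ell2_square: "(norm x)\<^sup>2 = (\<Sum>\<^sub>\<infinity>i. (norm (coord x i))\<^sup>2)" for x :: "('i, 'a::real_inner) ell2"
  by (simp add: power2_norm_eq_inner inner_ell2_def)

lemma finite_sum_le_norm_ell2:
  fixes x :: "('i, 'a::real_inner) ell2"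
  assumes "finite F"
  shows "(\<Sum>i\<in>F. (norm (coord x i))\<^sup>2) \<le> (norm x)\<^sup>2"
  unfolding norm_ell2_square
  by (rule finite_sum_le_infsum) (use assms coord_summable in auto)

lemma norm_coord_le: "norm (coord x i) \<le> norm x" for x :: "('i, 'a::real_inner) ell2"
  by (rule power2_le_imp_le) (use finite_sum_le_norm_ell2[of "{i}" x] in auto)

instance ell2 :: (type, "{real_inner, complete_space}") complete_space
proof
  fix X :: "nat \<Rightarrow> ('a, 'b) ell2"
  assume X: "Cauchy X"
  have "Cauchy (\<lambda>n. coord (X n) i)" for i
  proof (rule metric_CauchyI)
    fix e :: real assume "0 < e"
    then obtain M where "\<forall>m\<ge>M. \<forall>n\<ge>M. dist (X m) (X n) < e"
      using metric_CauchyD[OF X] by blast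
    moreover have "dist (coord (X m) i) (coord (X n) i) \<le> dist (X m) (X n)" for m n
      using norm_coord_le[of "X m - X n" i] by (simp add: dist_norm)
    ultimately show "\<exists>M. \<forall>m\<ge>M. \<forall>n\<ge>M. dist (coord (X m) i) (coord (X n) i) < e"
      by (meson le_less_trans)
  qed
  then have "\<exists>l. (\<lambda>n. coord (X n) i) \<longlonglongrightarrow> l" for i
    using Cauchy_convergent unfolding convergent_def by blast
  then obtain l where l: "\<And>i. (\<lambda>n. coord (X n) i) \<longlonglongrightarrow> l i"
    by metis
  have bound: "(\<Sum>i\<in>F. (norm (l i - coord (X n) i))\<^sup>2) \<le> e\<^sup>2"
    if "\<forall>m\<ge>M. \<forall>n\<ge>M. dist (X m) (X n) < e" "n \<ge> M" "finite F" for M n e and F :: "'a set"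
  proof (rule tendsto_upperbound)
    show "(\<lambda>m. \<Sum>i\<in>F. (norm (coord (X m) i - coord (X n) i))\<^sup>2)
            \<longlonglongrightarrow> (\<Sum>i\<in>F. (norm (l i - coord (X n) i))\<^sup>2)"
      by (intro tendsto_intros l)
    have "(\<Sum>i\<in>F. (norm (coord (X m) i - coord (X n) i))\<^sup>2) \<le> e\<^sup>2" if "m \<ge> M" for m
    proof -
      have "(\<Sum>i\<in>F. (norm (coord (X m) i - coord (X n) i))\<^sup>2) \<le> (norm (X m - X n))\<^sup>2"
        using finite_sum_le_norm_ell2[OF \<open>finite F\<close>, of "X m - X n"] by simp
      also have "\<dots> \<le> e\<^sup>2"
      proof (rule power_mono)
        have "dist (X m) (X n) < e"
          using \<open>\<forall>m\<ge>M. \<forall>n\<ge>M. dist (X m) (X n) < e\<close> \<open>n \<ge> M\<close> that by blast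
        then show "norm (X m - X n) \<le> e" by (simp only: dist_norm less_imp_le)
      qed simp
      finally show ?thesis .
    qed
    then show "\<forall>\<^sub>F m in sequentially. (\<Sum>i\<in>F. (norm (coord (X m) i - coord (X n) i))\<^sup>2) \<le> e\<^sup>2"
      using eventually_sequentially by blast
  qed simp
  have summ: "(\<lambda>i. (norm (l i - coord (X n) i))\<^sup>2) summable_on UNIV"
    if "\<forall>m\<ge>M. \<forall>n\<ge>M. dist (X m) (X n) < e" "n \<ge> M" for M n e
  proof (rule nonneg_bdd_above_summable_on)
    show "bdd_above (sum (\<lambda>i. (norm (l i - coord (X n) i))\<^sup>2) ` {F. F \<subseteq> UNIV \<and> finite F})"
      by (rule bdd_aboveI2[where M = "e\<^sup>2"]) (rule bound[OF that], simp)
  qed simp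
  obtain M where M: "\<forall>m\<ge>M. \<forall>n\<ge>M. dist (X m) (X n) < 1"
    using metric_CauchyD[OF X zero_less_one] by blast
  have "(\<lambda>i. (norm (l i - coord (X M) i + coord (X M) i))\<^sup>2) summable_on UNIV"
    by (rule square_summable_add[OF summ[OF M order_refl] coord_summable])
  then have cl: "coord (Abs_ell2 l) = l" by (simp add: Abs_ell2_inverse)
  have "X \<longlonglongrightarrow> Abs_ell2 l"
  proof (rule metric_LIMSEQ_I)
    fix e :: real assume "0 < e"
    then have e: "0 < e / 2" by simp
    obtain M where M: "\<forall>m\<ge>M. \<forall>n\<ge>M. dist (X m) (X n) < e / 2"
      using metric_CauchyD[OF X e] by blast
    have "dist (X n) (Abs_ell2 l) < e" if n: "n \<ge> M" for n
    proof -
      have "(norm (Abs_ell2 l - X n))\<^sup>2 = (\<Sum>\<^sub>\<infinity>i. (norm (l i - coord (X n) i))\<^sup>2)"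
        unfolding norm_ell2_square coord_minus cl ..
      also have "\<dots> \<le> (e / 2)\<^sup>2"
        by (rule infsum_le_finite_sums[OF summ[OF M n]]) (rule bound[OF M n])
      finally have "norm (Abs_ell2 l - X n) \<le> e / 2"
        by (rule power2_le_imp_le) (use e in simp)
      moreover have "dist (X n) (Abs_ell2 l) = norm (Abs_ell2 l - X n)"
        by (simp only: dist_norm norm_minus_commute)
      ultimately show ?thesis using \<open>0 < e\<close> by linarith
    qed
    then show "\<exists>M. \<forall>n\<ge>M. dist (X n) (Abs_ell2 l) < e" by blast
  qed
  then show "convergent X" unfolding convergent_def by blast
qed

definition cscale :: "complex \<Rightarrow> ('i, complex) ell2 \<Rightarrow> ('i, complex) ell2"
  where "cscale c x = Abs_ell2 (\<lambda>i. c * coord x i)"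

text \<open>Linear in the first variable; its real part is \<^const>\<open>inner\<close>.\<close>
definition cinner :: "('i, complex) ell2 \<Rightarrow> ('i, complex) ell2 \<Rightarrow> complex"
  where "cinner x y = (\<Sum>\<^sub>\<infinity>i. coord x i * cnj (coord y i))"

definition unit_vec :: "'i \<Rightarrow> ('i, complex) ell2"
  where "unit_vec j = Abs_ell2 (\<lambda>k. if k = j then 1 else 0)"


section \<open>Bounded operators, trace class operators and the weak* topology\<close>

text \<open>
  \<^typ>\<open>('i, complex) ell2 \<Rightarrow>\<^sub>L ('i, complex) ell2\<close> consists of the bounded real-linear maps, with the
  operator norm; the bounded operators in the sense of complex Hilbert spaces are the
  complex-linear ones.
\<close>

type_synonym 'i oper = "('i, complex) ell2 \<Rightarrow>\<^sub>L ('i, complex) ell2"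

definition Bl2 :: "'i oper set"
  where "Bl2 = {T. \<forall>c x. blinfun_apply T (cscale c x) = cscale c (blinfun_apply T x)}"

definition opmat :: "'i oper \<Rightarrow> 'i \<Rightarrow> 'i \<Rightarrow> complex"
  where "opmat T i j = cinner (blinfun_apply T (unit_vec j)) (unit_vec i)"

definition adj :: "'i oper \<Rightarrow> 'i oper"
  where "adj T = (THE S. S \<in> Bl2 \<and>
    (\<forall>x y. cinner (blinfun_apply S x) y = cinner x (blinfun_apply T y)))"

definition pos_op :: "'i oper \<Rightarrow> bool"
  where "pos_op P \<longleftrightarrow> P \<in> Bl2 \<and> (\<forall>x. cinner (blinfun_apply P x) x \<in> \<real>\<^sub>\<ge>\<^sub>0)"

definition is_abs_op :: "'i oper \<Rightarrow> 'i oper \<Rightarrow> bool"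
  where "is_abs_op P T \<longleftrightarrow> pos_op P \<and> P o\<^sub>L P = adj T o\<^sub>L T"

definition trace_class :: "'i oper set"
  where "trace_class = {T \<in> Bl2. \<exists>P. is_abs_op P T \<and> (\<lambda>i. Re (opmat P i i)) summable_on UNIV}"

definition Tr :: "'i oper \<Rightarrow> complex"
  where "Tr T = (\<Sum>\<^sub>\<infinity>i. opmat T i i)"

text \<open>
  The trace duality identifies the bounded operators with the dual of the trace class; the weak*
  topology is the coarsest one that makes all functionals \<open>x \<mapsto> Tr (x y)\<close>, \<open>y\<close> trace class,
  continuous.
\<close>
definition weak_star :: "'i oper topology"
  where "weak_star = pullback_topology Bl2 (\<lambda>x. \<lambda>y\<in>trace_class. Tr (x o\<^sub>L y))
    (product_topology (\<lambda>_. euclidean) trace_class)"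


section \<open>Schur multipliers\<close>

text \<open>The domain and the action of the unbounded Schur multiplier associated with \<open>C\<close>.\<close>

definition schur_dom :: "('i \<Rightarrow> 'i \<Rightarrow> complex) \<Rightarrow> 'i oper set"
  where "schur_dom C = {B \<in> Bl2. \<exists>D\<in>Bl2. opmat D = (\<lambda>i j. C i j * opmat B i j)}"

definition schur_mult :: "('i \<Rightarrow> 'i \<Rightarrow> complex) \<Rightarrow> 'i oper \<Rightarrow> 'i oper"
  where "schur_mult C B = (THE D. D \<in> Bl2 \<and> opmat D = (\<lambda>i j. C i j * opmat B i j))"

definition contractive_map :: "('i oper \<Rightarrow> 'i oper) \<Rightarrow> bool"
  where "contractive_map T \<longleftrightarrow> (\<forall>B\<in>Bl2. norm (T B) \<le> norm B)"

definition contractive_schur :: "('i oper \<Rightarrow> 'i oper) \<Rightarrow> bool"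
  where "contractive_schur T \<longleftrightarrow>
    (\<exists>C. schur_dom C = Bl2 \<and> (\<forall>B\<in>Bl2. T B = schur_mult C B)) \<and> contractive_map T"

text \<open>Normality is weak*-continuity.  Maps are only relevant on \<^const>\<open>Bl2\<close>.\<close>
definition selfadjoint_map :: "('i oper \<Rightarrow> 'i oper) \<Rightarrow> bool"
  where "selfadjoint_map T \<longleftrightarrow>
    continuous_map weak_star weak_star T \<and> contractive_map T \<and>
    (\<forall>x\<in>trace_class. \<forall>y\<in>trace_class. Tr (T x o\<^sub>L adj y) = Tr (x o\<^sub>L adj (T y)))"

definition selfadjoint_schur_semigroup :: "(real \<Rightarrow> 'i oper \<Rightarrow> 'i oper) \<Rightarrow> bool"
  where "selfadjoint_schur_semigroup S \<longleftrightarrow>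
    (\<forall>t\<ge>0. contractive_schur (S t) \<and> selfadjoint_map (S t)) \<and>
    (\<forall>B\<in>Bl2. S 0 B = B) \<and>
    (\<forall>s\<ge>0. \<forall>t\<ge>0. \<forall>B\<in>Bl2. S (s + t) B = S s (S t B))"

definition exp_matrix :: "('i \<Rightarrow> 'i \<Rightarrow> complex) \<Rightarrow> real \<Rightarrow> 'i \<Rightarrow> 'i \<Rightarrow> complex"
  where "exp_matrix A t = (\<lambda>i j. exp (- (complex_of_real t * A i j)))"

definition extends_exp_schur ::
    "('i \<Rightarrow> 'i \<Rightarrow> complex) \<Rightarrow> (real \<Rightarrow> 'i oper \<Rightarrow> 'i oper) \<Rightarrow> bool"
  where "extends_exp_schur A S \<longleftrightarrow>
    (\<forall>t\<ge>0. \<forall>B\<in>schur_dom (exp_matrix A t). S t B = schur_mult (exp_matrix A t) B)"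

definition wstar_continuous :: "(real \<Rightarrow> 'i oper \<Rightarrow> 'i oper) \<Rightarrow> bool"
  where "wstar_continuous S \<longleftrightarrow>
    (\<forall>x\<in>Bl2. continuous_map (top_of_set {0..}) weak_star (\<lambda>t. S t x))"

end

theory Submission
  imports Defs
begin

text \<open>
  If \<open>a\<^sub>i\<^sub>j = \<parallel>\<alpha>\<^sub>i - \<beta>\<^sub>j\<parallel>\<^sup>2\<close>, then \<open>exp (- t a\<^sub>i\<^sub>j)\<close> is the off-diagonal block of the Gaussian kernel of the joint
  family \<open>(\<alpha>, \<beta>)\<close>.  That kernel is positive semidefinite with unit diagonal (Schur product theorem and
  exponential series), and a positive semidefinite kernel on any set is the Gram kernel of vectors
  (\<open>psd_gram\<close>).  So \<open>exp (- t a\<^sub>i\<^sub>j) = \<langle>u\<^sub>i, v\<^sub>j\<rangle>\<close> with unit vectors, and the multiplier is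
  \<open>B \<mapsto> \<Sum>\<^sub>s D(u(s)) B D(v(s))\<close> with diagonal matrices whose squares add up to the identity; this is a
  contraction (\<open>form_bounded_schur\<close>).  It is selfadjoint because its matrix is real.

  Weak* continuity needs some trace class theory.  If \<open>|T| = G G\<^sup>*\<close> and \<open>T = U |T|\<close> is the polar
  decomposition, then \<open>T = (U G) G\<^sup>*\<close> is a product \<open>H K\<^sup>*\<close> of Hilbert-Schmidt matrices
  (\<open>trace_class_nuclear\<close>), and \<open>Tr (x T) = \<langle>(x \<otimes> 1) H, K\<rangle>\<close>.  Multiplying \<open>H K\<^sup>*\<close> entrywise by the matrix
  \<open>\<langle>v\<^sub>i, u\<^sub>j\<rangle>\<close> gives a product of the same kind, which is a combination of four positive trace class
  operators by polarization; so the multiplier is weak* continuous.  The same formula for the trace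
  shows that a bounded family of operators with continuous entries is weak* continuous, which gives
  continuity in \<open>t\<close>.

  For the converse, testing on matrix units shows that the semigroup consists of the multipliers with
  matrix \<open>exp (- t a\<^sub>i\<^sub>j)\<close> and that \<open>a\<^sub>i\<^sub>j\<close> is real and nonnegative.  On a finite set, a real contractive
  Schur multiplier is, up to any \<open>\<epsilon>\<close>, the off-diagonal block of a positive semidefinite kernel
  with unit diagonal: otherwise a separating functional would produce a contraction whose Schur
  product is not one (\<open>psd_dilation_approx\<close>).  In Gram vectors \<open>z\<close> of such a kernel,
  \<open>\<parallel>z\<^sub>i - z\<^sub>j\<parallel>\<^sup>2 / 2t\<close> is about \<open>(1 - exp (- t a\<^sub>i\<^sub>j)) / t\<close>, hence close to \<open>a\<^sub>i\<^sub>j\<close> for small \<open>t\<close>.  Each of these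
  rescaled distances is bounded independently of \<open>t\<close>, so by Tychonoff's theorem the Gram kernels of
  the rescaled vectors, based at one of them, have a limit point; its Gram vectors are the required families
  (\<open>limit_kernel\<close>).
\<close>

section \<open>Square-summable families\<close>

lemma ell2_of_bounded_sums:
  fixes f :: "'i \<Rightarrow> 'a::real_inner"
  assumes "\<And>F. finite F \<Longrightarrow> (\<Sum>i\<in>F. (norm (f i))\<^sup>2) \<le> B"
  shows "coord (Abs_ell2 f) = f" and "(norm (Abs_ell2 f))\<^sup>2 \<le> B"
proof -
  have s: "(\<lambda>i. (norm (f i))\<^sup>2) summable_on UNIV"
    by (rule nonneg_bdd_above_summable_on) (auto intro!: bdd_aboveI2[where M = B] assms)
  then show *: "coord (Abs_ell2 f) = f" by (simp add: Abs_ell2_inverse)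
  show "(norm (Abs_ell2 f))\<^sup>2 \<le> B"
    unfolding norm_ell2_square * by (rule infsum_le_finite_sums[OF s]) (use assms in auto)
qed

lemma coord_sum [simp]: "coord (\<Sum>i\<in>F. f i) k = (\<Sum>i\<in>F. coord (f i) k)"
  by (induction F rule: infinite_finite_induct) auto

lemma bounded_linear_coord: "bounded_linear (\<lambda>x. coord x i)"
  by (rule bounded_linear_intro[where K = 1]) (auto simp: norm_coord_le)

definition fin_vec :: "'i set \<Rightarrow> ('i \<Rightarrow> 'a::real_inner) \<Rightarrow> ('i, 'a) ell2"
  where "fin_vec F f = Abs_ell2 (\<lambda>i. if i \<in> F then f i else 0)"

lemma coord_fin_vec [simp]:
  assumes "finite F"
  shows "coord (fin_vec F f) i = (if i \<in> F then f i else 0)"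
proof -
  have "(\<lambda>i. (norm (if i \<in> F then f i else 0))\<^sup>2) summable_on UNIV"
    by (rule finite_nonzero_values_imp_summable_on) (auto intro: finite_subset[OF _ assms])
  then show ?thesis by (simp add: fin_vec_def Abs_ell2_inverse)
qed

lemma norm_fin_vec_square:
  assumes "finite F"
  shows "(norm (fin_vec F f))\<^sup>2 = (\<Sum>i\<in>F. (norm (f i))\<^sup>2)"
proof -
  have "(norm (fin_vec F f))\<^sup>2 = (\<Sum>\<^sub>\<infinity>i\<in>F. (norm (f i))\<^sup>2)"
    unfolding norm_ell2_square by (rule infsum_cong_neutral) (use assms in auto)
  then show ?thesis using assms by simp
qed

lemma tendsto_fin_vec: "((\<lambda>F. fin_vec F (coord x)) \<longlongrightarrow> x) (finite_subsets_at_top UNIV)"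
proof -
  let ?t = "\<lambda>F. fin_vec F (coord x)"
  have eq: "(norm (x - ?t F))\<^sup>2 = (norm x)\<^sup>2 - (\<Sum>i\<in>F. (norm (coord x i))\<^sup>2)"
    if "finite F" for F
  proof -
    have "inner (x - ?t F) (?t F) = 0"
      unfolding inner_ell2_def by (rule infsum_0) (use that in auto)
    then have "(norm x)\<^sup>2 = (norm (x - ?t F))\<^sup>2 + (norm (?t F))\<^sup>2"
      using dot_norm[of "x - ?t F" "?t F"] by simp
    then show ?thesis using norm_fin_vec_square[OF that, of "coord x"] by simp
  qed
  have "((\<lambda>F. \<Sum>i\<in>F. (norm (coord x i))\<^sup>2) \<longlongrightarrow> (norm x)\<^sup>2) (finite_subsets_at_top UNIV)"
    unfolding norm_ell2_square by (rule infsum_tendsto[OF coord_summable])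
  then have "((\<lambda>F. (norm x)\<^sup>2 - (\<Sum>i\<in>F. (norm (coord x i))\<^sup>2)) \<longlongrightarrow> (norm x)\<^sup>2 - (norm x)\<^sup>2)
      (finite_subsets_at_top UNIV)"
    by (intro tendsto_intros)
  then have "((\<lambda>F. (norm (x - ?t F))\<^sup>2) \<longlongrightarrow> 0) (finite_subsets_at_top UNIV)"
    by (subst tendsto_cong[OF eventually_mono[OF eventually_finite_subsets_at_top_weakI]])
       (auto simp: eq)
  then have "((\<lambda>F. sqrt ((norm (x - ?t F))\<^sup>2)) \<longlongrightarrow> sqrt 0) (finite_subsets_at_top UNIV)"
    by (rule tendsto_real_sqrt)
  then have "((\<lambda>F. x - ?t F) \<longlongrightarrow> 0) (finite_subsets_at_top UNIV)"
    by (simp add: tendsto_norm_zero_iff)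
  then show ?thesis
    using tendsto_diff[OF tendsto_const[of x]] by fastforce
qed

lemma eventually_finite_sets: "\<forall>\<^sub>F F in finite_subsets_at_top A. finite F"
  by (rule eventually_finite_subsets_at_top_weakI)

lemma coord_cscale [simp]: "coord (cscale c x) i = c * coord x i"
proof -
  have "(\<lambda>i. (norm (c * coord x i))\<^sup>2) summable_on UNIV"
    using summable_on_cmult_right[OF coord_summable[of x], of "(norm c)\<^sup>2"]
    by (simp add: norm_mult power_mult_distrib)
  then show ?thesis by (simp add: cscale_def Abs_ell2_inverse)
qed

lemma coord_unit_vec [simp]: "coord (unit_vec j) i = (if i = j then 1 else 0)"
proof -
  have "(\<lambda>i. (norm (if i = j then 1 else 0 :: complex))\<^sup>2) summable_on UNIV"
    by (rule finite_nonzero_values_imp_summable_on) (auto intro: finite_subset[of _ "{j}"])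
  then show ?thesis by (simp add: unit_vec_def Abs_ell2_inverse)
qed

lemma cscale_add_right: "cscale c (x + y) = cscale c x + cscale c y"
  and cscale_of_real: "cscale (of_real r) x = r *\<^sub>R x"
  by (rule ell2_eqI, simp add: algebra_simps scaleR_conv_of_real)+

lemma norm_cscale: "norm (cscale c x) = norm c * norm x"
proof -
  have "(norm (cscale c x))\<^sup>2 = (norm c * norm x)\<^sup>2"
    unfolding norm_ell2_square power_mult_distrib
    by (simp add: norm_mult power_mult_distrib infsum_cmult_right')
  then show ?thesis by (simp add: power2_eq_iff_nonneg)
qed

lemma bounded_linear_cscale: "bounded_linear (cscale c)"
proof (rule bounded_linear_intro[where K = "norm c"])
  show "cscale c (r *\<^sub>R x) = r *\<^sub>R cscale c x" for r x
    by (rule ell2_eqI) simp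
qed (auto simp: cscale_add_right norm_cscale)

lemma norm_unit_vec [simp]: "norm (unit_vec i) = 1"
proof -
  have "(norm (unit_vec i))\<^sup>2 = (\<Sum>\<^sub>\<infinity>k\<in>{i}. 1)"
    unfolding norm_ell2_square by (rule infsum_cong_neutral) auto
  then have "(norm (unit_vec i))\<^sup>2 = 1\<^sup>2" by simp
  then show ?thesis by (rule power2_eq_imp_eq) auto
qed

lemma fin_vec_eq_sum: "finite F \<Longrightarrow> fin_vec F f = (\<Sum>i\<in>F. cscale (f i) (unit_vec i))"
  by (rule ell2_eqI) (simp add: if_distrib sum.delta' cong: if_cong)

lemma mult_coord_abs_summable:
  fixes x y :: "('i, complex) ell2"
  shows "(\<lambda>i. norm (coord x i * coord y i)) summable_on UNIV"
  by (rule abs_summable_product)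
     (use coord_summable[of x] coord_summable[of y] in \<open>simp_all add: norm_mult power2_eq_square\<close>)

lemma mult_cnj_coord_abs_summable:
  fixes x y :: "('i, complex) ell2"
  shows "(\<lambda>i. norm (coord x i * cnj (coord y i))) summable_on UNIV"
  using mult_coord_abs_summable[of x y] by (simp add: norm_mult)

lemmas mult_cnj_coord_summable = abs_summable_summable[OF mult_cnj_coord_abs_summable]

lemma Re_cinner: "Re (cinner x y) = inner x y"
  unfolding cinner_def inner_ell2_def infsum_Re[OF mult_cnj_coord_summable, symmetric]
  by (simp add: inner_complex_def)

lemma cinner_add_left: "cinner (x + y) z = cinner x z + cinner y z"
  and cinner_add_right: "cinner z (x + y) = cinner z x + cinner z y"
  unfolding cinner_def
  by (simp_all add: algebra_simps infsum_add mult_cnj_coord_summable)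

lemma cinner_cscale_left [simp]: "cinner (cscale c x) y = c * cinner x y"
  and cinner_cscale_right [simp]: "cinner x (cscale c y) = cnj c * cinner x y"
proof -
  show "cinner (cscale c x) y = c * cinner x y"
    unfolding cinner_def by (simp add: mult.assoc infsum_cmult_right')
  have "coord x i * (cnj c * cnj (coord y i)) = cnj c * (coord x i * cnj (coord y i))" for i
    by (simp only: mult_ac)
  then show "cinner x (cscale c y) = cnj c * cinner x y"
    unfolding cinner_def coord_cscale complex_cnj_mult by (simp only: infsum_cmult_right')
qed

lemma cinner_scaleR_left: "cinner (r *\<^sub>R x) y = r *\<^sub>R cinner x y"
  and cinner_scaleR_right: "cinner x (r *\<^sub>R y) = r *\<^sub>R cinner x y"
  by (simp_all add: cscale_of_real[symmetric] scaleR_conv_of_real)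

lemma cnj_cinner: "cnj (cinner x y) = cinner y x"
  unfolding cinner_def by (simp add: mult.commute flip: infsum_cnj)

lemma norm_cinner_le: "norm (cinner x y) \<le> norm x * norm y"
proof (cases "cinner x y = 0")
  case False
  define c where "c = cnj (sgn (cinner x y))"
  have c: "norm c = 1" using False by (simp add: c_def norm_sgn)
  have "norm (cinner x y) = Re (c * cinner x y)"
  proof -
    have "c * cinner x y = of_real (norm (cinner x y))"
      unfolding c_def sgn_eq using False complex_norm_square[of "cinner x y"]
      by (simp add: power2_eq_square mult.commute divide_simps)
    then show ?thesis by simp
  qed
  also have "\<dots> = inner (cscale c x) y" by (simp add: Re_cinner[symmetric])
  also have "\<dots> \<le> norm (cscale c x) * norm y" by (rule norm_cauchy_schwarz)
  finally show ?thesis by (simp add: norm_cscale c)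
qed simp

lemma bounded_bilinear_cinner: "bounded_bilinear cinner"
proof (rule bounded_bilinear.intro)
  show "\<exists>K. \<forall>x y. norm (cinner x y) \<le> norm x * norm y * K"
    by (rule exI[of _ 1]) (simp add: norm_cinner_le)
qed (simp_all add: cinner_add_left cinner_add_right cinner_scaleR_left cinner_scaleR_right)

lemmas tendsto_cinner = bounded_bilinear.tendsto[OF bounded_bilinear_cinner]

lemma cinner_unit_vec_right [simp]: "cinner x (unit_vec i) = coord x i"
proof -
  have "cinner x (unit_vec i) = (\<Sum>\<^sub>\<infinity>k\<in>{i}. coord x k)"
    unfolding cinner_def by (rule infsum_cong_neutral) auto
  then show ?thesis by simp
qed

lemma cinner_unit_vec_left [simp]: "cinner (unit_vec i) x = cnj (coord x i)"
  using cnj_cinner[of x "unit_vec i"] by simp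

lemma cinner_self: "cinner x x = of_real ((norm x)\<^sup>2)"
proof -
  have "Im (cnj (cinner x x)) = Im (cinner x x)" by (simp only: cnj_cinner)
  then have "Im (cinner x x) = 0" by (simp only: cnj.simps)
  then show ?thesis
    using Re_cinner[of x x] by (simp add: complex_eq_iff power2_norm_eq_inner complex_is_Real_iff)
qed

lemma ell2_eq_of_inner: "(\<And>y. inner x y = inner x' y) \<Longrightarrow> x = x'"
proof -
  assume "\<And>y. inner x y = inner x' y"
  then have "inner (x - x') (x - x') = 0" by (simp add: inner_diff_left)
  then show ?thesis by simp
qed

section \<open>Bounded operators and their matrices\<close>

lemma Bl2_cscale: "T \<in> Bl2 \<Longrightarrow> blinfun_apply T (cscale c x) = cscale c (blinfun_apply T x)"
  by (simp add: Bl2_def)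

lemma opmat_eq_coord: "opmat T i j = coord (blinfun_apply T (unit_vec j)) i"
  by (simp add: opmat_def)

lemma Bl2_compose: "T \<in> Bl2 \<Longrightarrow> S \<in> Bl2 \<Longrightarrow> T o\<^sub>L S \<in> Bl2"
  by (simp add: Bl2_def)

lemma Bl2_apply_fin_vec:
  assumes "T \<in> Bl2" "finite F"
  shows "blinfun_apply T (fin_vec F f) = (\<Sum>j\<in>F. cscale (f j) (blinfun_apply T (unit_vec j)))"
  by (simp add: fin_vec_eq_sum assms blinfun.sum_right Bl2_cscale)

lemma tendsto_apply_fin_vec:
  "((\<lambda>F. blinfun_apply T (fin_vec F (coord x))) \<longlongrightarrow> blinfun_apply T x) (finite_subsets_at_top UNIV)"
  by (intro tendsto_intros tendsto_fin_vec)

lemma cinner_sum_left: "cinner (\<Sum>i\<in>F. f i) y = (\<Sum>i\<in>F. cinner (f i) y)"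
  by (rule bounded_linear.linear[THEN linear_sum, OF bounded_bilinear.bounded_linear_left[OF bounded_bilinear_cinner]])

lemma has_sum_cinner_apply:
  assumes "T \<in> Bl2"
  shows "((\<lambda>j. coord x j * cinner (blinfun_apply T (unit_vec j)) y) has_sum cinner (blinfun_apply T x) y) UNIV"
  unfolding has_sum_def
proof (rule Lim_transform_eventually)
  show "((\<lambda>F. cinner (blinfun_apply T (fin_vec F (coord x))) y) \<longlongrightarrow> cinner (blinfun_apply T x) y)
      (finite_subsets_at_top UNIV)"
    by (intro tendsto_cinner tendsto_apply_fin_vec tendsto_const)
  show "\<forall>\<^sub>F F in finite_subsets_at_top UNIV. cinner (blinfun_apply T (fin_vec F (coord x))) y =
      (\<Sum>j\<in>F. coord x j * cinner (blinfun_apply T (unit_vec j)) y)"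
    using eventually_finite_sets
    by eventually_elim (simp add: Bl2_apply_fin_vec[OF assms] cinner_sum_left)
qed

lemma has_sum_coord_apply:
  assumes "T \<in> Bl2"
  shows "((\<lambda>j. opmat T i j * coord x j) has_sum coord (blinfun_apply T x) i) UNIV"
  using has_sum_cinner_apply[OF assms, of x "unit_vec i"]
  by (simp add: opmat_eq_coord mult.commute)

lemma Bl2_eqI:
  assumes "T \<in> Bl2" "S \<in> Bl2" "opmat T = opmat S"
  shows "T = S"
proof (rule blinfun_eqI, rule ell2_eqI)
  fix x i
  show "coord (blinfun_apply T x) i = coord (blinfun_apply S x) i"
    using has_sum_coord_apply[OF assms(1), of i x] has_sum_coord_apply[OF assms(2), of i x]
    unfolding assms(3) by (rule has_sum_unique)
qed

lemma opmat_compose: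
  assumes "T \<in> Bl2"
  shows "opmat (T o\<^sub>L S) i j = (\<Sum>\<^sub>\<infinity>k. opmat T i k * opmat S k j)"
  using has_sum_coord_apply[OF assms, of i "blinfun_apply S (unit_vec j)"]
  by (simp add: opmat_eq_coord has_sum_iff)

text \<open>
  Replacing \<open>x, y\<close> by \<open>r x, y / r\<close> and minimizing over \<open>r\<close> turns this into the usual estimate by
  \<open>M \<parallel>x\<parallel> \<parallel>y\<parallel>\<close>.  Keeping the squares makes the right-hand side additive, so that estimates of this
  kind can be summed.
\<close>
definition form_bounded :: "('i \<Rightarrow> 'i \<Rightarrow> complex) \<Rightarrow> real \<Rightarrow> bool"
  where "form_bounded m M \<longleftrightarrow> (\<forall>F x y. finite F \<longrightarrow>
    Re (\<Sum>i\<in>F. \<Sum>j\<in>F. m i j * x j * cnj (y i)) \<le> M / 2 * ((\<Sum>i\<in>F. (norm (x i))\<^sup>2) + (\<Sum>i\<in>F. (norm (y i))\<^sup>2)))"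

lemma cinner_apply_fin_vec:
  assumes "T \<in> Bl2" "finite F"
  shows "cinner (blinfun_apply T (fin_vec F x)) (fin_vec F y) = (\<Sum>i\<in>F. \<Sum>j\<in>F. opmat T i j * x j * cnj (y i))"
proof -
  have "cinner (blinfun_apply T (fin_vec F x)) (fin_vec F y) =
      (\<Sum>\<^sub>\<infinity>i\<in>F. coord (blinfun_apply T (fin_vec F x)) i * cnj (y i))"
    unfolding cinner_def by (rule infsum_cong_neutral) (use assms in auto)
  also have "\<dots> = (\<Sum>i\<in>F. \<Sum>j\<in>F. opmat T i j * x j * cnj (y i))"
    using assms by (simp add: Bl2_apply_fin_vec opmat_eq_coord sum_distrib_left mult_ac)
  finally show ?thesis .
qed

lemma form_bounded_opmat:
  assumes "T \<in> Bl2" "norm T \<le> M"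
  shows "form_bounded (opmat T) M"
  unfolding form_bounded_def
proof (intro allI impI)
  fix F :: "'a set" and x y :: "'a \<Rightarrow> complex" assume F: "finite F"
  let ?X = "fin_vec F x" and ?Y = "fin_vec F y"
  have "Re (\<Sum>i\<in>F. \<Sum>j\<in>F. opmat T i j * x j * cnj (y i)) \<le> norm (cinner (blinfun_apply T ?X) ?Y)"
    unfolding cinner_apply_fin_vec[OF assms(1) F] by (rule complex_Re_le_cmod)
  also have "\<dots> \<le> norm (blinfun_apply T ?X) * norm ?Y" by (rule norm_cinner_le)
  also have "\<dots> \<le> (M * norm ?X) * norm ?Y"
    by (intro mult_right_mono order_trans[OF norm_blinfun] assms) auto
  also have "\<dots> = M * (norm ?X * norm ?Y)" by simp
  also have "\<dots> \<le> M * (((norm ?X)\<^sup>2 + (norm ?Y)\<^sup>2) / 2)"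
    using sum_squares_bound[of "norm ?X" "norm ?Y"] order_trans[OF norm_ge_zero assms(2)]
    by (intro mult_left_mono) auto
  finally show "Re (\<Sum>i\<in>F. \<Sum>j\<in>F. opmat T i j * x j * cnj (y i)) \<le>
      M / 2 * ((\<Sum>i\<in>F. (norm (x i))\<^sup>2) + (\<Sum>i\<in>F. (norm (y i))\<^sup>2))"
    by (simp add: norm_fin_vec_square F)
qed

text \<open>
  The bound of the form at \<open>y = t z\<close>, where \<open>z\<close> is the image of \<open>x\<close>, is a quadratic inequality in
  \<open>t\<close>, and \<open>t = 1 / M\<close> is the best choice.
\<close>
lemma form_bounded_column_sums:
  assumes m: "form_bounded m M" and M: "0 \<le> M" and fin: "finite I" "finite J"
  shows "(\<Sum>i\<in>I. (norm (\<Sum>j\<in>J. m i j * x j))\<^sup>2) \<le> M\<^sup>2 * (\<Sum>j\<in>J. (norm (x j))\<^sup>2)"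
proof -
  define z where "z i = (\<Sum>j\<in>J. m i j * x j)" for i
  define s where "s = (\<Sum>i\<in>I. (norm (z i))\<^sup>2)"
  define X where "X = (\<Sum>j\<in>J. (norm (x j))\<^sup>2)"
  have *: "t * s \<le> M / 2 * (X + t\<^sup>2 * s)" for t :: real
  proof -
    let ?x = "\<lambda>j. if j \<in> J then x j else 0" and ?y = "\<lambda>i. if i \<in> I then of_real t * z i else 0"
    have F: "finite (I \<union> J)" using fin by simp
    have "(\<Sum>i\<in>I\<union>J. \<Sum>j\<in>I\<union>J. m i j * ?x j * cnj (?y i)) =
        (\<Sum>i\<in>I\<union>J. (\<Sum>j\<in>I\<union>J. m i j * ?x j) * cnj (?y i))"
      by (simp add: sum_distrib_right)
    also have "\<dots> = (\<Sum>i\<in>I\<union>J. z i * cnj (?y i))"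
    proof (rule sum.cong[OF refl])
      fix i
      have "(\<Sum>j\<in>I\<union>J. m i j * ?x j) = z i"
        unfolding z_def by (rule sum.mono_neutral_cong_right) (use fin in auto)
      then show "(\<Sum>j\<in>I\<union>J. m i j * ?x j) * cnj (?y i) = z i * cnj (?y i)" by simp
    qed
    also have "\<dots> = (\<Sum>i\<in>I. of_real (t * (norm (z i))\<^sup>2))"
      by (rule sum.mono_neutral_cong_right) (use fin in \<open>auto simp: complex_norm_square mult_ac simp del: of_real_power\<close>)
    also have "\<dots> = of_real (t * s)" by (simp add: s_def sum_distrib_left)
    finally have 1: "Re (\<Sum>i\<in>I\<union>J. \<Sum>j\<in>I\<union>J. m i j * ?x j * cnj (?y i)) = t * s" by simp
    have 2: "(\<Sum>i\<in>I\<union>J. (norm (?x i))\<^sup>2) = X"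
      unfolding X_def by (rule sum.mono_neutral_cong_right) (use fin in auto)
    have "(\<Sum>i\<in>I\<union>J. (norm (?y i))\<^sup>2) = (\<Sum>i\<in>I. t\<^sup>2 * (norm (z i))\<^sup>2)"
      by (rule sum.mono_neutral_cong_right) (use fin in \<open>auto simp: norm_mult power_mult_distrib\<close>)
    then have 3: "(\<Sum>i\<in>I\<union>J. (norm (?y i))\<^sup>2) = t\<^sup>2 * s" by (simp add: s_def sum_distrib_left)
    show ?thesis
      using m[unfolded form_bounded_def, rule_format, OF F, of ?x ?y] unfolding 1 2 3 .
  qed
  have "s \<le> M\<^sup>2 * X"
  proof (cases "M = 0")
    case True then show ?thesis using *[of 1] by simp
  next
    case False
    then have "0 < M" using M by simp
    then show ?thesis using *[of "1 / M"] by (simp add: field_simps power2_eq_square)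
  qed
  then show ?thesis by (simp add: s_def X_def z_def)
qed

text \<open>
  Adjoints, Schur products, positive operators and matrix units are all obtained by this
  construction.  The rows are square-summable by the previous estimate, so each coordinate of the
  image can be defined as an inner product with the conjugated row.
\<close>
lemma op_of_form_bounded:
  assumes m: "form_bounded m M" and M: "0 \<le> M"
  obtains D where "D \<in> Bl2" "opmat D = m" "norm D \<le> M"
proof -
  have row: "(\<Sum>j\<in>J. (norm (cnj (m i j)))\<^sup>2) \<le> M\<^sup>2" if "finite J" for i J
  proof -
    let ?N = "\<Sum>j\<in>J. (norm (m i j))\<^sup>2"
    have "(\<Sum>j\<in>J. m i j * cnj (m i j)) = of_real ?N"
      by (simp only: complex_norm_square of_real_sum)
    then have "norm (\<Sum>j\<in>J. m i j * cnj (m i j)) = \<bar>?N\<bar>" by (simp only: norm_of_real)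
    then have "?N\<^sup>2 \<le> M\<^sup>2 * ?N"
      using form_bounded_column_sums[OF m M, of "{i}" J "\<lambda>j. cnj (m i j)"] that by simp
    moreover have "0 \<le> ?N" by (intro sum_nonneg) auto
    ultimately have "?N \<le> M\<^sup>2" by (cases "?N = 0") (auto simp: power2_eq_square)
    then show ?thesis by simp
  qed
  define r where "r i = Abs_ell2 (\<lambda>j. cnj (m i j))" for i
  have r: "coord (r i) j = cnj (m i j)" for i j
    using ell2_of_bounded_sums(1)[OF row, of i] by (simp add: r_def)
  have fin: "(\<Sum>i\<in>I. (norm (cinner x (r i)))\<^sup>2) \<le> (M * norm x)\<^sup>2" if I: "finite I" for I x
  proof (rule tendsto_upperbound)
    show "((\<lambda>F. \<Sum>i\<in>I. (norm (cinner (fin_vec F (coord x)) (r i)))\<^sup>2) \<longlongrightarrow>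
        (\<Sum>i\<in>I. (norm (cinner x (r i)))\<^sup>2)) (finite_subsets_at_top UNIV)"
      by (intro tendsto_sum tendsto_power tendsto_norm tendsto_cinner tendsto_fin_vec tendsto_const)
    show "\<forall>\<^sub>F F in finite_subsets_at_top UNIV.
        (\<Sum>i\<in>I. (norm (cinner (fin_vec F (coord x)) (r i)))\<^sup>2) \<le> (M * norm x)\<^sup>2"
      using eventually_finite_sets
    proof eventually_elim
      fix F :: "'a set" assume F: "finite F"
      have "(\<Sum>i\<in>I. (norm (cinner (fin_vec F (coord x)) (r i)))\<^sup>2) =
          (\<Sum>i\<in>I. (norm (\<Sum>j\<in>F. m i j * coord x j))\<^sup>2)"
        by (simp add: fin_vec_eq_sum[OF F] cinner_sum_left r mult.commute)
      also have "\<dots> \<le> M\<^sup>2 * (\<Sum>j\<in>F. (norm (coord x j))\<^sup>2)"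
        by (rule form_bounded_column_sums[OF m M I F])
      also have "\<dots> \<le> M\<^sup>2 * (norm x)\<^sup>2"
        by (intro mult_left_mono finite_sum_le_norm_ell2 F) auto
      finally show "(\<Sum>i\<in>I. (norm (cinner (fin_vec F (coord x)) (r i)))\<^sup>2) \<le> (M * norm x)\<^sup>2"
        by (simp add: power_mult_distrib)
    qed
  qed simp
  define f where "f x = Abs_ell2 (\<lambda>i. cinner x (r i))" for x
  have cf: "coord (f x) i = cinner x (r i)" for x i
    using ell2_of_bounded_sums(1)[OF fin, of x] by (simp add: f_def)
  have nf: "norm (f x) \<le> M * norm x" for x
    unfolding f_def
    by (rule power2_le_imp_le[OF ell2_of_bounded_sums(2)[OF fin]]) (use M in auto)
  have "bounded_linear f"
    by (rule bounded_linear_intro[where K = M])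
       (use nf in \<open>auto intro!: ell2_eqI simp: cf cinner_add_left cinner_scaleR_left mult.commute\<close>)
  then have B: "blinfun_apply (Blinfun f) = f" by (rule bounded_linear_Blinfun_apply)
  show ?thesis
  proof
    show "Blinfun f \<in> Bl2" by (auto intro!: ell2_eqI simp: Bl2_def B cf)
    show "opmat (Blinfun f) = m" by (intro ext) (simp add: opmat_eq_coord B cf r)
    show "norm (Blinfun f) \<le> M" by (rule norm_blinfun_bound) (auto simp: B M nf)
  qed
qed

lemma form_bounded_adjoint:
  assumes "form_bounded m M"
  shows "form_bounded (\<lambda>i j. cnj (m j i)) M"
  unfolding form_bounded_def
proof (intro allI impI)
  fix F :: "'a set" and x y :: "'a \<Rightarrow> complex" assume F: "finite F"
  have "(\<Sum>i\<in>F. \<Sum>j\<in>F. cnj (m j i) * x j * cnj (y i)) = cnj (\<Sum>i\<in>F. \<Sum>j\<in>F. m i j * y j * cnj (x i))"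
    by (subst sum.swap) (simp add: mult_ac)
  then have "Re (\<Sum>i\<in>F. \<Sum>j\<in>F. cnj (m j i) * x j * cnj (y i)) = Re (\<Sum>i\<in>F. \<Sum>j\<in>F. m i j * y j * cnj (x i))"
    by (simp only: cnj.simps)
  also have "\<dots> \<le> M / 2 * ((\<Sum>i\<in>F. (norm (y i))\<^sup>2) + (\<Sum>i\<in>F. (norm (x i))\<^sup>2))"
    using assms[unfolded form_bounded_def, rule_format, OF F, of y x] .
  finally show "Re (\<Sum>i\<in>F. \<Sum>j\<in>F. cnj (m j i) * x j * cnj (y i)) \<le>
      M / 2 * ((\<Sum>i\<in>F. (norm (x i))\<^sup>2) + (\<Sum>i\<in>F. (norm (y i))\<^sup>2))"
    by (simp add: add.commute)
qed

lemma adj_exists: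
  assumes T: "T \<in> Bl2"
  obtains S where "S \<in> Bl2" "opmat S = (\<lambda>i j. cnj (opmat T j i))" "norm S \<le> norm T"
    "\<And>x y. cinner (blinfun_apply S x) y = cinner x (blinfun_apply T y)"
proof -
  obtain S where S: "S \<in> Bl2" "opmat S = (\<lambda>i j. cnj (opmat T j i))" "norm S \<le> norm T"
    using op_of_form_bounded[OF form_bounded_adjoint[OF form_bounded_opmat[OF T order_refl]]] by auto
  have col: "cinner (blinfun_apply S (unit_vec j)) y = cnj (coord (blinfun_apply T y) j)" for j y
  proof -
    have "cinner (blinfun_apply S (unit_vec j)) y = (\<Sum>\<^sub>\<infinity>i. cnj (opmat T j i * coord y i))"
      unfolding cinner_def by (simp add: opmat_eq_coord[symmetric] S(2))
    also have "\<dots> = cnj (coord (blinfun_apply T y) j)"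
      using has_sum_coord_apply[OF T, of j y] by (simp only: infsum_cnj infsumI)
    finally show ?thesis .
  qed
  have "cinner (blinfun_apply S x) y = cinner x (blinfun_apply T y)" for x y
    using has_sum_cinner_apply[OF S(1), of x y] unfolding col cinner_def[of x]
    by (simp add: infsumI)
  then show ?thesis using that S by blast
qed

lemma adj_unique:
  assumes T: "T \<in> Bl2" and S: "S \<in> Bl2" "\<And>x y. cinner (blinfun_apply S x) y = cinner x (blinfun_apply T y)"
  shows "adj T = S"
  unfolding adj_def
proof (rule the_equality)
  fix S' assume S': "S' \<in> Bl2 \<and> (\<forall>x y. cinner (blinfun_apply S' x) y = cinner x (blinfun_apply T y))"
  show "S' = S"
    by (rule blinfun_eqI, rule ell2_eq_of_inner) (simp add: Re_cinner[symmetric] S S')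
qed (use S in auto)

lemma adj:
  assumes T: "T \<in> Bl2"
  shows adj_in_Bl2: "adj T \<in> Bl2"
    and opmat_adj: "opmat (adj T) i j = cnj (opmat T j i)"
    and norm_adj_le: "norm (adj T) \<le> norm T"
    and cinner_adj_left: "cinner (blinfun_apply (adj T) x) y = cinner x (blinfun_apply T y)"
proof -
  obtain S where S: "S \<in> Bl2" "opmat S = (\<lambda>i j. cnj (opmat T j i))" "norm S \<le> norm T"
    "\<And>x y. cinner (blinfun_apply S x) y = cinner x (blinfun_apply T y)"
    using adj_exists[OF T] by blast
  note * = adj_unique[OF T S(1,4)]
  show "adj T \<in> Bl2" "opmat (adj T) i j = cnj (opmat T j i)" "norm (adj T) \<le> norm T"
    "cinner (blinfun_apply (adj T) x) y = cinner x (blinfun_apply T y)"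
    by (simp_all add: * S)
qed

section \<open>Positive semidefinite kernels and Gram vectors\<close>

text \<open>
  A minimizing sequence is Cauchy by the parallelogram law, and the inequality is the first-order
  condition along the segment from the limit to \<open>v\<close>.
\<close>
lemma closed_convex_nearest_point:
  fixes S :: "'a::{real_inner, complete_space} set"
  assumes "closed S" "convex S" "S \<noteq> {}"
  obtains w where "w \<in> S" "\<And>v. v \<in> S \<Longrightarrow> inner (z - w) (v - w) \<le> 0"
proof -
  define D where "D = (INF v\<in>S. (norm (z - v))\<^sup>2)"
  have bdd: "bdd_below ((\<lambda>v. (norm (z - v))\<^sup>2) ` S)" by (rule bdd_belowI2[of _ 0]) simp
  have D: "D \<le> (norm (z - v))\<^sup>2" if "v \<in> S" for v
    unfolding D_def by (rule cINF_lower[OF bdd that])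
  have "\<exists>v\<in>S. (norm (z - v))\<^sup>2 < D + 1 / real (Suc n)" for n
    using cINF_less_iff[OF assms(3) bdd, of "D + 1 / real (Suc n)"] by (simp add: D_def)
  then obtain v where v: "\<And>n. v n \<in> S" "\<And>n. (norm (z - v n))\<^sup>2 < D + 1 / real (Suc n)" by metis
  \<comment> \<open>The midpoint belongs to \<open>S\<close>, so its squared distance to \<open>z\<close> is at least \<open>D\<close>.\<close>
  have par: "(norm (v m - v n))\<^sup>2 \<le> 2 / real (Suc m) + 2 / real (Suc n)" for m n
  proof -
    have mid: "(1/2) *\<^sub>R v m + (1/2) *\<^sub>R v n \<in> S"
      by (rule convexD[OF assms(2) v(1) v(1)]) auto
    have "(norm (v m - v n))\<^sup>2 = 2 * (norm (z - v m))\<^sup>2 + 2 * (norm (z - v n))\<^sup>2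
        - 4 * (norm (z - ((1/2) *\<^sub>R v m + (1/2) *\<^sub>R v n)))\<^sup>2"
      unfolding power2_norm_eq_inner by (simp add: algebra_simps inner_commute)
    then show ?thesis using D[OF mid] v(2)[of m] v(2)[of n] by linarith
  qed
  have "Cauchy v"
  proof (rule metric_CauchyI)
    fix e :: real assume e: "0 < e"
    obtain N where N: "4 / e\<^sup>2 < real N" using reals_Archimedean2 by blast
    have "dist (v m) (v n) < e" if "m \<ge> N" "n \<ge> N" for m n
    proof -
      have small: "2 / real (Suc k) < e\<^sup>2 / 2" if "k \<ge> N" for k
      proof -
        have "4 / e\<^sup>2 < real (Suc k)" using N that by linarith
        then show ?thesis using e by (simp add: field_simps)
      qed
      have "(norm (v m - v n))\<^sup>2 < e\<^sup>2" using par[of m n] small[OF that(1)] small[OF that(2)] by linarith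
      then show ?thesis using e by (simp add: dist_norm power_less_imp_less_base)
    qed
    then show "\<exists>M. \<forall>m\<ge>M. \<forall>n\<ge>M. dist (v m) (v n) < e" by blast
  qed
  then obtain w where w: "v \<longlonglongrightarrow> w" using Cauchy_convergent convergent_def by blast
  have wS: "w \<in> S" using closed_sequentially[OF assms(1) v(1) w] .
  have "(\<lambda>n. (norm (z - v n))\<^sup>2) \<longlonglongrightarrow> (norm (z - w))\<^sup>2" by (intro tendsto_intros w)
  moreover have "(\<lambda>n. D + 1 / real (Suc n)) \<longlonglongrightarrow> D + 0"
    by (intro tendsto_intros LIMSEQ_Suc[OF lim_1_over_n])
  ultimately have wD: "(norm (z - w))\<^sup>2 \<le> D + 0"
    by (rule LIMSEQ_le) (use v(2) less_imp_le in blast)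
  show ?thesis
  proof
    fix u assume u: "u \<in> S"
    define a where "a = inner (z - w) (u - w)"
    define b where "b = (norm (u - w))\<^sup>2"
    have *: "2 * a \<le> t * b" if t: "0 < t" "t \<le> 1" for t
    proof -
      have "(1 - t) *\<^sub>R w + t *\<^sub>R u \<in> S" using convexD[OF assms(2) wS u, of "1 - t" t] t by simp
      then have "(norm (z - w))\<^sup>2 \<le> (norm (z - ((1 - t) *\<^sub>R w + t *\<^sub>R u)))\<^sup>2" using D[of "(1 - t) *\<^sub>R w + t *\<^sub>R u"] wD by linarith
      also have "\<dots> = (norm (z - w))\<^sup>2 - 2 * t * a + t * t * b"
        unfolding power2_norm_eq_inner a_def b_def by (simp add: algebra_simps inner_commute)
      finally have "t * (2 * a) \<le> t * (t * b)" by simp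
      then show ?thesis using t by simp
    qed
    show "a \<le> 0"
    proof (rule ccontr)
      assume a: "\<not> a \<le> 0"
      have "b \<ge> 0" by (simp add: b_def)
      show False
      proof (cases "a \<ge> b")
        case True then show False using *[of 1] a \<open>b \<ge> 0\<close> by simp
      next
        case False
        then show False using *[of "a / b"] a \<open>b \<ge> 0\<close> by simp
      qed
    qed
  qed (rule wS)
qed

text \<open>
  A functional that is only known on linear combinations of given vectors is easiest to describe by
  its graph \<open>\<Gamma>\<close>; the bound makes it single-valued.  Let \<open>(w', s\<^sub>0)\<close> be the projection
  of \<open>(0, 1)\<close> onto the closure of \<open>\<Gamma>\<close>.  The residual \<open>(- w', 1 - s\<^sub>0)\<close> is orthogonal to \<open>\<Gamma>\<close>, which says
  that \<open>w' / (1 - s\<^sub>0)\<close> represents the functional; boundedness excludes \<open>s\<^sub>0 = 1\<close>.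
\<close>
lemma riesz_graph:
  fixes \<Gamma> :: "('a::{real_inner, complete_space} \<times> real) set"
  assumes sub: "subspace \<Gamma>" and bound: "\<And>v s. (v, s) \<in> \<Gamma> \<Longrightarrow> \<bar>s\<bar> \<le> K * norm v" and K: "0 \<le> K"
  obtains w where "w \<in> closure (fst ` \<Gamma>)" "\<And>v s. (v, s) \<in> \<Gamma> \<Longrightarrow> inner w v = s" "norm w \<le> K"
proof -
  have "closed (closure \<Gamma>)" "convex (closure \<Gamma>)" "closure \<Gamma> \<noteq> {}"
    using subspace_0[OF sub] closure_subset[of \<Gamma>] convex_closure[OF subspace_imp_convex[OF sub]]
    by (blast, blast, blast)
  then obtain p where p: "p \<in> closure \<Gamma>" "\<And>v. v \<in> closure \<Gamma> \<Longrightarrow> inner ((0, 1) - p) (v - p) \<le> 0"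
    using closed_convex_nearest_point[of "closure \<Gamma>" "(0, 1)"] by blast
  obtain w' s0 where ws: "p = (w', s0)" by (cases p)
  \<comment> \<open>A linear function of \<open>r\<close> that is bounded above has slope zero.\<close>
  have lin0: "b = 0" if "\<And>r::real. r * b \<le> c" for b c :: real
  proof (rule ccontr)
    assume "b \<noteq> 0"
    then show False using that[of "(c + 1) / b"] by simp
  qed
  have orth: "inner ((0, 1) - p) q = 0" if q: "q \<in> \<Gamma>" for q
  proof (rule lin0)
    fix r :: real
    have "r *\<^sub>R q \<in> closure \<Gamma>" using subspace_scale[OF sub q] closure_subset by blast
    then show "r * inner ((0, 1) - p) q \<le> inner ((0, 1) - p) p"
      using p(2)[of "r *\<^sub>R q"] by (simp add: inner_diff_right)
  qed
  have "closure \<Gamma> \<subseteq> {q. inner ((0, 1) - p) q = 0}"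
    by (rule closure_minimal) (auto simp: orth intro!: closed_Collect_eq continuous_intros)
  then have pp: "inner ((0, 1) - p) p = 0" using p(1) by blast
  have "closure \<Gamma> \<subseteq> {q. \<bar>snd q\<bar> \<le> K * norm (fst q)}"
    by (rule closure_minimal) (auto simp: bound intro!: closed_Collect_le continuous_intros)
  then have bp: "\<bar>s0\<bar> \<le> K * norm w'" using p(1) ws by auto
  have s1: "s0 \<noteq> 1"
  proof
    assume "s0 = 1"
    then have "w' = 0" using pp by (simp add: ws)
    then show False using bp \<open>s0 = 1\<close> by simp
  qed
  define w where "w = (1 / (1 - s0)) *\<^sub>R w'"
  have inn: "inner w v = s" if "(v, s) \<in> \<Gamma>" for v s
  proof -
    have "inner w' v = (1 - s0) * s" using orth[OF that] by (simp add: ws)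
    then show ?thesis using s1 by (simp add: w_def)
  qed
  have "closure \<Gamma> \<subseteq> closure (fst ` \<Gamma>) \<times> UNIV"
    by (rule closure_minimal) (use closure_subset in \<open>force intro!: closed_Times\<close>)+
  then have "w' \<in> closure (fst ` \<Gamma>)" using p(1) ws by auto
  then have "w \<in> (\<lambda>v. (1 / (1 - s0)) *\<^sub>R v) ` closure (fst ` \<Gamma>)" unfolding w_def by (rule imageI)
  also have "\<dots> = closure ((\<lambda>v. (1 / (1 - s0)) *\<^sub>R v) ` fst ` \<Gamma>)" by (rule closure_scaleR)
  also have "\<dots> \<subseteq> closure (fst ` \<Gamma>)"
  proof (rule closure_mono, safe)
    fix v s assume "(v, s) \<in> \<Gamma>"
    then have "(1 / (1 - s0)) *\<^sub>R (v, s) \<in> \<Gamma>" by (rule subspace_scale[OF sub])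
    then show "(1 / (1 - s0)) *\<^sub>R fst (v, s) \<in> fst ` \<Gamma>" by (force simp: image_iff)
  qed
  finally have wcl: "w \<in> closure (fst ` \<Gamma>)" .
  have "closure (fst ` \<Gamma>) \<subseteq> {v. inner w v \<le> K * norm v}"
    by (rule closure_minimal)
       (use inn bound in \<open>fastforce intro!: closed_Collect_le continuous_intros\<close>)+
  then have "inner w w \<le> K * norm w" using wcl by blast
  then have "norm w * norm w \<le> K * norm w" by (simp add: power2_norm_eq_inner[symmetric] power2_eq_square)
  then have "norm w \<le> K" using K by (cases "norm w = 0") auto
  then show ?thesis using that wcl inn by blast
qed

definition psd :: "('x \<Rightarrow> 'x \<Rightarrow> real) \<Rightarrow> bool"
  where "psd G \<longleftrightarrow> (\<forall>x y. G x y = G y x) \<and>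
    (\<forall>F c. finite F \<longrightarrow> 0 \<le> (\<Sum>x\<in>F. \<Sum>y\<in>F. c x * c y * G x y))"

lemma psd_sym: "psd G \<Longrightarrow> G x y = G y x"
  by (simp add: psd_def)

text \<open>
  Points that occur several times may be merged by adding up their coefficients.
\<close>
lemma psd_indexed_sum_nonneg:
  assumes G: "psd G" and A: "finite A"
  shows "0 \<le> (\<Sum>a\<in>A. \<Sum>b\<in>A. c a * c b * G (f a) (f b))"
proof -
  define C where "C x = (\<Sum>a | a \<in> A \<and> f a = x. c a)" for x
  have inner: "(\<Sum>b\<in>A. c b * h (f b)) = (\<Sum>y\<in>f`A. C y * h y)" for h
    unfolding sum.image_gen[OF A, of "\<lambda>b. c b * h (f b)" f] C_def
    by (intro sum.cong refl) (simp add: sum_distrib_right)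
  have "(\<Sum>a\<in>A. \<Sum>b\<in>A. c a * c b * G (f a) (f b)) = (\<Sum>a\<in>A. c a * (\<Sum>b\<in>A. c b * G (f a) (f b)))"
    by (simp add: sum_distrib_left mult.assoc)
  also have "\<dots> = (\<Sum>x\<in>f`A. C x * (\<Sum>y\<in>f`A. C y * G x y))"
    unfolding inner using inner[of "\<lambda>x. \<Sum>y\<in>f`A. C y * G x y"] by simp
  also have "\<dots> = (\<Sum>x\<in>f`A. \<Sum>y\<in>f`A. C x * C y * G x y)"
    by (simp add: sum_distrib_left mult.assoc)
  also have "\<dots> \<ge> 0" using G A by (simp add: psd_def)
  finally show ?thesis .
qed

lemma psd_diag_nonneg: "psd G \<Longrightarrow> 0 \<le> G x x"
  using psd_indexed_sum_nonneg[of G "{x}" "\<lambda>_. 1" "\<lambda>x. x"] by simp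

lemma discriminant_nonpos:
  fixes a b c :: real
  assumes "\<And>t. 0 \<le> a + 2 * t * b + t\<^sup>2 * c" "0 \<le> c"
  shows "b\<^sup>2 \<le> a * c"
proof (cases "c = 0")
  case True
  have "b = 0"
  proof (rule ccontr)
    assume "b \<noteq> 0"
    then show False using assms(1)[of "- (a + 1) / (2 * b)"] True by (simp add: field_simps)
  qed
  then show ?thesis using True by simp
next
  case False
  then have "0 < c" using assms(2) by simp
  then show ?thesis using assms(1)[of "- b / c"] by (simp add: field_simps power2_eq_square)
qed

text \<open>
  This is the Gram-Schmidt process on an index set of arbitrary size.  A partial solution \<open>R\<close> relates
  indices to vectors supported on the indices that already occur, and Zorn's lemma provides a maximal
  one.  If an index \<open>k\<close> were missing, the functional \<open>z\<^sub>x \<mapsto> G k x\<close> would be bounded on the span of the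
  vectors \<open>z\<^sub>x\<close> found so far, hence represented by some \<open>w\<close> in its closure; the unused coordinate \<open>k\<close>
  can then carry the missing part of the norm.  Keeping one coordinate per index is what places the
  vectors in the space of families indexed by the set itself.
\<close>
theorem psd_gram:
  fixes G :: "'x \<Rightarrow> 'x \<Rightarrow> real"
  assumes G: "psd G"
  obtains z :: "'x \<Rightarrow> ('x, real) ell2" where "\<And>x y. inner (z x) (z y) = G x y"
proof -
  define \<A> :: "('x \<times> ('x, real) ell2) set set" where
    "\<A> = {R. (\<forall>x z x' z'. (x, z) \<in> R \<longrightarrow> (x', z') \<in> R \<longrightarrow> inner z z' = G x x') \<and>
      (\<forall>x z y. (x, z) \<in> R \<longrightarrow> coord z y \<noteq> 0 \<longrightarrow> y \<in> fst ` R)}"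
  have "\<exists>M\<in>\<A>. \<forall>R\<in>\<A>. M \<subseteq> R \<longrightarrow> R = M"
  proof (rule subset_Zorn)
    fix \<C> assume C: "subset.chain \<A> \<C>"
    have sub: "R \<in> \<A>" if "R \<in> \<C>" for R using C that by (auto simp: subset.chain_def)
    have "\<Union>\<C> \<in> \<A>"
      unfolding \<A>_def
    proof (intro CollectI conjI allI impI)
      fix x z x' z' assume "(x, z) \<in> \<Union>\<C>" "(x', z') \<in> \<Union>\<C>"
      then obtain R R' where R: "R \<in> \<C>" "(x, z) \<in> R" "R' \<in> \<C>" "(x', z') \<in> R'" by blast
      then have "R \<subseteq> R' \<or> R' \<subseteq> R" using C by (auto simp: subset.chain_def subset_iff_psubset_eq)
      then show "inner z z' = G x x'" using R sub unfolding \<A>_def by blast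
    next
      fix x z y assume "(x, z) \<in> \<Union>\<C>" "coord z y \<noteq> 0"
      then show "y \<in> fst ` \<Union>\<C>" using sub unfolding \<A>_def by blast
    qed
    then show "\<exists>U\<in>\<A>. \<forall>X\<in>\<C>. X \<subseteq> U" by blast
  qed
  then obtain M where M: "M \<in> \<A>" and max: "\<And>R. R \<in> \<A> \<Longrightarrow> M \<subseteq> R \<Longrightarrow> R = M" by blast
  have MG: "inner z z' = G x x'" if "(x, z) \<in> M" "(x', z') \<in> M" for x z x' z'
    using M that by (auto simp: \<A>_def)
  have Msupp: "coord z y = 0" if "(x, z) \<in> M" "y \<notin> fst ` M" for x z y
    using M that unfolding \<A>_def by blast
  have "k \<in> fst ` M" for k
  proof (rule ccontr)
    assume k: "k \<notin> fst ` M"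
    define f where "f p = (snd p, G k (fst p))" for p :: "'x \<times> ('x, real) ell2"
    define \<Gamma> where "\<Gamma> = span (f ` M)"
    have bound: "\<bar>s\<bar> \<le> sqrt (G k k) * norm v" if vs: "(v, s) \<in> \<Gamma>" for v s
    proof -
      obtain t r where t: "finite t" "t \<subseteq> f ` M" "(v, s) = (\<Sum>a\<in>t. r a *\<^sub>R a)"
        using vs unfolding \<Gamma>_def span_explicit by blast
      then obtain F where F: "F \<subseteq> M" "inj_on f F" "t = f ` F" by (meson subset_image_inj)
      have finF: "finite F" using F t(1) finite_image_iff by blast
      define c where "c p = r (f p)" for p
      have vs': "(v, s) = (\<Sum>p\<in>F. c p *\<^sub>R f p)" unfolding t(3) F(3) sum.reindex[OF F(2)] by (simp add: c_def)
      have v: "v = (\<Sum>p\<in>F. c p *\<^sub>R snd p)"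
        using arg_cong[OF vs', of fst] by (simp add: fst_sum f_def)
      have s: "s = (\<Sum>p\<in>F. c p * G k (fst p))"
        using arg_cong[OF vs', of snd] by (simp add: snd_sum f_def)
      have nv: "(norm v)\<^sup>2 = (\<Sum>p\<in>F. \<Sum>q\<in>F. c p * c q * G (fst p) (fst q))"
        unfolding power2_norm_eq_inner v inner_sum_left unfolding inner_sum_right
      proof (intro sum.cong refl)
        fix p q assume "p \<in> F" "q \<in> F"
        then have "inner (snd p) (snd q) = G (fst p) (fst q)"
          using F(1) by (intro MG) auto
        then show "inner (c p *\<^sub>R snd p) (c q *\<^sub>R snd q) = c p * c q * G (fst p) (fst q)" by simp
      qed
      \<comment> \<open>The index \<open>k\<close>, with coefficient \<open>t\<close>, is added as \<open>None\<close> to the pairs in \<open>F\<close>.\<close>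
      have "s\<^sup>2 \<le> (norm v)\<^sup>2 * G k k"
      proof (rule discriminant_nonpos)
        fix t :: real
        have sym: "G (fst p) k = G k (fst p)" for p :: "'x \<times> ('x, real) ell2"
          by (rule psd_sym[OF G])
        let ?g = "\<lambda>a. case a of None \<Rightarrow> k | Some p \<Rightarrow> fst p"
        let ?c = "\<lambda>a. case a of None \<Rightarrow> t | Some p \<Rightarrow> c p"
        have "0 \<le> (\<Sum>a\<in>insert None (Some ` F). \<Sum>b\<in>insert None (Some ` F). ?c a * ?c b * G (?g a) (?g b))"
          by (rule psd_indexed_sum_nonneg[OF G]) (use finF in auto)
        also have "\<dots> = (t * t * G k k + t * s) + (t * s + (norm v)\<^sup>2)"
          using finF by (simp add: sum.reindex sum.distrib nv s sym sum_distrib_left mult_ac)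
        finally show "0 \<le> (norm v)\<^sup>2 + 2 * t * s + t\<^sup>2 * G k k" by (simp add: power2_eq_square algebra_simps)
      qed (rule psd_diag_nonneg[OF G])
      then have "sqrt (s\<^sup>2) \<le> sqrt ((norm v)\<^sup>2 * G k k)" by (rule real_sqrt_le_mono)
      then show ?thesis by (simp add: real_sqrt_mult mult.commute)
    qed
    obtain w where w: "w \<in> closure (fst ` \<Gamma>)" "\<And>v s. (v, s) \<in> \<Gamma> \<Longrightarrow> inner w v = s" "norm w \<le> sqrt (G k k)"
      by (rule riesz_graph[of \<Gamma> "sqrt (G k k)"]) (use bound psd_diag_nonneg[OF G, of k] in \<open>auto simp: \<Gamma>_def\<close>)
    have wG: "inner w z = G k x" if "(x, z) \<in> M" for x z
      by (rule w(2)) (use that in \<open>force simp: \<Gamma>_def f_def intro: span_base\<close>)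
    have wsupp: "coord w y = 0" if y: "y \<notin> fst ` M" for y
    proof -
      have "\<Gamma> \<subseteq> {p. coord (fst p) y = 0}"
        unfolding \<Gamma>_def
        by (rule span_minimal) (use Msupp y in \<open>force simp: f_def subspace_def\<close>)+
      then have "closure (fst ` \<Gamma>) \<subseteq> {v. coord v y = 0}"
        by (intro closure_minimal closed_Collect_eq continuous_intros
              linear_continuous_on[OF bounded_linear_coord]) auto
      then show ?thesis using w(1) by blast
    qed
    \<comment> \<open>Since \<open>w\<close> vanishes at \<open>k\<close>, adding \<open>r\<close> in this coordinate affects only the norm.\<close>
    define r where "r = sqrt (G k k - (norm w)\<^sup>2)"
    have "(norm w)\<^sup>2 \<le> (sqrt (G k k))\<^sup>2" by (rule power_mono[OF w(3)]) simp
    then have r: "r\<^sup>2 = G k k - (norm w)\<^sup>2"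
      using psd_diag_nonneg[OF G, of k] by (simp add: r_def)
    define z where "z = w + fin_vec {k} (\<lambda>_. r)"
    have fv: "inner (fin_vec {k} (\<lambda>_. r)) v = r * coord v k" for v
    proof -
      have "inner (fin_vec {k} (\<lambda>_. r)) v = (\<Sum>\<^sub>\<infinity>i\<in>{k}. r * coord v i)"
        unfolding inner_ell2_def by (rule infsum_cong_neutral) auto
      then show ?thesis by simp
    qed
    have wfv: "inner w (fin_vec {k} (\<lambda>_. r)) = r * coord w k"
      using fv[of w] by (simp only: inner_commute)
    have zz: "inner z z = G k k"
    proof -
      have "inner z z = inner w w + 2 * (r * coord w k) + r * (coord (fin_vec {k} (\<lambda>_. r)) k)"
        unfolding z_def inner_add_left inner_add_right fv wfv by simp
      then show ?thesis using r wsupp[OF k] by (simp add: power2_norm_eq_inner power2_eq_square[symmetric])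
    qed
    have zM: "inner z z' = G k x" if "(x, z') \<in> M" for x z'
      using Msupp[OF that k] wG[OF that] by (simp add: z_def inner_add_left fv)
    have Mz: "inner z' z = G x k" if "(x, z') \<in> M" for x z'
      using zM[OF that] psd_sym[OF G, of x k] by (simp only: inner_commute)
    have "insert (k, z) M \<in> \<A>"
      unfolding \<A>_def
    proof (intro CollectI conjI allI impI)
      fix x y x' y' assume "(x, y) \<in> insert (k, z) M" "(x', y') \<in> insert (k, z) M"
      then show "inner y y' = G x x'"
        using zz zM Mz MG by auto
    next
      fix x y j assume "(x, y) \<in> insert (k, z) M" "coord y j \<noteq> 0"
      then show "j \<in> fst ` insert (k, z) M"
        using Msupp wsupp by (auto simp: z_def split: if_splits)
    qed
    then have "insert (k, z) M = M" by (rule max) auto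
    then show False using k by (metis fst_conv image_eqI insertI1)
  qed
  then have "\<forall>x. \<exists>z. (x, z) \<in> M" by force
  then obtain z where "\<And>x. (x, z x) \<in> M" by metis
  then show ?thesis using that MG by blast
qed

section \<open>Gaussian kernels as contractive Schur multipliers\<close>

lemma has_sum_finite_sum:
  fixes f :: "'a \<Rightarrow> 'b \<Rightarrow> 'c::{topological_comm_monoid_add}"
  assumes "\<And>i. i \<in> F \<Longrightarrow> (f i has_sum s i) A"
  shows "((\<lambda>x. \<Sum>i\<in>F. f i x) has_sum (\<Sum>i\<in>F. s i)) A"
  using assms by (induction F rule: infinite_finite_induct) (auto intro: has_sum_add)

lemma has_sum_inner_real:
  fixes x y :: "('s, real) ell2"
  shows "((\<lambda>s. coord x s * coord y s) has_sum inner x y) UNIV"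
  using has_sum_infsum[OF inner_summable[OF coord_summable[of x] coord_summable[of y]]]
  by (simp add: inner_ell2_def)

lemma psdI:
  assumes "\<And>x y. G x y = G y x"
    and "\<And>F c. finite F \<Longrightarrow> 0 \<le> (\<Sum>x\<in>F. \<Sum>y\<in>F. c x * c y * G x y)"
  shows "psd G"
  using assms by (auto simp: psd_def)

lemma psd_sum_nonneg: "psd G \<Longrightarrow> finite F \<Longrightarrow> 0 \<le> (\<Sum>x\<in>F. \<Sum>y\<in>F. c x * c y * G x y)"
  by (simp add: psd_def)

lemma psd_inner: "psd (\<lambda>x y. inner (f x) (f y))"
proof (rule psdI)
  fix F and c :: "'a \<Rightarrow> real"
  have "(\<Sum>x\<in>F. \<Sum>y\<in>F. c x * c y * inner (f x) (f y)) = inner (\<Sum>x\<in>F. c x *\<^sub>R f x) (\<Sum>y\<in>F. c y *\<^sub>R f y)"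
    unfolding inner_sum_left unfolding inner_sum_right by (simp add: mult_ac)
  then show "0 \<le> (\<Sum>x\<in>F. \<Sum>y\<in>F. c x * c y * inner (f x) (f y))" by simp
qed (rule inner_commute)

lemma psd_congruence:
  fixes G :: "'a \<Rightarrow> 'a \<Rightarrow> real"
  assumes "psd G" shows "psd (\<lambda>x y. f x * f y * G x y)"
proof (rule psdI)
  fix F :: "'a set" and c :: "'a \<Rightarrow> real" assume "finite F"
  then have "0 \<le> (\<Sum>x\<in>F. \<Sum>y\<in>F. (c x * f x) * (c y * f y) * G x y)"
    by (rule psd_sum_nonneg[OF assms])
  then show "0 \<le> (\<Sum>x\<in>F. \<Sum>y\<in>F. c x * c y * (f x * f y * G x y))" by (simp add: mult_ac)
qed (simp add: psd_sym[OF assms] mult.commute)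

lemma psd_scale: "psd G \<Longrightarrow> 0 \<le> r \<Longrightarrow> psd (\<lambda>x y. r * G x y)"
  using psd_congruence[of G "\<lambda>_. sqrt r"] by simp

lemma psd_add:
  assumes "psd G" "psd H" shows "psd (\<lambda>x y. G x y + H x y)"
  by (rule psdI)
     (use assms in \<open>auto simp: psd_sym distrib_left sum.distrib intro!: add_nonneg_nonneg psd_sum_nonneg\<close>)

lemma psd_const: "0 \<le> r \<Longrightarrow> psd (\<lambda>x y. r)"
  using psd_inner[of "\<lambda>_. sqrt r"] by simp

text \<open>
  Schur's product theorem: in Gram vectors of \<open>G\<close> the form becomes a sum, over the coordinates, of
  values of the form of \<open>H\<close>.
\<close>
lemma psd_mult:
  fixes G :: "'a \<Rightarrow> 'a \<Rightarrow> real"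
  assumes G: "psd G" and H: "psd H"
  shows "psd (\<lambda>x y. G x y * H x y)"
proof (rule psdI)
  fix F :: "'a set" and c :: "'a \<Rightarrow> real" assume F: "finite F"
  obtain z :: "'a \<Rightarrow> ('a, real) ell2" where z: "\<And>x y. inner (z x) (z y) = G x y"
    using psd_gram[OF G] by blast
  have "((\<lambda>s. \<Sum>x\<in>F. \<Sum>y\<in>F. c x * c y * H x y * (coord (z x) s * coord (z y) s))
      has_sum (\<Sum>x\<in>F. \<Sum>y\<in>F. c x * c y * H x y * inner (z x) (z y))) UNIV"
    by (intro has_sum_finite_sum has_sum_cmult_right has_sum_inner_real)
  then have "0 \<le> (\<Sum>x\<in>F. \<Sum>y\<in>F. c x * c y * H x y * inner (z x) (z y))"
  proof (rule has_sum_nonneg)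
    fix s
    have "0 \<le> (\<Sum>x\<in>F. \<Sum>y\<in>F. (c x * coord (z x) s) * (c y * coord (z y) s) * H x y)"
      by (rule psd_sum_nonneg[OF H F])
    then show "0 \<le> (\<Sum>x\<in>F. \<Sum>y\<in>F. c x * c y * H x y * (coord (z x) s * coord (z y) s))"
      by (simp add: mult_ac)
  qed
  then show "0 \<le> (\<Sum>x\<in>F. \<Sum>y\<in>F. c x * c y * (G x y * H x y))" by (simp add: z mult_ac)
qed (simp add: psd_sym[OF G] psd_sym[OF H])

lemma psd_power: "psd G \<Longrightarrow> psd (\<lambda>x y. G x y ^ n)"
  by (induction n) (auto intro: psd_const psd_mult)

lemma psd_lim:
  fixes L :: "'a \<Rightarrow> 'a \<Rightarrow> real"
  assumes "\<And>n. psd (G n)" "\<And>x y. (\<lambda>n. G n x y) \<longlonglongrightarrow> L x y"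
  shows "psd L"
proof (rule psdI)
  fix x y
  have "(\<lambda>n. G n x y) \<longlonglongrightarrow> L y x"
    using assms(2)[of y x] by (simp add: psd_sym[OF assms(1), of _ y x])
  then show "L x y = L y x" using assms(2) LIMSEQ_unique by blast
next
  fix F :: "'a set" and c :: "'a \<Rightarrow> real" assume F: "finite F"
  have "(\<lambda>n. \<Sum>x\<in>F. \<Sum>y\<in>F. c x * c y * G n x y) \<longlonglongrightarrow> (\<Sum>x\<in>F. \<Sum>y\<in>F. c x * c y * L x y)"
    by (intro tendsto_intros assms(2))
  then show "0 \<le> (\<Sum>x\<in>F. \<Sum>y\<in>F. c x * c y * L x y)"
    by (rule LIMSEQ_le_const) (use psd_sum_nonneg[OF assms(1) F] in blast)
qed

lemma psd_exp:
  assumes "psd G" shows "psd (\<lambda>x y. exp (G x y))"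
proof (rule psd_lim)
  show "psd (\<lambda>x y. \<Sum>n<N. inverse (fact n) * G x y ^ n)" for N
    by (induction N) (auto intro!: psd_const psd_add psd_scale psd_power assms)
  show "(\<lambda>N. \<Sum>n<N. inverse (fact n) * G x y ^ n) \<longlonglongrightarrow> exp (G x y)" for x y
    using exp_converges[of "G x y"] by (simp add: sums_def)
qed

text \<open>
  Expanding the square leaves an exponential of an inner product, up to a factor \<open>f x * f y\<close>.
\<close>
lemma psd_gaussian:
  fixes f :: "'a \<Rightarrow> 'h::real_inner"
  assumes "0 \<le> t"
  shows "psd (\<lambda>x y. exp (- t * (norm (f x - f y))\<^sup>2))"
proof -
  have "psd (\<lambda>x y. exp (- t * (norm (f x))\<^sup>2) * exp (- t * (norm (f y))\<^sup>2) * exp (2 * t * inner (f x) (f y)))"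
    by (rule psd_congruence, rule psd_exp, rule psd_scale, rule psd_inner) (use assms in simp)
  moreover have "exp (- t * (norm (f x))\<^sup>2) * exp (- t * (norm (f y))\<^sup>2) * exp (2 * t * inner (f x) (f y)) =
      exp (- t * (norm (f x - f y))\<^sup>2)" for x y
    unfolding exp_add[symmetric] power2_norm_eq_inner
    by (simp add: algebra_simps inner_commute)
  ultimately show ?thesis by simp
qed

text \<open>
  Write the inner product as a sum over coordinates \<open>s\<close>.  Each summand is the form of \<open>m\<close> at the
  vectors \<open>v\<^sub>j(s) x\<^sub>j\<close> and \<open>u\<^sub>i(s) y\<^sub>i\<close>, and as \<open>u\<^sub>i\<close>, \<open>v\<^sub>j\<close> are unit vectors the squared norms of these
  add up to those of \<open>x\<close> and \<open>y\<close>.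
\<close>
lemma form_bounded_schur:
  fixes u v :: "'i \<Rightarrow> ('s, real) ell2"
  assumes m: "form_bounded m M" and u: "\<And>i. norm (u i) = 1" and v: "\<And>j. norm (v j) = 1"
  shows "form_bounded (\<lambda>i j. of_real (inner (u i) (v j)) * m i j) M"
  unfolding form_bounded_def
proof (intro allI impI)
  fix F :: "'i set" and x y :: "'i \<Rightarrow> complex" assume F: "finite F"
  have "((\<lambda>s. \<Sum>i\<in>F. \<Sum>j\<in>F. Re (m i j * x j * cnj (y i)) * (coord (u i) s * coord (v j) s))
      has_sum (\<Sum>i\<in>F. \<Sum>j\<in>F. Re (m i j * x j * cnj (y i)) * inner (u i) (v j))) UNIV"
    by (intro has_sum_finite_sum has_sum_cmult_right has_sum_inner_real)
  moreover have "((\<lambda>s. M / 2 * ((\<Sum>i\<in>F. (norm (x i))\<^sup>2 * (coord (v i) s * coord (v i) s)) +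
      (\<Sum>i\<in>F. (norm (y i))\<^sup>2 * (coord (u i) s * coord (u i) s))))
      has_sum M / 2 * ((\<Sum>i\<in>F. (norm (x i))\<^sup>2 * inner (v i) (v i)) +
        (\<Sum>i\<in>F. (norm (y i))\<^sup>2 * inner (u i) (u i)))) UNIV"
    by (intro has_sum_finite_sum has_sum_cmult_right has_sum_add has_sum_inner_real)
  moreover have "(\<Sum>i\<in>F. \<Sum>j\<in>F. Re (m i j * x j * cnj (y i)) * (coord (u i) s * coord (v j) s)) \<le>
      M / 2 * ((\<Sum>i\<in>F. (norm (x i))\<^sup>2 * (coord (v i) s * coord (v i) s)) +
        (\<Sum>i\<in>F. (norm (y i))\<^sup>2 * (coord (u i) s * coord (u i) s)))" for s
  proof -
    let ?x = "\<lambda>j. of_real (coord (v j) s) * x j" and ?y = "\<lambda>i. of_real (coord (u i) s) * y i"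
    have "Re (m i j * ?x j * cnj (?y i)) = Re (m i j * x j * cnj (y i)) * (coord (u i) s * coord (v j) s)" for i j
    proof -
      have "m i j * ?x j * cnj (?y i) = of_real (coord (u i) s * coord (v j) s) * (m i j * x j * cnj (y i))"
        by simp
      moreover have "Re (of_real r * w) = Re w * r" for r w by simp
      ultimately show ?thesis by (simp only:)
    qed
    then have "Re (\<Sum>i\<in>F. \<Sum>j\<in>F. m i j * ?x j * cnj (?y i)) =
        (\<Sum>i\<in>F. \<Sum>j\<in>F. Re (m i j * x j * cnj (y i)) * (coord (u i) s * coord (v j) s))"
      by (simp only: Re_sum)
    moreover have "(norm (of_real r * w :: complex))\<^sup>2 = (norm w)\<^sup>2 * (r * r)" for r w
      by (simp add: norm_mult power_mult_distrib mult.commute power2_eq_square[of r])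
    ultimately show ?thesis
      using m[unfolded form_bounded_def, rule_format, OF F, of ?x ?y] by (simp only:)
  qed
  ultimately have "(\<Sum>i\<in>F. \<Sum>j\<in>F. Re (m i j * x j * cnj (y i)) * inner (u i) (v j)) \<le>
      M / 2 * ((\<Sum>i\<in>F. (norm (x i))\<^sup>2 * inner (v i) (v i)) + (\<Sum>i\<in>F. (norm (y i))\<^sup>2 * inner (u i) (u i)))"
    by (rule has_sum_mono)
  moreover have "Re (of_real (inner (u i) (v j)) * m i j * x j * cnj (y i)) =
      Re (m i j * x j * cnj (y i)) * inner (u i) (v j)" for i j
    by (simp add: algebra_simps)
  ultimately show "Re (\<Sum>i\<in>F. \<Sum>j\<in>F. of_real (inner (u i) (v j)) * m i j * x j * cnj (y i)) \<le>
      M / 2 * ((\<Sum>i\<in>F. (norm (x i))\<^sup>2) + (\<Sum>i\<in>F. (norm (y i))\<^sup>2))"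
    by (simp only: Re_sum) (simp add: power2_norm_eq_inner[symmetric] u v)
qed

text \<open>
  The Gaussian kernel of the joint family has unit diagonal, so its Gram vectors are unit vectors.
\<close>
lemma gaussian_factorization:
  fixes \<alpha> \<beta> :: "'i \<Rightarrow> 'h::real_inner"
  assumes "0 \<le> t"
  obtains u v :: "'i \<Rightarrow> ('i + 'i, real) ell2" where "\<And>i. norm (u i) = 1" "\<And>j. norm (v j) = 1"
    "\<And>i j. exp (- t * (norm (\<alpha> i - \<beta> j))\<^sup>2) = inner (u i) (v j)"
proof -
  obtain z :: "'i + 'i \<Rightarrow> ('i + 'i, real) ell2" where
    z: "\<And>x y. inner (z x) (z y) = exp (- t * (norm (case_sum \<alpha> \<beta> x - case_sum \<alpha> \<beta> y))\<^sup>2)"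
    using psd_gram[OF psd_gaussian[OF assms]] by blast
  have "norm (z x) = 1" for x using z[of x x] by (simp add: norm_eq_sqrt_inner)
  then show ?thesis using that[of "z \<circ> Inl" "z \<circ> Inr"] z by simp
qed

definition schur_contraction :: "('i \<Rightarrow> 'i \<Rightarrow> complex) \<Rightarrow> bool"
  where "schur_contraction C \<longleftrightarrow>
    (\<forall>B\<in>Bl2. \<exists>D\<in>Bl2. opmat D = (\<lambda>i j. C i j * opmat B i j) \<and> norm D \<le> norm B)"

lemma schur_mult_eqI:
  assumes "D \<in> Bl2" "opmat D = (\<lambda>i j. C i j * opmat B i j)"
  shows "schur_mult C B = D"
  unfolding schur_mult_def
proof (rule the_equality)
  fix D' assume "D' \<in> Bl2 \<and> opmat D' = (\<lambda>i j. C i j * opmat B i j)"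
  then show "D' = D" using assms by (intro Bl2_eqI) auto
qed (use assms in auto)

lemma schur_contraction:
  assumes "schur_contraction C" "B \<in> Bl2"
  shows schur_mult_in_Bl2: "schur_mult C B \<in> Bl2"
    and opmat_schur_mult: "opmat (schur_mult C B) i j = C i j * opmat B i j"
    and norm_schur_mult_le: "norm (schur_mult C B) \<le> norm B"
proof -
  obtain D where "D \<in> Bl2" "opmat D = (\<lambda>i j. C i j * opmat B i j)" "norm D \<le> norm B"
    using assms unfolding schur_contraction_def by blast
  then show "schur_mult C B \<in> Bl2" "opmat (schur_mult C B) i j = C i j * opmat B i j"
    "norm (schur_mult C B) \<le> norm B"
    using schur_mult_eqI[of D C B] by auto
qed

lemma schur_dom_eq_Bl2: "schur_contraction C \<Longrightarrow> schur_dom C = Bl2"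
  unfolding schur_contraction_def schur_dom_def by blast

lemma schur_contraction_factorization:
  fixes u v :: "'i \<Rightarrow> ('s, real) ell2"
  assumes "\<And>i. norm (u i) = 1" "\<And>j. norm (v j) = 1"
  shows "schur_contraction (\<lambda>i j. of_real (inner (u i) (v j)))"
  unfolding schur_contraction_def
proof
  fix B :: "'i oper" assume "B \<in> Bl2"
  then have "form_bounded (\<lambda>i j. of_real (inner (u i) (v j)) * opmat B i j) (norm B)"
    by (intro form_bounded_schur form_bounded_opmat assms order_refl)
  then show "\<exists>D\<in>Bl2. opmat D = (\<lambda>i j. of_real (inner (u i) (v j)) * opmat B i j) \<and> norm D \<le> norm B"
    by (rule op_of_form_bounded) auto
qed

text \<open>
  Both sides are the same iterated sum of \<open>C\<^sub>i\<^sub>j x\<^sub>i\<^sub>j cnj y\<^sub>i\<^sub>j\<close>, term by term.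
\<close>
lemma Tr_schur_mult_adj:
  assumes C: "schur_contraction C" and real: "\<And>i j. cnj (C i j) = C i j" and xy: "x \<in> Bl2" "y \<in> Bl2"
  shows "Tr (schur_mult C x o\<^sub>L adj y) = Tr (x o\<^sub>L adj (schur_mult C y))"
  unfolding Tr_def
  by (simp add: opmat_compose opmat_adj opmat_schur_mult[OF C] schur_mult_in_Bl2[OF C] xy real mult_ac)

section \<open>Products of Hilbert-Schmidt matrices and the weak* topology\<close>

definition cplx :: "('i, real) ell2 \<Rightarrow> ('i, complex) ell2"
  where "cplx x = Abs_ell2 (\<lambda>i. of_real (coord x i))"

lemma coord_cplx [simp]: "coord (cplx x) i = of_real (coord x i)"
  using coord_summable[of x] by (simp add: cplx_def Abs_ell2_inverse)

lemma norm_cplx [simp]: "norm (cplx x) = norm x"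
proof -
  have "(norm (cplx x))\<^sup>2 = (norm x)\<^sup>2" unfolding norm_ell2_square by simp
  then show ?thesis by (rule power2_eq_imp_eq) auto
qed

lemma cinner_cplx [simp]: "cinner (cplx x) (cplx y) = of_real (inner x y)"
proof -
  have "((\<lambda>i. of_real (coord x i * coord y i) :: complex) has_sum of_real (inner x y)) UNIV"
    by (rule has_sum_of_real[OF has_sum_inner_real])
  then show ?thesis unfolding cinner_def by (simp add: infsumI)
qed

definition restr :: "('k \<Rightarrow> 'l) \<Rightarrow> ('l, 'a::real_inner) ell2 \<Rightarrow> ('k, 'a) ell2"
  where "restr f H = Abs_ell2 (\<lambda>k. coord H (f k))"

lemma
  assumes "inj f"
  shows coord_restr: "coord (restr f H) k = coord H (f k)"
    and norm_restr_le: "norm (restr f H) \<le> norm H"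
proof -
  have *: "(\<Sum>k\<in>F. (norm (coord H (f k)))\<^sup>2) \<le> (norm H)\<^sup>2" if "finite F" for F
  proof -
    have "(\<Sum>k\<in>F. (norm (coord H (f k)))\<^sup>2) = (\<Sum>l\<in>f`F. (norm (coord H l))\<^sup>2)"
      by (subst sum.reindex) (use assms in \<open>auto intro: inj_on_subset\<close>)
    then show ?thesis using finite_sum_le_norm_ell2[of "f ` F" H] that by simp
  qed
  show "coord (restr f H) k = coord H (f k)"
    unfolding restr_def using ell2_of_bounded_sums(1)[OF *] by metis
  show "norm (restr f H) \<le> norm H"
    unfolding restr_def by (rule power2_le_imp_le[OF ell2_of_bounded_sums(2)[OF *]]) auto
qed

definition row_vec :: "('i \<times> 'r, 'a::real_inner) ell2 \<Rightarrow> 'i \<Rightarrow> ('r, 'a) ell2"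
  where "row_vec H i = restr (\<lambda>r. (i, r)) H"

definition col_vec :: "('i \<times> 'r, 'a::real_inner) ell2 \<Rightarrow> 'r \<Rightarrow> ('i, 'a) ell2"
  where "col_vec H r = restr (\<lambda>i. (i, r)) H"

lemma coord_row [simp]: "coord (row_vec H i) r = coord H (i, r)"
  and coord_col [simp]: "coord (col_vec H r) i = coord H (i, r)"
  by (simp_all add: row_vec_def col_vec_def coord_restr inj_on_def)

lemma ell2_of_rows:
  fixes h :: "'i \<Rightarrow> ('r, 'a::real_inner) ell2"
  assumes "\<And>F. finite F \<Longrightarrow> (\<Sum>i\<in>F. (norm (h i))\<^sup>2) \<le> B"
  obtains H where "\<And>i. row_vec H i = h i" "(norm H)\<^sup>2 \<le> B"
proof -
  have *: "(\<Sum>p\<in>\<Phi>. (norm (coord (h (fst p)) (snd p)))\<^sup>2) \<le> B" if fin: "finite \<Phi>" for \<Phi>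
  proof -
    have "(\<Sum>p\<in>\<Phi>. (norm (coord (h (fst p)) (snd p)))\<^sup>2) \<le>
        (\<Sum>p\<in>fst`\<Phi> \<times> snd`\<Phi>. (norm (coord (h (fst p)) (snd p)))\<^sup>2)"
      by (rule sum_mono2) (use fin in \<open>force+\<close>)
    also have "\<dots> = (\<Sum>i\<in>fst`\<Phi>. \<Sum>r\<in>snd`\<Phi>. (norm (coord (h i) r))\<^sup>2)"
      by (simp add: sum.cartesian_product case_prod_beta)
    also have "\<dots> \<le> (\<Sum>i\<in>fst`\<Phi>. (norm (h i))\<^sup>2)"
      by (intro sum_mono finite_sum_le_norm_ell2) (use fin in auto)
    also have "\<dots> \<le> B" by (rule assms) (use fin in auto)
    finally show ?thesis .
  qed
  show ?thesis
  proof
    show "row_vec (Abs_ell2 (\<lambda>p. coord (h (fst p)) (snd p))) i = h i" for i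
      by (rule ell2_eqI) (simp add: ell2_of_bounded_sums(1)[OF *])
    show "(norm (Abs_ell2 (\<lambda>p. coord (h (fst p)) (snd p))))\<^sup>2 \<le> B"
      by (rule ell2_of_bounded_sums(2)[OF *])
  qed
qed

lemma ell2_of_cols:
  fixes h :: "'r \<Rightarrow> ('i, 'a::real_inner) ell2"
  assumes "\<And>F. finite F \<Longrightarrow> (\<Sum>r\<in>F. (norm (h r))\<^sup>2) \<le> B"
  obtains H where "\<And>r. col_vec H r = h r" "(norm H)\<^sup>2 \<le> B"
proof -
  obtain H where H: "\<And>r. row_vec H r = h r" "(norm H)\<^sup>2 \<le> B" using ell2_of_rows[OF assms] by blast
  have inj: "inj (prod.swap :: 'i \<times> 'r \<Rightarrow> 'r \<times> 'i)" by simp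
  show ?thesis
  proof
    show "col_vec (restr prod.swap H) r = h r" for r
      by (rule ell2_eqI) (simp add: coord_restr[OF inj] H(1)[symmetric])
    show "(norm (restr prod.swap H))\<^sup>2 \<le> B"
      by (rule order_trans[OF power_mono[OF norm_restr_le[OF inj]] H(2)]) simp
  qed
qed

lemma sum_norm_row_le:
  assumes "finite F" shows "(\<Sum>i\<in>F. (norm (row_vec H i))\<^sup>2) \<le> (norm H)\<^sup>2"
proof -
  have "((\<lambda>r. \<Sum>i\<in>F. (norm (coord (row_vec H i) r))\<^sup>2) has_sum (\<Sum>i\<in>F. (norm (row_vec H i))\<^sup>2)) UNIV"
    by (intro has_sum_finite_sum) (simp only: norm_ell2_square has_sum_infsum coord_summable)
  then show ?thesis
  proof (rule has_sum_le_finite_sums)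
    fix R :: "'b set" assume R: "finite R"
    have "(\<Sum>r\<in>R. \<Sum>i\<in>F. (norm (coord (row_vec H i) r))\<^sup>2) = (\<Sum>p\<in>F \<times> R. (norm (coord H p))\<^sup>2)"
      by (subst sum.swap) (simp add: sum.cartesian_product)
    also have "\<dots> \<le> (norm H)\<^sup>2" by (rule finite_sum_le_norm_ell2) (use assms R in auto)
    finally show "(\<Sum>r\<in>R. \<Sum>i\<in>F. (norm (coord (row_vec H i) r))\<^sup>2) \<le> (norm H)\<^sup>2" .
  qed
qed

lemma sum_norm_col_le:
  fixes H :: "('i \<times> 'r, 'a::real_inner) ell2"
  assumes "finite F" shows "(\<Sum>r\<in>F. (norm (col_vec H r))\<^sup>2) \<le> (norm H)\<^sup>2"
proof -
  have inj: "inj (prod.swap :: 'r \<times> 'i \<Rightarrow> 'i \<times> 'r)" by simp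
  have "row_vec (restr prod.swap H) r = col_vec H r" for r
    by (rule ell2_eqI) (simp add: coord_restr[OF inj])
  then have "(\<Sum>r\<in>F. (norm (col_vec H r))\<^sup>2) \<le> (norm (restr (prod.swap :: 'r \<times> 'i \<Rightarrow> 'i \<times> 'r) H))\<^sup>2"
    using sum_norm_row_le[OF assms, of "restr prod.swap H"] by simp
  also have "\<dots> \<le> (norm H)\<^sup>2" by (rule power_mono[OF norm_restr_le[OF inj]]) simp
  finally show ?thesis .
qed

lemma tensor_exists:
  fixes a :: "('i, complex) ell2" and b :: "('r, complex) ell2"
  shows "\<exists>H. \<forall>i. row_vec H i = cscale (coord a i) b"
proof -
  have "(\<Sum>i\<in>F. (norm (cscale (coord a i) b))\<^sup>2) \<le> (norm a)\<^sup>2 * (norm b)\<^sup>2" if "finite F" for F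
    using mult_right_mono[OF finite_sum_le_norm_ell2[OF that, of a], of "(norm b)\<^sup>2"]
    by (simp add: norm_cscale power_mult_distrib sum_distrib_right)
  from ell2_of_rows[OF this] show ?thesis by metis
qed

definition tensor :: "('i, complex) ell2 \<Rightarrow> ('r, complex) ell2 \<Rightarrow> ('i \<times> 'r, complex) ell2"
  where "tensor a b = (SOME H. \<forall>i. row_vec H i = cscale (coord a i) b)"

lemma row_tensor [simp]: "row_vec (tensor a b) i = cscale (coord a i) b"
  using someI_ex[OF tensor_exists[of a b]] by (simp add: tensor_def)

lemma coord_tensor [simp]: "coord (tensor a b) (i, r) = coord a i * coord b r"
  using arg_cong[OF row_tensor[of a b i], of "\<lambda>v. coord v r"] by (simp only: coord_row coord_cscale)

lemma has_sum_cinner: "((\<lambda>i. coord x i * cnj (coord y i)) has_sum cinner x y) UNIV"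
  unfolding cinner_def by (rule has_sum_infsum[OF mult_cnj_coord_summable])

lemma has_sum_cinner_rows: "((\<lambda>i. cinner (row_vec H i) (row_vec K i)) has_sum cinner H K) UNIV"
  by (rule has_sum_SigmaD[where f = "\<lambda>p. coord H p * cnj (coord K p)" and B = "\<lambda>_. UNIV"])
     (use has_sum_cinner[of H K] has_sum_cinner[of "row_vec H _" "row_vec K _"] in simp_all)

lemma has_sum_cinner_cols: "((\<lambda>r. cinner (col_vec H r) (col_vec K r)) has_sum cinner H K) UNIV"
proof (rule has_sum_SigmaD[where f = "\<lambda>(r, i). coord H (i, r) * cnj (coord K (i, r))" and B = "\<lambda>_. UNIV"])
  have "((\<lambda>p. coord H p * cnj (coord K p)) has_sum cinner H K) (UNIV \<times> UNIV)"
    using has_sum_cinner[of H K] by simp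
  from has_sum_swap[THEN iffD1, OF this]
  show "((\<lambda>(r, i). coord H (i, r) * cnj (coord K (i, r))) has_sum cinner H K) (UNIV \<times> UNIV)" .
qed (use has_sum_cinner[of "col_vec H _" "col_vec K _"] in simp)

text \<open>
  This lemma and the next sum \<open>H\<^sub>i\<^sub>r cnj a\<^sub>i cnj b\<^sub>r\<close> in the two possible orders; together they exchange
  the summations that occur in products of matrices with square-summable entries.
\<close>
lemma has_sum_tensor_rows: "((\<lambda>i. cnj (coord a i) * cinner (row_vec H i) b) has_sum cinner H (tensor a b)) UNIV"
  using has_sum_cinner_rows[of H "tensor a b"] by simp

lemma has_sum_tensor_cols: "((\<lambda>r. cinner (col_vec H r) a * cnj (coord b r)) has_sum cinner H (tensor a b)) UNIV"
proof -
  have "col_vec (tensor a b) r = cscale (coord b r) a" for r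
    by (rule ell2_eqI) simp
  then show ?thesis using has_sum_cinner_cols[of H "tensor a b"] by (simp add: mult.commute)
qed

lemma cinner_tensor: "cinner (tensor a b) (tensor a' b') = cinner a a' * cinner b b'"
proof -
  have "((\<lambda>i. coord a i * cnj (coord a' i) * cinner b b') has_sum cinner (tensor a b) (tensor a' b')) UNIV"
    using has_sum_cinner_rows[of "tensor a b" "tensor a' b'"] by (simp add: mult_ac)
  moreover have "((\<lambda>i. coord a i * cnj (coord a' i) * cinner b b') has_sum cinner a a' * cinner b b') UNIV"
    by (intro has_sum_cmult_left has_sum_cinner)
  ultimately show ?thesis by (rule has_sum_unique)
qed

lemma norm_tensor: "norm (tensor a b) = norm a * norm b"
proof -
  have "of_real ((norm (tensor a b))\<^sup>2) = (of_real ((norm a * norm b)\<^sup>2) :: complex)"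
    unfolding cinner_self[symmetric] cinner_tensor by (simp add: cinner_self power_mult_distrib)
  then have "(norm (tensor a b))\<^sup>2 = (norm a * norm b)\<^sup>2" by (simp only: of_real_eq_iff)
  then show ?thesis by (rule power2_eq_imp_eq) auto
qed

text \<open>
  The amplification \<open>Z \<otimes> 1\<close>, which applies \<open>Z\<close> to each column.
\<close>
definition amp :: "'i oper \<Rightarrow> ('i \<times> 'r, complex) ell2 \<Rightarrow> ('i \<times> 'r, complex) ell2"
  where "amp Z H = (SOME K. (\<forall>r. col_vec K r = blinfun_apply Z (col_vec H r)) \<and> norm K \<le> norm Z * norm H)"

lemma
  shows col_amp [simp]: "col_vec (amp Z H) r = blinfun_apply Z (col_vec H r)"
    and norm_amp_le: "norm (amp Z H) \<le> norm Z * norm H"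
proof -
  have "(\<Sum>r\<in>F. (norm (blinfun_apply Z (col_vec H r)))\<^sup>2) \<le> (norm Z * norm H)\<^sup>2" if F: "finite F" for F
  proof -
    have "(\<Sum>r\<in>F. (norm (blinfun_apply Z (col_vec H r)))\<^sup>2) \<le> (\<Sum>r\<in>F. (norm Z)\<^sup>2 * (norm (col_vec H r))\<^sup>2)"
      by (intro sum_mono) (simp add: norm_blinfun power_mono flip: power_mult_distrib)
    also have "\<dots> = (norm Z)\<^sup>2 * (\<Sum>r\<in>F. (norm (col_vec H r))\<^sup>2)" by (simp add: sum_distrib_left)
    also have "\<dots> \<le> (norm Z)\<^sup>2 * (norm H)\<^sup>2" by (intro mult_left_mono sum_norm_col_le F) auto
    finally show ?thesis by (simp add: power_mult_distrib)
  qed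
  from ell2_of_cols[OF this] obtain K where
    K: "\<And>r. col_vec K r = blinfun_apply Z (col_vec H r)" "(norm K)\<^sup>2 \<le> (norm Z * norm H)\<^sup>2" by blast
  have "norm K \<le> norm Z * norm H" by (rule power2_le_imp_le[OF K(2)]) simp
  then have "\<exists>K. (\<forall>r. col_vec K r = blinfun_apply Z (col_vec H r)) \<and> norm K \<le> norm Z * norm H" using K(1) by blast
  from someI_ex[OF this] show "col_vec (amp Z H) r = blinfun_apply Z (col_vec H r)" "norm (amp Z H) \<le> norm Z * norm H"
    unfolding amp_def by auto
qed

lemma coord_amp: "coord (amp Z H) (i, r) = coord (blinfun_apply Z (col_vec H r)) i"
  using arg_cong[OF col_amp[of Z H r], of "\<lambda>v. coord v i"] by (simp only: coord_col)

lemma amp_add: "amp Z (H + K) = amp Z H + amp Z K"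
proof (rule ell2_eqI)
  fix p :: "'a \<times> 'b"
  have "col_vec (H + K) r = col_vec H r + col_vec K r" for r by (rule ell2_eqI) simp
  then show "coord (amp Z (H + K)) p = coord (amp Z H + amp Z K) p"
    by (cases p) (simp add: coord_amp blinfun.add_right)
qed

lemma amp_cscale:
  assumes "Z \<in> Bl2" shows "amp Z (cscale c H) = cscale c (amp Z H)"
proof (rule ell2_eqI)
  fix p :: "'a \<times> 'b"
  have "col_vec (cscale c H) r = cscale c (col_vec H r)" for r by (rule ell2_eqI) simp
  then show "coord (amp Z (cscale c H)) p = coord (cscale c (amp Z H)) p"
    by (cases p) (simp add: coord_amp Bl2_cscale[OF assms])
qed

text \<open>
  Here \<open>y = H K\<^sup>*\<close> with Hilbert-Schmidt matrices \<open>H, K\<close>.  The diagonal entry of \<open>x y\<close> at \<open>i\<close> is the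
  inner product of the \<open>i\<close>-th rows of \<open>(x \<otimes> 1) H\<close> and \<open>K\<close>.
\<close>
lemma has_sum_trace_nuclear:
  assumes x: "x \<in> Bl2" and y: "\<And>i j. opmat y i j = cinner (row_vec H i) (row_vec K j)"
  shows "((\<lambda>i. opmat (x o\<^sub>L y) i i) has_sum cinner (amp x H) K) UNIV"
proof -
  have "opmat (x o\<^sub>L y) i i = cinner (row_vec (amp x H) i) (row_vec K i)" for i
  proof -
    let ?a = "blinfun_apply (adj x) (unit_vec i)" and ?b = "row_vec K i"
    have a: "cnj (coord ?a k) = opmat x i k" for k
      using opmat_adj[OF x, of k i] by (simp add: opmat_eq_coord)
    have "((\<lambda>k. cnj (coord ?a k) * cinner (row_vec H k) ?b) has_sum cinner H (tensor ?a ?b)) UNIV"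
      by (rule has_sum_tensor_rows)
    then have "opmat (x o\<^sub>L y) i i = cinner H (tensor ?a ?b)"
      unfolding opmat_compose[OF x] y a by (rule infsumI)
    moreover have "cinner (col_vec H r) ?a = coord (row_vec (amp x H) i) r" for r
    proof -
      have "cinner (col_vec H r) ?a = cnj (cinner ?a (col_vec H r))" by (rule cnj_cinner[symmetric])
      also have "\<dots> = coord (blinfun_apply x (col_vec H r)) i" by (simp add: cinner_adj_left[OF x])
      finally show ?thesis by (simp add: coord_amp)
    qed
    then have "((\<lambda>r. coord (row_vec (amp x H) i) r * cnj (coord ?b r)) has_sum cinner H (tensor ?a ?b)) UNIV"
      using has_sum_tensor_cols[of H ?a ?b] by simp
    then have "cinner (row_vec (amp x H) i) ?b = cinner H (tensor ?a ?b)"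
      by (rule has_sum_unique[OF has_sum_cinner])
    ultimately show ?thesis by simp
  qed
  then show ?thesis using has_sum_cinner_rows[of "amp x H" K] by simp
qed

lemma Tr_nuclear:
  assumes "x \<in> Bl2" "\<And>i j. opmat y i j = cinner (row_vec H i) (row_vec K j)"
  shows "Tr (x o\<^sub>L y) = cinner (amp x H) K"
  unfolding Tr_def by (rule infsumI[OF has_sum_trace_nuclear[OF assms]])

lemma cinner_sum_right: "cinner y (\<Sum>i\<in>F. f i) = (\<Sum>i\<in>F. cinner y (f i))"
  by (rule bounded_linear.linear[THEN linear_sum, OF bounded_bilinear.bounded_linear_right[OF bounded_bilinear_cinner]])

lemma gram_sum:
  "(\<Sum>i\<in>F. \<Sum>j\<in>F. cinner (g i) (g j) * x j * cnj (y i)) =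
    cinner (\<Sum>i\<in>F. cscale (cnj (y i)) (g i)) (\<Sum>j\<in>F. cscale (cnj (x j)) (g j))"
  unfolding cinner_sum_left unfolding cinner_sum_right by (simp add: mult_ac)

text \<open>
  The operator \<open>G G\<^sup>*\<close> is positive, so it is its own absolute value, and its trace is \<open>\<parallel>G\<parallel>\<^sup>2\<close>.
\<close>
lemma positive_of_gram:
  fixes G :: "('i \<times> 'r, complex) ell2"
  obtains L where "L \<in> trace_class" "pos_op L" "\<And>i j. opmat L i j = cinner (row_vec G i) (row_vec G j)"
proof -
  have bd: "(norm (\<Sum>i\<in>F. cscale (cnj (y i)) (row_vec G i)))\<^sup>2 \<le> (norm G)\<^sup>2 * (\<Sum>i\<in>F. (norm (y i))\<^sup>2)"
    if F: "finite F" for F and y :: "'i \<Rightarrow> complex"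
  proof -
    have "norm (\<Sum>i\<in>F. cscale (cnj (y i)) (row_vec G i)) \<le> (\<Sum>i\<in>F. norm (y i) * norm (row_vec G i))"
      by (rule norm_sum[THEN order_trans]) (simp add: norm_cscale)
    then have "(norm (\<Sum>i\<in>F. cscale (cnj (y i)) (row_vec G i)))\<^sup>2 \<le> (\<Sum>i\<in>F. norm (y i) * norm (row_vec G i))\<^sup>2"
      by (rule power_mono) simp
    also have "\<dots> \<le> (\<Sum>i\<in>F. (norm (y i))\<^sup>2) * (\<Sum>i\<in>F. (norm (row_vec G i))\<^sup>2)"
      by (rule Cauchy_Schwarz_ineq_sum)
    also have "\<dots> \<le> (\<Sum>i\<in>F. (norm (y i))\<^sup>2) * (norm G)\<^sup>2"
      by (intro mult_left_mono sum_norm_row_le F sum_nonneg) auto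
    finally show ?thesis by (simp add: mult.commute)
  qed
  have "form_bounded (\<lambda>i j. cinner (row_vec G i) (row_vec G j)) ((norm G)\<^sup>2)"
    unfolding form_bounded_def
  proof (intro allI impI)
    fix F :: "'i set" and x y :: "'i \<Rightarrow> complex" assume F: "finite F"
    let ?a = "\<Sum>i\<in>F. cscale (cnj (y i)) (row_vec G i)" and ?b = "\<Sum>i\<in>F. cscale (cnj (x i)) (row_vec G i)"
    have "Re (\<Sum>i\<in>F. \<Sum>j\<in>F. cinner (row_vec G i) (row_vec G j) * x j * cnj (y i)) = inner ?a ?b"
      unfolding gram_sum by (rule Re_cinner)
    also have "\<dots> \<le> norm ?a * norm ?b" by (rule norm_cauchy_schwarz)
    also have "\<dots> \<le> ((norm ?a)\<^sup>2 + (norm ?b)\<^sup>2) / 2" using sum_squares_bound[of "norm ?a" "norm ?b"] by simp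
    also have "\<dots> \<le> (norm G)\<^sup>2 / 2 * ((\<Sum>i\<in>F. (norm (x i))\<^sup>2) + (\<Sum>i\<in>F. (norm (y i))\<^sup>2))"
      using bd[OF F, of x] bd[OF F, of y] by (simp add: algebra_simps)
    finally show "Re (\<Sum>i\<in>F. \<Sum>j\<in>F. cinner (row_vec G i) (row_vec G j) * x j * cnj (y i)) \<le>
      (norm G)\<^sup>2 / 2 * ((\<Sum>i\<in>F. (norm (x i))\<^sup>2) + (\<Sum>i\<in>F. (norm (y i))\<^sup>2))" .
  qed
  then obtain L where L: "L \<in> Bl2" "opmat L = (\<lambda>i j. cinner (row_vec G i) (row_vec G j))"
    by (rule op_of_form_bounded) auto
  have "cinner (blinfun_apply L x) x \<in> \<real>\<^sub>\<ge>\<^sub>0" for x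
  proof (rule Lim_in_closed_set[OF closed_nonneg_Reals_complex])
    let ?x = "\<lambda>F. fin_vec F (coord x)"
    show "((\<lambda>F. cinner (blinfun_apply L (?x F)) (?x F)) \<longlongrightarrow> cinner (blinfun_apply L x) x) (finite_subsets_at_top UNIV)"
      by (intro tendsto_cinner tendsto_apply_fin_vec tendsto_fin_vec)
    show "\<forall>\<^sub>F F in finite_subsets_at_top UNIV. cinner (blinfun_apply L (?x F)) (?x F) \<in> \<real>\<^sub>\<ge>\<^sub>0"
      using eventually_finite_sets
    proof eventually_elim
      case (elim F)
      have "cinner (blinfun_apply L (?x F)) (?x F) =
          of_real ((norm (\<Sum>i\<in>F. cscale (cnj (coord x i)) (row_vec G i)))\<^sup>2)"
        unfolding cinner_apply_fin_vec[OF L(1) elim] L(2) gram_sum by (rule cinner_self)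
      then show ?case by (simp only: nonneg_Reals_of_real_iff) simp
    qed
  qed simp
  then have pos: "pos_op L" using L(1) by (simp add: pos_op_def)
  have "adj L = L"
    by (rule Bl2_eqI) (auto intro!: ext simp: L adj_in_Bl2 opmat_adj cnj_cinner)
  then have "is_abs_op L L" using pos by (simp add: is_abs_op_def)
  moreover have "(\<lambda>i. Re (opmat L i i)) summable_on UNIV"
  proof (rule nonneg_bdd_above_summable_on)
    have eq: "Re (opmat L i i) = (norm (row_vec G i))\<^sup>2" for i
      by (simp only: L(2) cinner_self Re_complex_of_real)
    then show "0 \<le> Re (opmat L i i)" for i by simp
    show "bdd_above (sum (\<lambda>i. Re (opmat L i i)) ` {F. F \<subseteq> UNIV \<and> finite F})"
      unfolding eq by (auto intro!: bdd_aboveI2[where M = "(norm G)\<^sup>2"] sum_norm_row_le)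
  qed
  ultimately have "L \<in> trace_class" using L(1) by (auto simp: trace_class_def)
  then show ?thesis using that pos L(2) by simp
qed

lemma topspace_weak_star [simp]: "topspace weak_star = Bl2"
  by (auto simp: weak_star_def topspace_pullback_topology)

lemma continuous_map_Tr:
  assumes "y \<in> trace_class"
  shows "continuous_map weak_star euclidean (\<lambda>x. Tr (x o\<^sub>L y))"
proof -
  have "continuous_map weak_star euclidean ((\<lambda>f. f y) \<circ> (\<lambda>x. \<lambda>y\<in>trace_class. Tr (x o\<^sub>L y)))"
    unfolding weak_star_def
    by (rule continuous_map_pullback, rule continuous_map_product_projection[OF assms])
  then show ?thesis using assms by (simp add: comp_def)
qed

lemma continuous_map_weak_starI:
  assumes "\<And>t. t \<in> topspace X \<Longrightarrow> f t \<in> Bl2"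
    and "\<And>y. y \<in> trace_class \<Longrightarrow> continuous_map X euclidean (\<lambda>t. Tr (f t o\<^sub>L y))"
  shows "continuous_map X weak_star f"
  unfolding weak_star_def
proof (rule continuous_map_pullback')
  show "continuous_map X (product_topology (\<lambda>_. euclidean) trace_class)
      ((\<lambda>x. \<lambda>y\<in>trace_class. Tr (x o\<^sub>L y)) \<circ> f)"
    unfolding continuous_map_componentwise using assms(2) by (auto simp: comp_def)
qed (use assms(1) in auto)

lemma continuous_map_complex_mult_left:
  fixes f :: "'a \<Rightarrow> complex"
  shows "continuous_map X euclidean f \<Longrightarrow> continuous_map X euclidean (\<lambda>x. c * f x)"
  by (simp add: continuous_map_atin tendsto_mult)

text \<open>
  For trace class operators this is the definition of the topology.  By the polarization identity
  \<open>4 H K\<^sup>* = \<Sum>\<^sub>\<omega> \<omega> (H + \<omega> K) (H + \<omega> K)\<^sup>*\<close>, with \<open>\<omega>\<close> ranging over the fourth roots of unity, \<open>H K\<^sup>*\<close> is a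
  combination of positive ones.
\<close>
lemma continuous_map_Tr_nuclear:
  assumes y: "\<And>i j. opmat y i j = cinner (row_vec H i) (row_vec K j)"
  shows "continuous_map weak_star euclidean (\<lambda>x. Tr (x o\<^sub>L y))"
proof -
  have "\<exists>L\<in>trace_class. \<forall>i j. opmat L i j = cinner (row_vec (H + cscale w K) i) (row_vec (H + cscale w K) j)" for w
    using positive_of_gram[of "H + cscale w K"] by metis
  then obtain L where L: "\<And>w. L w \<in> trace_class"
    "\<And>w i j. opmat (L w) i j = cinner (row_vec (H + cscale w K) i) (row_vec (H + cscale w K) j)" by metis
  have "continuous_map weak_star euclidean
    (\<lambda>x. (1/4) * (Tr (x o\<^sub>L L 1) + \<i> * Tr (x o\<^sub>L L \<i>) - Tr (x o\<^sub>L L (-1)) - \<i> * Tr (x o\<^sub>L L (-\<i>))))"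
    by (intro continuous_map_complex_mult_left continuous_map_add continuous_map_diff continuous_map_Tr L)
  then show ?thesis
  proof (rule continuous_map_eq)
    fix x :: "'a oper" assume "x \<in> topspace weak_star"
    then have x: "x \<in> Bl2" by simp
    show "(1/4) * (Tr (x o\<^sub>L L 1) + \<i> * Tr (x o\<^sub>L L \<i>) - Tr (x o\<^sub>L L (-1)) - \<i> * Tr (x o\<^sub>L L (-\<i>))) = Tr (x o\<^sub>L y)"
      unfolding Tr_nuclear[OF x L(2)] Tr_nuclear[OF x y]
      by (simp add: amp_add amp_cscale[OF x] cinner_add_left cinner_add_right algebra_simps)
  qed
qed

section \<open>Trace class operators factor through Hilbert-Schmidt matrices\<close>

text \<open>
  The imaginary part of an inner product is a real part with \<open>y\<close> replaced by \<open>\<i> y\<close>.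
\<close>
lemma cinner_eq_of_inner_eq:
  assumes "\<And>y. inner a (f y) = inner b (g y)"
    and "\<And>c y. f (cscale c y) = cscale c (f y)" "\<And>c y. g (cscale c y) = cscale c (g y)"
  shows "cinner a (f y) = cinner b (g y)"
proof (rule complex_eqI)
  show "Re (cinner a (f y)) = Re (cinner b (g y))" by (simp add: Re_cinner assms)
  have "Im (cinner a (f y)) = Re (cinner a (f (cscale \<i> y)))" by (simp add: assms(2))
  also have "\<dots> = Re (cinner b (g (cscale \<i> y)))" by (simp only: Re_cinner assms(1))
  also have "\<dots> = Im (cinner b (g y))" by (simp add: assms(3))
  finally show "Im (cinner a (f y)) = Im (cinner b (g y))" .
qed

lemma pos_op_hermitian:
  assumes "pos_op P"
  shows "cinner (blinfun_apply P x) y = cinner x (blinfun_apply P y)"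
proof -
  have P: "P \<in> Bl2" and im: "Im (cinner (blinfun_apply P x) x) = 0" for x
    using assms by (auto simp: pos_op_def complex_nonneg_Reals_iff)
  have 1: "Im (cinner (blinfun_apply P x) y) + Im (cinner (blinfun_apply P y) x) = 0" for x y
    using im[of "x + y"] im[of x] im[of y]
    by (simp add: blinfun.add_right cinner_add_left cinner_add_right)
  have 2: "Re (cinner (blinfun_apply P y) x) = Re (cinner (blinfun_apply P x) y)"
    using 1[of x "cscale \<i> y"] by (simp add: Bl2_cscale[OF P])
  have "cinner (blinfun_apply P x) y = cnj (cinner (blinfun_apply P y) x)"
    using 1[of x y] 2 by (simp add: complex_eq_iff)
  then show ?thesis by (simp add: cnj_cinner)
qed

text \<open>
  On the real orthonormal basis \<open>e\<^sub>i, \<i> e\<^sub>i\<close> the operator defines a real kernel, which has Gram vectors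
  \<open>z\<close>.  The vectors \<open>(z(e\<^sub>i) + \<i> z(\<i> e\<^sub>i)) / \<surd>2\<close> then represent the complex matrix.
\<close>
lemma positive_gram:
  assumes P: "pos_op P" and summ: "(\<lambda>i. Re (opmat P i i)) summable_on UNIV"
  obtains G :: "('i \<times> ('i \<times> bool), complex) ell2"
  where "\<And>i j. opmat (P :: 'i oper) i j = cinner (row_vec G i) (row_vec G j)"
proof -
  have PB: "P \<in> Bl2" using P by (simp add: pos_op_def)
  define b :: "'i \<times> bool \<Rightarrow> ('i, complex) ell2"
    where "b p = cscale (if snd p then \<i> else 1) (unit_vec (fst p))" for p
  have sym: "inner (blinfun_apply P x) y = inner (blinfun_apply P y) x" for x y
    using pos_op_hermitian[OF P, of x y] by (simp add: Re_cinner[symmetric] cnj_cinner[of x, symmetric])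
  have "psd (\<lambda>p q. inner (blinfun_apply P (b p)) (b q))"
  proof (rule psdI)
    fix F :: "('i \<times> bool) set" and c :: "'i \<times> bool \<Rightarrow> real"
    let ?x = "\<Sum>p\<in>F. c p *\<^sub>R b p"
    have "(\<Sum>p\<in>F. \<Sum>q\<in>F. c p * c q * inner (blinfun_apply P (b p)) (b q)) = inner (blinfun_apply P ?x) ?x"
      unfolding blinfun.sum_right inner_sum_left unfolding inner_sum_right
      by (simp add: blinfun.scaleR_right mult_ac)
    also have "\<dots> = Re (cinner (blinfun_apply P ?x) ?x)" by (rule Re_cinner[symmetric])
    also have "\<dots> \<ge> 0" using P by (auto simp: pos_op_def complex_nonneg_Reals_iff)
    finally show "0 \<le> (\<Sum>p\<in>F. \<Sum>q\<in>F. c p * c q * inner (blinfun_apply P (b p)) (b q))" .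
  qed (rule sym)
  then obtain z :: "'i \<times> bool \<Rightarrow> ('i \<times> bool, real) ell2" where
    z: "\<And>p q. inner (z p) (z q) = inner (blinfun_apply P (b p)) (b q)"
    using psd_gram[of "\<lambda>p q. inner (blinfun_apply P (b p)) (b q)"] by blast
  define g where "g i = (1 / sqrt 2) *\<^sub>R (cplx (z (i, False)) + cscale \<i> (cplx (z (i, True))))" for i
  have g: "opmat P i j = cinner (g i) (g j)" for i j
  proof -
    have ij: "opmat P i j = cnj (opmat P j i)"
      using pos_op_hermitian[OF P, of "unit_vec j" "unit_vec i"] by (simp add: opmat_eq_coord)
    have zz: "inner (z (k, False)) (z (l, False)) = Re (opmat P l k)"
      "inner (z (k, True)) (z (l, True)) = Re (opmat P l k)"
      "inner (z (k, True)) (z (l, False)) = - Im (opmat P l k)"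
      "inner (z (k, False)) (z (l, True)) = Im (opmat P l k)" for k l
      unfolding z b_def by (simp_all add: Bl2_cscale[OF PB] Re_cinner[symmetric] opmat_eq_coord)
    have "cinner (g i) (g j) = (1/2) * (of_real (inner (z (i, False)) (z (j, False))) +
        of_real (inner (z (i, True)) (z (j, True))) + \<i> * of_real (inner (z (i, True)) (z (j, False)))
        - \<i> * of_real (inner (z (i, False)) (z (j, True))))"
      unfolding g_def
      by (simp add: cinner_scaleR_left cinner_scaleR_right cinner_add_left cinner_add_right
        scaleR_conv_of_real algebra_simps flip: of_real_mult)
    also have "\<dots> = opmat P i j" unfolding ij zz by (simp add: complex_eq_iff)
    finally show ?thesis by simp
  qed
  have "(\<Sum>i\<in>F. (norm (g i))\<^sup>2) \<le> (\<Sum>\<^sub>\<infinity>i. Re (opmat P i i))" if F: "finite F" for F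
  proof -
    have eq: "(norm (g i))\<^sup>2 = Re (opmat P i i)" for i by (simp add: g cinner_self del: of_real_power)
    show ?thesis
      unfolding eq by (rule finite_sum_le_infsum[OF summ F]) (auto simp flip: eq)
  qed
  from ell2_of_rows[OF this] obtain G where "\<And>i. row_vec G i = g i" by blast
  then have "opmat P i j = cinner (row_vec G i) (row_vec G j)" for i j by (simp add: g)
  then show ?thesis by (rule that)
qed

lemma closure_linear_combination:
  fixes S :: "('i, complex) ell2 set"
  assumes add: "\<And>x y. x \<in> S \<Longrightarrow> y \<in> S \<Longrightarrow> x + y \<in> S" and sc: "\<And>c x. x \<in> S \<Longrightarrow> cscale c x \<in> S" and z: "0 \<in> S"
    and w: "\<And>i. w i \<in> closure S"
  shows "(\<Sum>i\<in>F. cscale (c i) (w i)) \<in> closure S"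
proof -
  obtain s where s: "\<And>i n. s i n \<in> S" "\<And>i. s i \<longlonglongrightarrow> w i"
    using w unfolding closure_sequential by metis
  have mem: "(\<Sum>i\<in>F. cscale (c i) (s i n)) \<in> S" for n
    by (induction F rule: infinite_finite_induct) (auto intro: add sc z s)
  have "(\<lambda>n. \<Sum>i\<in>F. cscale (c i) (s i n)) \<longlonglongrightarrow> (\<Sum>i\<in>F. cscale (c i) (w i))"
    by (intro tendsto_sum bounded_linear.tendsto[OF bounded_linear_cscale] s)
  with mem show ?thesis unfolding closure_sequential by (intro exI[of _ "\<lambda>n. \<Sum>i\<in>F. cscale (c i) (s i n)"]) blast
qed

text \<open>
  In the polar decomposition \<open>T = U P\<close> the vector \<open>w i\<close> is \<open>U\<^sup>* e\<^sub>i\<close>.  It exists because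
  \<open>P y \<mapsto> \<langle>e\<^sub>i, T y\<rangle>\<close> is well defined and bounded by 1, and the second property says that \<open>U\<close> is a
  contraction.
\<close>
lemma polar_rows:
  fixes T P :: "'i oper"
  assumes T: "T \<in> Bl2" and P: "P \<in> Bl2"
    and eq: "\<And>y. norm (blinfun_apply T y) = norm (blinfun_apply P y)"
  obtains w where "\<And>i y. cinner (w i) (blinfun_apply P y) = cnj (coord (blinfun_apply T y) i)"
    "\<And>F x. finite F \<Longrightarrow> (\<Sum>i\<in>F. (norm (cinner x (w i)))\<^sup>2) \<le> (norm x)\<^sup>2"
proof -
  let ?S = "range (blinfun_apply P)"
  have "\<exists>w. w \<in> closure ?S \<and> (\<forall>y. inner w (blinfun_apply P y) = inner (unit_vec i) (blinfun_apply T y))" for i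
  proof -
    define g where "g y = (blinfun_apply P y, inner (unit_vec i) (blinfun_apply T y))" for y
    define \<Gamma> where "\<Gamma> = range g"
    have "linear g"
      unfolding g_def
      by (intro linearI) (simp_all add: blinfun.add_right blinfun.scaleR_right inner_add_right)
    then have sub: "subspace \<Gamma>" unfolding \<Gamma>_def by (rule linear_subspace_image[OF _ subspace_UNIV])
    have bd: "\<bar>s\<bar> \<le> 1 * norm v" if vs: "(v, s) \<in> \<Gamma>" for v s
    proof -
      obtain y where "v = blinfun_apply P y" "s = inner (unit_vec i) (blinfun_apply T y)"
        using vs unfolding \<Gamma>_def g_def by blast
      then show ?thesis using Cauchy_Schwarz_ineq2[of "unit_vec i" "blinfun_apply T y"] eq[of y] by simp
    qed
    obtain w where w: "w \<in> closure (fst ` \<Gamma>)" "\<And>v s. (v, s) \<in> \<Gamma> \<Longrightarrow> inner w v = s" "norm w \<le> 1"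
      by (rule riesz_graph[of \<Gamma> 1]) (use sub bd in auto)
    have "fst ` \<Gamma> = ?S" by (simp add: \<Gamma>_def g_def image_image)
    moreover have "inner w (blinfun_apply P y) = inner (unit_vec i) (blinfun_apply T y)" for y
      by (rule w(2)) (simp add: \<Gamma>_def g_def)
    ultimately show ?thesis using w(1) by auto
  qed
  then obtain w where w: "\<And>i. w i \<in> closure ?S"
    "\<And>i y. inner (w i) (blinfun_apply P y) = inner (unit_vec i) (blinfun_apply T y)" by metis
  have wT: "cinner (w i) (blinfun_apply P y) = cnj (coord (blinfun_apply T y) i)" for i y
  proof -
    have "cinner (w i) (blinfun_apply P y) = cinner (unit_vec i) (blinfun_apply T y)"
      by (rule cinner_eq_of_inner_eq) (use w T P in \<open>auto simp: Bl2_cscale\<close>)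
    then show ?thesis by simp
  qed
  have bessel: "(\<Sum>i\<in>F. (norm (cinner x (w i)))\<^sup>2) \<le> (norm x)\<^sup>2" if F: "finite F" for F x
  proof -
    \<comment> \<open>On the range of \<open>P\<close>, the vector \<open>u = \<Sum> c\<^sub>i w\<^sub>i\<close> acts as \<open>\<Sum> c\<^sub>i e\<^sub>i\<close> does after \<open>T\<close>; as \<open>u\<close> lies in
      the closure of that range, its norm is at most that of \<open>c\<close>.\<close>
    define c where "c i = cinner x (w i)" for i
    define N where "N = (\<Sum>i\<in>F. (norm (c i))\<^sup>2)"
    define u where "u = (\<Sum>i\<in>F. cscale (c i) (w i))"
    have N: "N = (norm (fin_vec F c))\<^sup>2" by (simp add: N_def norm_fin_vec_square F)
    have "u \<in> closure ?S"
      unfolding u_def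
    proof (rule closure_linear_combination[OF _ _ _ w(1)])
      show "a \<in> ?S \<Longrightarrow> b \<in> ?S \<Longrightarrow> a + b \<in> ?S" for a b by (auto simp flip: blinfun.add_right)
      show "a \<in> ?S \<Longrightarrow> cscale k a \<in> ?S" for k a by (auto simp flip: Bl2_cscale[OF P])
      show "0 \<in> ?S" using blinfun.zero_right[of P] by (metis rangeI)
    qed
    moreover have "closure ?S \<subseteq> {v. inner u v \<le> sqrt N * norm v}"
    proof (rule closure_minimal)
      show "?S \<subseteq> {v. inner u v \<le> sqrt N * norm v}"
      proof safe
        fix y
        have "cinner u (blinfun_apply P y) = cinner (fin_vec F c) (blinfun_apply T y)"
          unfolding u_def fin_vec_eq_sum[OF F] cinner_sum_left by (simp add: wT)
        then have "inner u (blinfun_apply P y) = inner (fin_vec F c) (blinfun_apply T y)"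
          by (simp flip: Re_cinner)
        also have "\<dots> \<le> norm (fin_vec F c) * norm (blinfun_apply T y)" by (rule norm_cauchy_schwarz)
        finally show "inner u (blinfun_apply P y) \<le> sqrt N * norm (blinfun_apply P y)" by (simp add: N eq)
      qed
    qed (intro closed_Collect_le continuous_intros)
    ultimately have "inner u u \<le> sqrt N * norm u" by blast
    then have "norm u * norm u \<le> sqrt N * norm u" by (simp add: power2_norm_eq_inner[symmetric] power2_eq_square)
    then have nu: "norm u \<le> sqrt N" by (cases "norm u = 0") (auto simp: N_def sum_nonneg)
    have "N = Re (\<Sum>i\<in>F. cnj (c i) * c i)"
      unfolding N_def cmod_power2 by (simp add: power2_eq_square)
    also have "\<dots> = inner x u"
      unfolding Re_cinner[symmetric] u_def cinner_sum_right by (simp add: c_def)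
    also have "\<dots> \<le> norm x * norm u" by (rule norm_cauchy_schwarz)
    also have "\<dots> \<le> norm x * sqrt N" by (intro mult_left_mono nu) auto
    finally have NN: "N \<le> norm x * sqrt N" .
    have "N \<le> (norm x)\<^sup>2"
    proof (cases "N = 0")
      case False
      then have N0: "0 < N" using sum_nonneg[of F "\<lambda>i. (norm (c i))\<^sup>2"] by (simp add: N_def)
      then have "sqrt N * sqrt N \<le> norm x * sqrt N" using NN by simp
      then have "sqrt N \<le> norm x" by (rule mult_right_le_imp_le) (use N0 in simp)
      then have "(sqrt N)\<^sup>2 \<le> (norm x)\<^sup>2" by (rule power_mono) (use N0 in simp)
      then show ?thesis using N0 by simp
    qed simp
    then show ?thesis by (simp add: N_def c_def)
  qed
  show ?thesis using that wT bessel by blast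
qed

lemma trace_class_in_Bl2: "T \<in> trace_class \<Longrightarrow> T \<in> Bl2"
  by (simp add: trace_class_def)

text \<open>
  With \<open>P = |T| = G G\<^sup>*\<close> and the partial isometry \<open>U\<close> of the polar decomposition, \<open>H = U G\<close> and \<open>K = G\<close>.
  Thus \<open>H\<close> is defined column by column, with columns no longer than those of \<open>G\<close>.
\<close>
theorem trace_class_nuclear:
  fixes T :: "'i oper"
  assumes T: "T \<in> trace_class"
  obtains H K :: "('i \<times> ('i \<times> bool), complex) ell2"
  where "\<And>i j. opmat T i j = cinner (row_vec H i) (row_vec K j)"
proof -
  obtain P where TB: "T \<in> Bl2" and P: "pos_op P" and PP: "P o\<^sub>L P = adj T o\<^sub>L T"
    and summ: "(\<lambda>i. Re (opmat P i i)) summable_on UNIV"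
    using T by (auto simp: trace_class_def is_abs_op_def)
  have PB: "P \<in> Bl2" using P by (simp add: pos_op_def)
  have eq: "norm (blinfun_apply T y) = norm (blinfun_apply P y)" for y
  proof -
    have "of_real ((norm (blinfun_apply T y))\<^sup>2) = cinner (blinfun_apply (adj T o\<^sub>L T) y) y"
      by (simp add: cinner_adj_left[OF TB] cinner_self del: of_real_power)
    also have "\<dots> = of_real ((norm (blinfun_apply P y))\<^sup>2)"
      by (simp add: PP[symmetric] pos_op_hermitian[OF P] cinner_self del: of_real_power)
    finally have "(norm (blinfun_apply T y))\<^sup>2 = (norm (blinfun_apply P y))\<^sup>2" by (simp only: of_real_eq_iff)
    then show ?thesis by (rule power2_eq_imp_eq) auto
  qed
  obtain w where w: "\<And>i y. cinner (w i) (blinfun_apply P y) = cnj (coord (blinfun_apply T y) i)"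
    "\<And>F x. finite F \<Longrightarrow> (\<Sum>i\<in>F. (norm (cinner x (w i)))\<^sup>2) \<le> (norm x)\<^sup>2"
    using polar_rows[OF TB PB eq] by blast
  obtain G :: "('i \<times> ('i \<times> bool), complex) ell2"
    where G: "\<And>i j. opmat P i j = cinner (row_vec G i) (row_vec G j)"
    using positive_gram[OF P summ] by blast
  define h where "h r = Abs_ell2 (\<lambda>i. cinner (col_vec G r) (w i))" for r
  have h: "coord (h r) i = cinner (col_vec G r) (w i)" "(norm (h r))\<^sup>2 \<le> (norm (col_vec G r))\<^sup>2" for r i
    unfolding h_def using ell2_of_bounded_sums[OF w(2), of "col_vec G r"] by auto
  have "(\<Sum>r\<in>R. (norm (h r))\<^sup>2) \<le> (norm G)\<^sup>2" if "finite R" for R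
    by (rule order_trans[OF sum_mono[OF h(2)] sum_norm_col_le[OF that]])
  from ell2_of_cols[OF this] obtain H where H: "\<And>r. col_vec H r = h r" by blast
  have "opmat T i j = cinner (row_vec H i) (row_vec G j)" for i j
  proof -
    have "opmat T i j = cnj (cinner (w i) (blinfun_apply P (unit_vec j)))" by (simp add: w opmat_eq_coord)
    also have "\<dots> = cinner (blinfun_apply P (unit_vec j)) (w i)" by (rule cnj_cinner)
    also have "\<dots> = (\<Sum>\<^sub>\<infinity>k. cnj (coord (w i) k) * cinner (row_vec G k) (row_vec G j))"
      unfolding cinner_def[of _ "w i"] by (simp add: opmat_eq_coord[symmetric] G mult.commute)
    also have "\<dots> = cinner G (tensor (w i) (row_vec G j))" by (rule infsumI[OF has_sum_tensor_rows])
    also have "\<dots> = cinner (row_vec H i) (row_vec G j)"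
    proof (rule has_sum_unique[OF _ has_sum_cinner])
      have "coord (row_vec H i) r = cinner (col_vec G r) (w i)" for r
        using arg_cong[OF H[of r], of "\<lambda>v. coord v i"] by (simp add: h)
      then show "((\<lambda>r. coord (row_vec H i) r * cnj (coord (row_vec G j) r)) has_sum
          cinner G (tensor (w i) (row_vec G j))) UNIV"
        using has_sum_tensor_cols[of G "w i" "row_vec G j"] by simp
    qed
    finally show ?thesis .
  qed
  then show ?thesis using that by blast
qed

text \<open>
  The preadjoint is Schur multiplication by the transposed matrix.  It sends \<open>y = H K\<^sup>*\<close> to \<open>H' K'\<^sup>*\<close>,
  where the rows of \<open>H'\<close> and \<open>K'\<close> are \<open>H\<^sub>i \<otimes> v\<^sub>i\<close> and \<open>K\<^sub>j \<otimes> u\<^sub>j\<close>, so that the functionals defining the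
  topology are pulled back to functionals of the form treated in \<open>continuous_map_Tr_nuclear\<close>.
\<close>
lemma continuous_map_schur_mult:
  fixes u v :: "'i \<Rightarrow> ('s, real) ell2"
  assumes u: "\<And>i. norm (u i) = 1" and v: "\<And>j. norm (v j) = 1"
  shows "continuous_map weak_star weak_star (schur_mult (\<lambda>i j. of_real (inner (u i) (v j))))"
proof (rule continuous_map_weak_starI)
  let ?C = "\<lambda>i j. complex_of_real (inner (u i) (v j))"
  let ?C' = "\<lambda>i j. complex_of_real (inner (v i) (u j))"
  note C = schur_contraction_factorization[of u v, OF u v]
  note C' = schur_contraction_factorization[of v u, OF v u]
  show "schur_mult ?C x \<in> Bl2" if "x \<in> topspace weak_star" for x
    using schur_mult_in_Bl2[OF C] that by simp
  fix y :: "'i oper" assume y: "y \<in> trace_class"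
  note yB = trace_class_in_Bl2[OF y]
  obtain H K :: "('i \<times> ('i \<times> bool), complex) ell2"
    where HK: "\<And>i j. opmat y i j = cinner (row_vec H i) (row_vec K j)"
    using trace_class_nuclear[OF y] by blast
  have tens: "\<exists>H'. \<forall>i. row_vec H' i = tensor (row_vec H i) (cplx (f i))"
    if f: "\<And>i. norm (f i) = 1" for f :: "'i \<Rightarrow> ('s, real) ell2" and H :: "('i \<times> ('i \<times> bool), complex) ell2"
  proof -
    have "(\<Sum>i\<in>F. (norm (tensor (row_vec H i) (cplx (f i))))\<^sup>2) \<le> (norm H)\<^sup>2" if "finite F" for F
      using sum_norm_row_le[OF that, of H] by (simp add: norm_tensor f)
    from ell2_of_rows[OF this] show ?thesis by metis
  qed
  obtain H' where H': "\<And>i. row_vec H' i = tensor (row_vec H i) (cplx (v i))" using tens[where f = v and H = H, OF v] by blast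
  obtain K' where K': "\<And>i. row_vec K' i = tensor (row_vec K i) (cplx (u i))" using tens[where f = u and H = K, OF u] by blast
  have y': "opmat (schur_mult ?C' y) i j = cinner (row_vec H' i) (row_vec K' j)" for i j
    by (simp add: opmat_schur_mult[OF C' yB] HK H' K' cinner_tensor)
  have "continuous_map weak_star euclidean (\<lambda>x. Tr (x o\<^sub>L schur_mult ?C' y))"
    by (rule continuous_map_Tr_nuclear[OF y'])
  then show "continuous_map weak_star euclidean (\<lambda>x. Tr (schur_mult ?C x o\<^sub>L y))"
  proof (rule continuous_map_eq)
    fix x :: "'i oper" assume "x \<in> topspace weak_star"
    then have x: "x \<in> Bl2" by simp
    show "Tr (x o\<^sub>L schur_mult ?C' y) = Tr (schur_mult ?C x o\<^sub>L y)"
      unfolding Tr_def opmat_compose[OF x] opmat_compose[OF schur_mult_in_Bl2[OF C x]]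
        opmat_schur_mult[OF C x] opmat_schur_mult[OF C' yB]
      by (simp add: inner_commute mult_ac)
  qed
qed

text \<open>
  By boundedness, replacing \<open>k\<close> by its finite sections gives a uniform approximation.
\<close>
lemma continuous_on_cinner_of_coord:
  fixes w :: "'t::topological_space \<Rightarrow> ('i, complex) ell2"
  assumes bound: "\<And>t. t \<in> S \<Longrightarrow> norm (w t) \<le> M"
    and cont: "\<And>i. continuous_on S (\<lambda>t. coord (w t) i)"
  shows "continuous_on S (\<lambda>t. cinner (w t) k)"
proof (rule uniform_limit_theorem)
  let ?F = "finite_subsets_at_top (UNIV :: 'i set)"
  have eq: "cinner x (fin_vec F (coord k)) = (\<Sum>i\<in>F. cnj (coord k i) * coord x i)" if "finite F" for x F
    by (simp add: fin_vec_eq_sum[OF that] cinner_sum_right)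
  show "\<forall>\<^sub>F F in ?F. continuous_on S (\<lambda>t. cinner (w t) (fin_vec F (coord k)))"
    using eventually_finite_sets
    by eventually_elim (simp add: eq, intro continuous_intros cont)
  show "uniform_limit S (\<lambda>F t. cinner (w t) (fin_vec F (coord k))) (\<lambda>t. cinner (w t) k) ?F"
  proof (rule uniform_limitI)
    fix e :: real assume e: "0 < e"
    define d where "d = e / (\<bar>M\<bar> + 1)"
    have d: "0 < d" using e by (simp add: d_def)
    have "\<forall>\<^sub>F F in ?F. dist (fin_vec F (coord k)) k < d" by (rule tendstoD[OF tendsto_fin_vec d])
    then show "\<forall>\<^sub>F F in ?F. \<forall>t\<in>S. dist (cinner (w t) (fin_vec F (coord k))) (cinner (w t) k) < e"
    proof eventually_elim
      case (elim F)
      show ?case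
      proof
        fix t assume t: "t \<in> S"
        have "dist (cinner (w t) (fin_vec F (coord k))) (cinner (w t) k) = norm (cinner (w t) (fin_vec F (coord k) - k))"
          by (simp add: dist_norm bounded_bilinear.diff_right[OF bounded_bilinear_cinner])
        also have "\<dots> \<le> norm (w t) * norm (fin_vec F (coord k) - k)" by (rule norm_cinner_le)
        also have "\<dots> \<le> (\<bar>M\<bar> + 1) * norm (fin_vec F (coord k) - k)"
          using bound[OF t] by (intro mult_right_mono) auto
        also have "\<dots> < (\<bar>M\<bar> + 1) * d" using elim by (intro mult_strict_left_mono) (auto simp: dist_norm)
        also have "\<dots> = e" by (simp add: d_def)
        finally show "dist (cinner (w t) (fin_vec F (coord k))) (cinner (w t) k) < e" .
      qed
    qed
  qed
qed simp

text \<open>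
  The previous lemma is used twice: for the rows of \<open>Z t\<close>, that is for \<open>(Z t)\<^sup>* e\<^sub>i\<close>, and then for
  \<open>(Z t \<otimes> 1) H\<close>, which is paired with \<open>K\<close> to give the trace.
\<close>
lemma weak_star_continuous_of_entries:
  fixes Z :: "real \<Rightarrow> 'i oper"
  assumes Z: "\<And>t. t \<in> S \<Longrightarrow> Z t \<in> Bl2" and bound: "\<And>t. t \<in> S \<Longrightarrow> norm (Z t) \<le> M"
    and cont: "\<And>i j. continuous_on S (\<lambda>t. opmat (Z t) i j)"
  shows "continuous_map (top_of_set S) weak_star Z"
proof (rule continuous_map_weak_starI)
  fix y :: "'i oper" assume "y \<in> trace_class"
  then obtain H K :: "('i \<times> ('i \<times> bool), complex) ell2"
    where HK: "\<And>i j. opmat y i j = cinner (row_vec H i) (row_vec K j)"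
    using trace_class_nuclear by blast
  have row: "continuous_on S (\<lambda>t. coord (blinfun_apply (Z t) h) i)" for h i
  proof -
    have "continuous_on S (\<lambda>t. cinner (blinfun_apply (adj (Z t)) (unit_vec i)) h)"
    proof (rule continuous_on_cinner_of_coord)
      fix t assume t: "t \<in> S"
      show "norm (blinfun_apply (adj (Z t)) (unit_vec i)) \<le> M"
        using norm_blinfun[of "adj (Z t)" "unit_vec i"] norm_adj_le[OF Z[OF t]] bound[OF t] by simp
    next
      fix j
      have "continuous_on S (\<lambda>t. cnj (opmat (Z t) i j))" by (intro continuous_intros cont)
      then show "continuous_on S (\<lambda>t. coord (blinfun_apply (adj (Z t)) (unit_vec i)) j)"
        by (rule continuous_on_eq) (simp add: opmat_adj[OF Z] opmat_eq_coord[symmetric])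
    qed
    then have "continuous_on S (\<lambda>t. cnj (cinner (blinfun_apply (adj (Z t)) (unit_vec i)) h))"
      by (intro continuous_intros)
    then show ?thesis
      by (rule continuous_on_eq) (simp add: cinner_adj_left[OF Z])
  qed
  have "continuous_on S (\<lambda>t. cinner (amp (Z t) H) K)"
  proof (rule continuous_on_cinner_of_coord)
    show "norm (amp (Z t) H) \<le> M * norm H" if "t \<in> S" for t
      by (rule order_trans[OF norm_amp_le mult_right_mono[OF bound[OF that]]]) simp
    show "continuous_on S (\<lambda>t. coord (amp (Z t) H) p)" for p
      by (cases p) (simp add: coord_amp row)
  qed
  then have "continuous_on S (\<lambda>t. Tr (Z t o\<^sub>L y))"
    by (rule continuous_on_eq) (simp add: Tr_nuclear[OF Z HK])
  then show "continuous_map (top_of_set S) euclidean (\<lambda>t. Tr (Z t o\<^sub>L y))" by simp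
qed (use Z in auto)

section \<open>Dilating contractive Schur multipliers\<close>

lemma inner_fin_vec:
  fixes x :: "('j, real) ell2"
  assumes "finite J" shows "inner x (fin_vec J q) = (\<Sum>j\<in>J. coord x j * q j)"
proof -
  have "inner x (fin_vec J q) = (\<Sum>\<^sub>\<infinity>j\<in>J. coord x j * q j)"
    unfolding inner_ell2_def by (rule infsum_cong_neutral) (use assms in auto)
  then show ?thesis using assms by simp
qed

text \<open>
  If \<open>p\<close> is not within \<open>e\<close> of the cone, it does not belong to the closure of the cone in the Hilbert
  space of families on \<open>J\<close>; the vector from \<open>p\<close> to its nearest point in that closure separates.
\<close>
lemma cone_separation:
  fixes Q :: "('j \<Rightarrow> real) set" and p :: "'j \<Rightarrow> real"
  assumes J: "finite J" and e: "0 < e"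
    and cone: "\<And>q q' r s. q \<in> Q \<Longrightarrow> q' \<in> Q \<Longrightarrow> 0 \<le> r \<Longrightarrow> 0 \<le> s \<Longrightarrow> (\<lambda>j. r * q j + s * q' j) \<in> Q"
    and ne: "Q \<noteq> {}" and far: "\<And>q. q \<in> Q \<Longrightarrow> \<exists>j\<in>J. e < \<bar>q j - p j\<bar>"
  obtains w where "\<And>q. q \<in> Q \<Longrightarrow> 0 \<le> (\<Sum>j\<in>J. w j * q j)" "(\<Sum>j\<in>J. w j * p j) < 0"
proof -
  let ?f = "\<lambda>q. fin_vec J q :: ('j, real) ell2"
  let ?S = "closure (?f ` Q)"
  have lin: "?f (\<lambda>j. r * q j + s * q' j) = r *\<^sub>R ?f q + s *\<^sub>R ?f q'" for r s q q'
    by (rule ell2_eqI) (simp add: J)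
  have "convex (?f ` Q)"
  proof (rule convexI)
    fix a b and r s :: real assume "a \<in> ?f ` Q" "b \<in> ?f ` Q" and rs: "0 \<le> r" "0 \<le> s"
    then obtain q q' where q: "q \<in> Q" "q' \<in> Q" "a = ?f q" "b = ?f q'" by blast
    have "r *\<^sub>R a + s *\<^sub>R b = ?f (\<lambda>j. r * q j + s * q' j)" by (simp add: q lin)
    then show "r *\<^sub>R a + s *\<^sub>R b \<in> ?f ` Q" by (rule image_eqI[OF _ cone[OF q(1,2) rs]])
  qed
  then have conv: "convex ?S" by (rule convex_closure)
  obtain w where w: "w \<in> ?S" "\<And>v. v \<in> ?S \<Longrightarrow> inner (?f p - w) (v - w) \<le> 0"
    by (rule closed_convex_nearest_point[of ?S "?f p"]) (use conv ne in auto)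
  have "w \<noteq> ?f p"
  proof
    assume "w = ?f p"
    then obtain q where q: "q \<in> Q" "dist (?f q) (?f p) < e"
      using w(1) e unfolding closure_approachable by blast
    obtain j where j: "j \<in> J" "e < \<bar>q j - p j\<bar>" using far[OF q(1)] by blast
    have "\<bar>q j - p j\<bar> = norm (coord (?f q - ?f p) j)" using J j by simp
    also have "\<dots> \<le> norm (?f q - ?f p)" by (rule norm_coord_le)
    finally show False using q(2) j(2) by (simp add: dist_norm)
  qed
  then have pos: "0 < inner (?f p - w) (?f p - w)" by simp
  have *: "r * inner (?f p - w) (?f q) \<le> inner (?f p - w) w" if "q \<in> Q" "0 \<le> r" for q r
  proof -
    have "r *\<^sub>R ?f q \<in> ?f ` Q"
    proof (rule image_eqI)
      show "r *\<^sub>R ?f q = ?f (\<lambda>j. r * q j + 0 * q j)" unfolding lin by simp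
    qed (rule cone[OF that(1) that(1) that(2) order_refl])
    then have "r *\<^sub>R ?f q \<in> ?S" by (rule subsetD[OF closure_subset])
    from w(2)[OF this] show ?thesis by (simp add: inner_diff_right)
  qed
  have neg: "inner (?f p - w) (?f q) \<le> 0" if "q \<in> Q" for q
  proof (rule ccontr)
    assume a: "\<not> inner (?f p - w) (?f q) \<le> 0"
    have "0 \<le> inner (?f p - w) w" using *[OF that, of 0] by simp
    then show False using *[OF that, of "(inner (?f p - w) w + 1) / inner (?f p - w) (?f q)"] a by simp
  qed
  obtain q where "q \<in> Q" using ne by blast
  then have "0 \<le> inner (?f p - w) w" using *[of q 0] by simp
  then have pp: "0 < inner (?f p - w) (?f p)" using pos by (simp add: inner_diff_right)
  show ?thesis
  proof
    show "0 \<le> (\<Sum>j\<in>J. coord (w - ?f p) j * q j)" if "q \<in> Q" for q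
      using neg[OF that] unfolding inner_fin_vec[OF J, symmetric] inner_diff_left by simp
    show "(\<Sum>j\<in>J. coord (w - ?f p) j * p j) < 0"
      using pp unfolding inner_fin_vec[OF J, symmetric] inner_diff_left by simp
  qed
qed

lemma sum_off_diagonal:
  fixes f :: "('i + 'i) \<times> ('i + 'i) \<Rightarrow> real"
  assumes F: "finite F"
  shows "(\<Sum>p\<in>(\<lambda>k. (k, k)) ` (F <+> F) \<union> (\<lambda>(i, j). (Inl i, Inr j)) ` (F \<times> F). f p) =
    (\<Sum>i\<in>F. f (Inl i, Inl i)) + (\<Sum>j\<in>F. f (Inr j, Inr j)) + (\<Sum>i\<in>F. \<Sum>j\<in>F. f (Inl i, Inr j))"
proof -
  have "(\<Sum>p\<in>(\<lambda>k. (k, k)) ` (F <+> F) \<union> (\<lambda>(i, j). (Inl i, Inr j)) ` (F \<times> F). f p) =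
      (\<Sum>p\<in>(\<lambda>k. (k, k)) ` (F <+> F). f p) + (\<Sum>p\<in>(\<lambda>(i, j). (Inl i, Inr j)) ` (F \<times> F). f p)"
    by (rule sum.union_disjoint) (use F in auto)
  also have "(\<Sum>p\<in>(\<lambda>k. (k, k)) ` (F <+> F). f p) = (\<Sum>k\<in>F <+> F. f (k, k))"
    by (subst sum.reindex) (auto simp: inj_on_def)
  also have "\<dots> = (\<Sum>i\<in>F. f (Inl i, Inl i)) + (\<Sum>j\<in>F. f (Inr j, Inr j))"
    unfolding sum.Plus[OF F F] by (simp add: comp_def)
  also have "(\<Sum>p\<in>(\<lambda>(i, j). (Inl i, Inr j)) ` (F \<times> F). f p) = (\<Sum>i\<in>F. \<Sum>j\<in>F. f (Inl i, Inr j))"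
    by (subst sum.reindex) (auto simp: inj_on_def sum.cartesian_product case_prod_beta intro!: sum.cong)
  finally show ?thesis .
qed

text \<open>
  The real counterpart, restricted to \<open>F\<close> and with constant 1, of \<^const>\<open>form_bounded\<close>.
\<close>
definition dominated_form :: "'i set \<Rightarrow> ('i \<Rightarrow> 'i \<Rightarrow> real) \<Rightarrow> bool"
  where "dominated_form F b \<longleftrightarrow>
    (\<forall>x y. (\<Sum>i\<in>F. \<Sum>j\<in>F. b i j * x j * y i) \<le> ((\<Sum>i\<in>F. (x i)\<^sup>2) + (\<Sum>i\<in>F. (y i)\<^sup>2)) / 2)"

text \<open>
  The finite part of the theorem of Grothendieck and Haagerup on Schur multipliers.  If no such kernel
  existed, a functional would separate \<open>(1, c)\<close> from the cone of all
  (diagonal, off-diagonal block) pairs of positive semidefinite kernels: there would be weights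
  \<open>\<lambda>, \<mu>\<close> and a matrix \<open>b\<close> with \<open>\<Sum> \<lambda>\<^sub>i + \<Sum> \<mu>\<^sub>j + \<Sum> b\<^sub>i\<^sub>j c\<^sub>i\<^sub>j < 0\<close>, while evaluation at kernels of rank one
  gives \<open>\<Sum> \<lambda>\<^sub>i y\<^sub>i\<^sup>2 + \<Sum> \<mu>\<^sub>j x\<^sub>j\<^sup>2 + \<Sum> b\<^sub>i\<^sub>j y\<^sub>i x\<^sub>j \<ge> 0\<close> for all \<open>x, y\<close>.  By the latter,
  \<open>- b\<^sub>i\<^sub>j / 2\<surd>(\<lambda>\<^sub>i \<mu>\<^sub>j)\<close> is dominated; applying the hypothesis to it and evaluating at
  \<open>\<surd>\<mu>\<^sub>j\<close> and \<open>\<surd>\<lambda>\<^sub>i\<close> contradicts the former.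
\<close>
lemma psd_dilation_approx:
  fixes c :: "'i \<Rightarrow> 'i \<Rightarrow> real"
  assumes F: "finite F" and e: "0 < e"
    and contr: "\<And>b. dominated_form F b \<Longrightarrow> dominated_form F (\<lambda>i j. c i j * b i j)"
  obtains M where "psd M" "\<And>k. k \<in> F <+> F \<Longrightarrow> \<bar>M k k - 1\<bar> \<le> e"
    "\<And>i j. i \<in> F \<Longrightarrow> j \<in> F \<Longrightarrow> \<bar>M (Inl i) (Inr j) - c i j\<bar> \<le> e"
proof (rule ccontr)
  assume contra: "\<not> thesis"
  note dilation = that
  let ?J = "(\<lambda>k. (k, k)) ` (F <+> F) \<union> (\<lambda>(i, j). (Inl i, Inr j)) ` (F \<times> F) :: (('i + 'i) \<times> ('i + 'i)) set"
  define Q :: "(('i + 'i) \<times> ('i + 'i) \<Rightarrow> real) set" where "Q = {q. psd (curry q)}"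
  define p :: "('i + 'i) \<times> ('i + 'i) \<Rightarrow> real"
    where "p = (\<lambda>(k, l). case k of Inl i \<Rightarrow> (case l of Inl _ \<Rightarrow> 1 | Inr j \<Rightarrow> c i j) | Inr _ \<Rightarrow> 1)"
  have far: "\<exists>j\<in>?J. e < \<bar>q j - p j\<bar>" if q: "q \<in> Q" for q
  proof (rule ccontr)
    assume "\<not> ?thesis"
    then have near: "\<bar>q j - p j\<bar> \<le> e" if "j \<in> ?J" for j using that by (meson not_less)
    have thesis
    proof (rule dilation)
      show "psd (curry q)" using q by (simp add: Q_def)
      show "\<bar>curry q k k - 1\<bar> \<le> e" if "k \<in> F <+> F" for k
        using near[of "(k, k)"] that by (cases k) (auto simp: p_def)
      show "\<bar>curry q (Inl i) (Inr j) - c i j\<bar> \<le> e" if "i \<in> F" "j \<in> F" for i j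
      proof -
        have "(Inl i, Inr j) \<in> ?J" using that by force
        then show ?thesis using near[of "(Inl i, Inr j)"] by (simp add: p_def)
      qed
    qed
    with contra show False ..
  qed
  obtain w where w: "\<And>q. q \<in> Q \<Longrightarrow> 0 \<le> (\<Sum>j\<in>?J. w j * q j)" "(\<Sum>j\<in>?J. w j * p j) < 0"
  proof (rule cone_separation[of ?J e Q p])
    show "(\<lambda>j. r * q j + s * q' j) \<in> Q" if "q \<in> Q" "q' \<in> Q" "0 \<le> r" "0 \<le> s" for q q' r s
      using psd_add[OF psd_scale[of "curry q" r] psd_scale[of "curry q'" s]] that
      by (simp add: Q_def curry_def)
    show "Q \<noteq> {}" using psd_const[of 0] by (auto simp: Q_def curry_def)
  qed (use F e far in auto)
  define la where "la i = w (Inl i, Inl i)" for i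
  define \<mu> where "\<mu> j = w (Inr j, Inr j)" for j
  define b where "b i j = w (Inl i, Inr j)" for i j
  have form: "0 \<le> (\<Sum>i\<in>F. la i * (y i)\<^sup>2) + (\<Sum>j\<in>F. \<mu> j * (x j)\<^sup>2) + (\<Sum>i\<in>F. \<Sum>j\<in>F. b i j * (y i * x j))" for x y
  proof -
    have "psd (\<lambda>k l. case_sum y x k * case_sum y x l)"
      using psd_inner[of "case_sum y x"] by simp
    then have "(\<lambda>(k, l). case_sum y x k * case_sum y x l) \<in> Q" by (simp add: Q_def curry_def)
    from w(1)[OF this] show ?thesis
      unfolding sum_off_diagonal[OF F] by (simp add: la_def \<mu>_def b_def power2_eq_square)
  qed
  have la: "0 \<le> la i" if "i \<in> F" for i
    using form[of "\<lambda>k. if k = i then 1 else 0" "\<lambda>_. 0"] that F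
    by (simp add: if_distrib[of "\<lambda>x. _ * x"] if_distrib[of "\<lambda>x. x ^ _"] cong: if_cong)
  have \<mu>: "0 \<le> \<mu> i" if "i \<in> F" for i
    using form[of "\<lambda>_. 0" "\<lambda>k. if k = i then 1 else 0"] that F
    by (simp add: if_distrib[of "\<lambda>x. _ * x"] if_distrib[of "\<lambda>x. x ^ _"] cong: if_cong)
  define V where "V = (\<Sum>i\<in>F. la i) + (\<Sum>j\<in>F. \<mu> j) + (\<Sum>i\<in>F. \<Sum>j\<in>F. b i j * c i j)"
  have V: "V < 0"
    using w(2) unfolding sum_off_diagonal[OF F] by (simp add: p_def V_def la_def \<mu>_def b_def)
  \<comment> \<open>Weights may vanish, so \<open>d\<close> is added to all of them; \<open>V\<close> is the supposedly negative number.\<close>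
  have "0 \<le> V + 2 * real (card F) * d" if d: "0 < d" for d
  proof -
    define r where "r i = sqrt (la i + d)" for i
    define s where "s j = sqrt (\<mu> j + d)" for j
    have rs: "0 < r i" "(r i)\<^sup>2 = la i + d" "0 < s i" "(s i)\<^sup>2 = \<mu> i + d" if "i \<in> F" for i
      using la[OF that] \<mu>[OF that] d by (auto simp: r_def s_def)
    have "dominated_form F (\<lambda>i j. - b i j / (2 * r i * s j))"
      unfolding dominated_form_def
    proof (intro allI)
      fix x y :: "'i \<Rightarrow> real"
      have "(\<Sum>i\<in>F. la i * (y i / r i)\<^sup>2) \<le> (\<Sum>i\<in>F. (y i)\<^sup>2)"
      proof (rule sum_mono)
        fix i assume i: "i \<in> F"
        have "la i * (y i)\<^sup>2 \<le> (la i + d) * (y i)\<^sup>2" using d by (intro mult_right_mono) auto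
        then show "la i * (y i / r i)\<^sup>2 \<le> (y i)\<^sup>2"
          using rs(2)[OF i] la[OF i] d by (simp add: power_divide field_simps)
      qed
      moreover have "(\<Sum>i\<in>F. \<mu> i * (x i / s i)\<^sup>2) \<le> (\<Sum>i\<in>F. (x i)\<^sup>2)"
      proof (rule sum_mono)
        fix i assume i: "i \<in> F"
        have "\<mu> i * (x i)\<^sup>2 \<le> (\<mu> i + d) * (x i)\<^sup>2" using d by (intro mult_right_mono) auto
        then show "\<mu> i * (x i / s i)\<^sup>2 \<le> (x i)\<^sup>2"
          using rs(4)[OF i] \<mu>[OF i] d by (simp add: power_divide field_simps)
      qed
      moreover have "(\<Sum>i\<in>F. \<Sum>j\<in>F. - b i j / (2 * r i * s j) * x j * y i) =
          - (1/2) * (\<Sum>i\<in>F. \<Sum>j\<in>F. b i j * (y i / r i * (x j / s j)))"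
        by (simp add: sum_distrib_left mult_ac)
      moreover have "S \<le> (X + Y) / 2" if "L \<le> Y" "N \<le> X" "S = - (1/2) * B" "0 \<le> L + N + B"
        for L N B S X Y :: real
        using that by (simp add: field_simps)
      ultimately show "(\<Sum>i\<in>F. \<Sum>j\<in>F. - b i j / (2 * r i * s j) * x j * y i) \<le>
          ((\<Sum>i\<in>F. (x i)\<^sup>2) + (\<Sum>i\<in>F. (y i)\<^sup>2)) / 2"
        using form[of "\<lambda>i. y i / r i" "\<lambda>j. x j / s j"] by blast
    qed
    from contr[OF this, unfolded dominated_form_def, rule_format, of s r]
    have "(\<Sum>i\<in>F. \<Sum>j\<in>F. c i j * (- b i j / (2 * r i * s j)) * s j * r i) \<le>
        ((\<Sum>i\<in>F. (s i)\<^sup>2) + (\<Sum>i\<in>F. (r i)\<^sup>2)) / 2" .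
    moreover have "(\<Sum>i\<in>F. \<Sum>j\<in>F. c i j * (- b i j / (2 * r i * s j)) * s j * r i) =
        (\<Sum>i\<in>F. \<Sum>j\<in>F. - (1/2) * (b i j * c i j))"
      by (intro sum.cong refl) (use rs in \<open>force simp: field_simps\<close>)
    moreover have "\<dots> = - (1/2) * (\<Sum>i\<in>F. \<Sum>j\<in>F. b i j * c i j)" by (simp add: sum_distrib_left)
    ultimately show ?thesis by (simp add: V_def rs sum.distrib algebra_simps)
  qed
  \<comment> \<open>With this \<open>d\<close> the error \<open>2 |F| d\<close> compensates less than half of \<open>V\<close>.\<close>
  from this[of "- V / (4 * real (card F) + 1)"] V
  have "0 \<le> V + 2 * real (card F) * (- V / (4 * real (card F) + 1))"
    by (simp add: divide_neg_pos)
  also have "\<dots> = V * ((2 * real (card F) + 1) / (4 * real (card F) + 1))" by (simp add: field_simps)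
  also have "\<dots> < 0" using V by (intro mult_neg_pos) (auto intro!: divide_pos_pos)
  finally show False by simp
qed

lemma double_sum_mono_neutral:
  assumes "finite B" "A \<subseteq> B" and z: "\<And>i j. i \<notin> A \<or> j \<notin> A \<Longrightarrow> h i j = 0"
  shows "(\<Sum>i\<in>A. \<Sum>j\<in>A. h i j) = (\<Sum>i\<in>B. \<Sum>j\<in>B. h i j)"
proof -
  have "(\<Sum>j\<in>A. h i j) = (\<Sum>j\<in>B. h i j)" for i
    by (rule sum.mono_neutral_left) (use assms in auto)
  then have "(\<Sum>i\<in>A. \<Sum>j\<in>A. h i j) = (\<Sum>i\<in>A. \<Sum>j\<in>B. h i j)" by simp
  also have "\<dots> = (\<Sum>i\<in>B. \<Sum>j\<in>B. h i j)"
    by (rule sum.mono_neutral_left) (use assms in auto)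
  finally show ?thesis .
qed

text \<open>
  A dominated real form defines a complex operator of norm at most 1, because real and imaginary parts
  of the vectors can be treated separately.
\<close>
lemma schur_contraction_dominated_form:
  fixes c :: "'i \<Rightarrow> 'i \<Rightarrow> real"
  assumes C: "schur_contraction (\<lambda>i j. complex_of_real (c i j))" and F: "finite F" and b: "dominated_form F b"
  shows "dominated_form F (\<lambda>i j. c i j * b i j)"
proof -
  define m where "m i j = (if i \<in> F \<and> j \<in> F then complex_of_real (b i j) else 0)" for i j
  have "form_bounded m 1"
    unfolding form_bounded_def
  proof (intro allI impI)
    fix G :: "'i set" and x y :: "'i \<Rightarrow> complex" assume G: "finite G"
    define x' where "x' i = (if i \<in> G then x i else 0)" for i
    define y' where "y' i = (if i \<in> G then y i else 0)" for i
    have "(\<Sum>i\<in>G. \<Sum>j\<in>G. m i j * x j * cnj (y i)) = (\<Sum>i\<in>F. \<Sum>j\<in>F. of_real (b i j) * x' j * cnj (y' i))"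
    proof -
      have "(\<Sum>i\<in>G. \<Sum>j\<in>G. m i j * x j * cnj (y i)) = (\<Sum>i\<in>G. \<Sum>j\<in>G. m i j * x' j * cnj (y' i))"
        by (simp add: x'_def y'_def)
      also have "\<dots> = (\<Sum>i\<in>F \<union> G. \<Sum>j\<in>F \<union> G. m i j * x' j * cnj (y' i))"
        by (rule double_sum_mono_neutral) (use F G in \<open>auto simp: x'_def y'_def\<close>)
      also have "\<dots> = (\<Sum>i\<in>F. \<Sum>j\<in>F. m i j * x' j * cnj (y' i))"
        by (rule double_sum_mono_neutral[symmetric]) (use F G in \<open>auto simp: m_def\<close>)
      also have "\<dots> = (\<Sum>i\<in>F. \<Sum>j\<in>F. of_real (b i j) * x' j * cnj (y' i))"
        by (simp add: m_def)
      finally show ?thesis .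
    qed
    moreover have "Re (of_real (b i j) * x' j * cnj (y' i)) = b i j * Re (x' j) * Re (y' i) + b i j * Im (x' j) * Im (y' i)" for i j
      by (simp add: algebra_simps)
    ultimately have "Re (\<Sum>i\<in>G. \<Sum>j\<in>G. m i j * x j * cnj (y i)) =
        (\<Sum>i\<in>F. \<Sum>j\<in>F. b i j * Re (x' j) * Re (y' i)) + (\<Sum>i\<in>F. \<Sum>j\<in>F. b i j * Im (x' j) * Im (y' i))"
      by (simp only: Re_sum sum.distrib)
    also have "\<dots> \<le> ((\<Sum>i\<in>F. (Re (x' i))\<^sup>2) + (\<Sum>i\<in>F. (Re (y' i))\<^sup>2)) / 2 +
        ((\<Sum>i\<in>F. (Im (x' i))\<^sup>2) + (\<Sum>i\<in>F. (Im (y' i))\<^sup>2)) / 2"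
      by (intro add_mono b[unfolded dominated_form_def, rule_format])
    also have "\<dots> = ((\<Sum>i\<in>F. (norm (x' i))\<^sup>2) + (\<Sum>i\<in>F. (norm (y' i))\<^sup>2)) / 2"
      unfolding cmod_power2 sum.distrib by (simp add: add_divide_distrib)
    also have "\<dots> \<le> ((\<Sum>i\<in>G. (norm (x i))\<^sup>2) + (\<Sum>i\<in>G. (norm (y i))\<^sup>2)) / 2"
    proof -
      have "(\<Sum>i\<in>F. (norm (if i \<in> G then z i else 0))\<^sup>2) \<le> (\<Sum>i\<in>G. (norm (z i))\<^sup>2)" for z :: "'i \<Rightarrow> complex"
      proof -
        have "(\<Sum>i\<in>F. (norm (if i \<in> G then z i else 0))\<^sup>2) = (\<Sum>i\<in>F \<inter> G. (norm (z i))\<^sup>2)"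
          by (rule sum.mono_neutral_cong_right) (use F in auto)
        also have "\<dots> \<le> (\<Sum>i\<in>G. (norm (z i))\<^sup>2)" by (rule sum_mono2) (use G in auto)
        finally show ?thesis .
      qed
      from this[of x] this[of y] show ?thesis by (simp add: x'_def y'_def)
    qed
    finally show "Re (\<Sum>i\<in>G. \<Sum>j\<in>G. m i j * x j * cnj (y i)) \<le>
        1 / 2 * ((\<Sum>i\<in>G. (norm (x i))\<^sup>2) + (\<Sum>i\<in>G. (norm (y i))\<^sup>2))" by simp
  qed
  then obtain B where B: "B \<in> Bl2" "opmat B = m" "norm B \<le> 1" by (rule op_of_form_bounded) auto
  let ?D = "schur_mult (\<lambda>i j. complex_of_real (c i j)) B"
  have "form_bounded (opmat ?D) 1"
    by (rule form_bounded_opmat[OF schur_mult_in_Bl2[OF C B(1)] order_trans[OF norm_schur_mult_le[OF C B(1)] B(3)]])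
  note D = this[unfolded form_bounded_def, rule_format, OF F]
  show ?thesis
    unfolding dominated_form_def
  proof (intro allI)
    fix x y :: "'i \<Rightarrow> real"
    have "(\<Sum>i\<in>F. \<Sum>j\<in>F. opmat ?D i j * of_real (x j) * cnj (of_real (y i))) =
        of_real (\<Sum>i\<in>F. \<Sum>j\<in>F. c i j * b i j * x j * y i)"
      unfolding of_real_sum opmat_schur_mult[OF C B(1)] B(2)
      by (intro sum.cong refl) (simp add: m_def)
    note eq = arg_cong[OF this, of Re, unfolded Re_complex_of_real]
    have "(\<Sum>i\<in>F. \<Sum>j\<in>F. c i j * b i j * x j * y i) \<le>
        1 / 2 * ((\<Sum>i\<in>F. (norm (complex_of_real (x i)))\<^sup>2) + (\<Sum>i\<in>F. (norm (complex_of_real (y i)))\<^sup>2))"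
      using D[of "\<lambda>i. of_real (x i)" "\<lambda>i. of_real (y i)"] unfolding eq .
    then show "(\<Sum>i\<in>F. \<Sum>j\<in>F. c i j * b i j * x j * y i) \<le> ((\<Sum>i\<in>F. (x i)\<^sup>2) + (\<Sum>i\<in>F. (y i)\<^sup>2)) / 2"
      by simp
  qed
qed

section \<open>From multipliers to squared distances\<close>

text \<open>
  Closed for the topology of pointwise convergence, since only finitely many values of the kernel
  enter each condition.
\<close>
lemma closed_Collect_psd: "closed {G :: 'x \<times> 'x \<Rightarrow> real. psd (curry G)}"
proof -
  have c: "continuous_on UNIV (\<lambda>G :: 'x \<times> 'x \<Rightarrow> real. G p)" for p
    by (rule continuous_on_product_coordinates)
  have "{G :: 'x \<times> 'x \<Rightarrow> real. psd (curry G)} =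
      (\<Inter>x. \<Inter>y. {G. G (x, y) = G (y, x)}) \<inter>
      (\<Inter>F\<in>{F. finite F}. \<Inter>c. {G. 0 \<le> (\<Sum>x\<in>F. \<Sum>y\<in>F. c x * c y * G (x, y))})"
    by (auto simp: psd_def)
  also have "closed \<dots>"
    by (intro closed_Int closed_INT ballI closed_Collect_eq closed_Collect_le continuous_intros c)
  finally show ?thesis .
qed

lemma compact_box: "compact {G :: 'x \<Rightarrow> real. \<forall>p. \<bar>G p\<bar> \<le> b p}"
proof -
  have "compactin (product_topology (\<lambda>_. euclideanreal) UNIV) (PiE UNIV (\<lambda>p. {- b p..b p}))"
    by (subst compactin_PiE) auto
  then have "compact (PiE UNIV (\<lambda>p. {- b p..b p}))"
    by (simp add: euclidean_product_topology)
  moreover have "PiE UNIV (\<lambda>p. {- b p..b p}) = {G. \<forall>p. \<bar>G p\<bar> \<le> b p}"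
    by (auto simp: PiE_UNIV_domain abs_le_iff minus_le_iff)
  ultimately show ?thesis by simp
qed

lemma abs_inner_le_of_square_bounds:
  assumes "(norm x)\<^sup>2 \<le> a" "(norm y)\<^sup>2 \<le> b"
  shows "\<bar>inner x y\<bar> \<le> (a + b) / 2"
proof -
  have "\<bar>inner x y\<bar> \<le> norm x * norm y" by (rule Cauchy_Schwarz_ineq2)
  also have "\<dots> \<le> ((norm x)\<^sup>2 + (norm y)\<^sup>2) / 2" using sum_squares_bound[of "norm x" "norm y"] by simp
  also have "\<dots> \<le> (a + b) / 2" using assms by simp
  finally show ?thesis .
qed

lemma norm_diff_square_triangle:
  fixes x y z :: "'a::real_inner"
  shows "(norm (x - z))\<^sup>2 \<le> 2 * (norm (x - y))\<^sup>2 + 2 * (norm (y - z))\<^sup>2"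
proof -
  have "(norm (x - z))\<^sup>2 \<le> (norm (x - y) + norm (y - z))\<^sup>2"
    using norm_triangle_ineq[of "x - y" "y - z"] by (intro power_mono) auto
  also have "\<dots> \<le> 2 * (norm (x - y))\<^sup>2 + 2 * (norm (y - z))\<^sup>2"
    using sum_squares_bound[of "norm (x - y)" "norm (y - z)"] by (simp add: power2_sum)
  finally show ?thesis .
qed

text \<open>
  For a finite set and a small \<open>t\<close>, take Gram vectors \<open>z\<close> of the approximate dilation of
  \<open>exp (- t a\<^sub>i\<^sub>j)\<close>, and let \<open>g\<close> be the vectors \<open>(z k - z i\<^sub>0) / \<surd>(2 t)\<close>, based at a fixed index \<open>i\<^sub>0\<close> of the first
  copy of the index set.  Then \<open>\<parallel>g\<^sub>i - g\<^sub>j\<parallel>\<^sup>2\<close> is close to \<open>a\<^sub>i\<^sub>j\<close> across the two copies.  The Gram kernels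
  of \<open>g\<close> stay in a fixed compact box: a point of the second copy is directly compared with \<open>i\<^sub>0\<close>, a
  point of the first copy via the point \<open>i\<^sub>0\<close> of the second.  The closed sets of kernels that satisfy the
  requirements for one finite set and one tolerance therefore have a common point.
\<close>
lemma limit_kernel:
  fixes a :: "'i \<Rightarrow> 'i \<Rightarrow> real"
  assumes a: "\<And>i j. 0 \<le> a i j"
    and dil: "\<And>t F e. 0 < t \<Longrightarrow> finite F \<Longrightarrow> 0 < e \<Longrightarrow> \<exists>M. psd M \<and> (\<forall>k\<in>F <+> F. \<bar>M k k - 1\<bar> \<le> e) \<and>
      (\<forall>i\<in>F. \<forall>j\<in>F. \<bar>M (Inl i) (Inr j) - exp (- t * a i j)\<bar> \<le> e)"
  obtains G :: "'i + 'i \<Rightarrow> 'i + 'i \<Rightarrow> real" where "psd G"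
    "\<And>i j. G (Inl i) (Inl i) + G (Inr j) (Inr j) - 2 * G (Inl i) (Inr j) = a i j"
proof -
  define i0 :: 'i where "i0 = undefined"
  define \<beta> :: "'i + 'i \<Rightarrow> real" where
    "\<beta> k = (case k of Inl i \<Rightarrow> 2 * (a i i0 + 1) + 2 * (a i0 i0 + 1) | Inr j \<Rightarrow> a i0 j + 1)" for k
  define D :: "(('i + 'i) \<times> ('i + 'i) \<Rightarrow> real) \<Rightarrow> 'i \<Rightarrow> 'i \<Rightarrow> real" where
    "D G i j = G (Inl i, Inl i) + G (Inr j, Inr j) - 2 * G (Inl i, Inr j)" for G i j
  define box where "box = {G. \<forall>p. \<bar>G p\<bar> \<le> (\<beta> (fst p) + \<beta> (snd p)) / 2}"
  define \<K> where "\<K> F e = {G. psd (curry G)} \<inter> (\<Inter>i\<in>F. \<Inter>j\<in>F. {G. \<bar>D G i j - a i j\<bar> \<le> e})" for F e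
  have nonempty: "box \<inter> \<K> F e \<noteq> {}" if F: "finite F" "i0 \<in> F" and e: "0 < e" "e \<le> 1" for F e
  proof -
    have lim: "((\<lambda>t. (1 - exp (- t * r)) / t) \<longlongrightarrow> r) (at_right 0)" for r :: real
    proof -
      have "((\<lambda>t. 1 - exp (- t * r)) has_real_derivative r) (at 0 within {0<..})"
        by (auto intro!: derivative_eq_intros)
      then show ?thesis by (simp add: has_field_derivative_iff)
    qed
    have "\<forall>\<^sub>F t in at_right 0. dist ((1 - exp (- t * a i j)) / t) (a i j) < e / 2" for i j
      by (rule tendstoD[OF lim]) (use e in simp)
    then have "\<forall>\<^sub>F t in at_right 0. \<forall>i\<in>F. \<forall>j\<in>F. dist ((1 - exp (- t * a i j)) / t) (a i j) < e / 2"
      by (intro eventually_ball_finite F ballI)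
    moreover have "\<forall>\<^sub>F t in at_right (0::real). 0 < t" by (rule eventually_at_right_less)
    ultimately have "\<forall>\<^sub>F t in at_right 0. 0 < t \<and> (\<forall>i\<in>F. \<forall>j\<in>F. dist ((1 - exp (- t * a i j)) / t) (a i j) < e / 2)"
      by eventually_elim simp
    from eventually_happens[OF this] obtain t where t: "0 < t"
      "\<And>i j. i \<in> F \<Longrightarrow> j \<in> F \<Longrightarrow> dist ((1 - exp (- t * a i j)) / t) (a i j) < e / 2" by auto
    \<comment> \<open>Four entries of \<open>M\<close> enter each distance, which is then divided by \<open>2 t\<close>: an error of \<open>t e / 4\<close>
      per entry results in \<open>e / 2\<close>.\<close>
    have "0 < t * e / 4" using t e by simp
    from dil[OF t(1) F(1) this] obtain M where M: "psd M" "\<forall>k\<in>F <+> F. \<bar>M k k - 1\<bar> \<le> t * e / 4"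
      "\<forall>i\<in>F. \<forall>j\<in>F. \<bar>M (Inl i) (Inr j) - exp (- t * a i j)\<bar> \<le> t * e / 4" by blast
    obtain z :: "'i + 'i \<Rightarrow> ('i + 'i, real) ell2" where z: "\<And>k l. inner (z k) (z l) = M k l"
      using psd_gram[OF M(1)] by blast
    define g where "g k = (if k \<in> F <+> F then (1 / sqrt (2 * t)) *\<^sub>R (z k - z (Inl i0)) else 0)" for k
    have near: "\<bar>(norm (g (Inl i) - g (Inr j)))\<^sup>2 - a i j\<bar> \<le> e" if ij: "i \<in> F" "j \<in> F" for i j
    proof -
      have "g (Inl i) - g (Inr j) = (1 / sqrt (2 * t)) *\<^sub>R (z (Inl i) - z (Inr j))"
        using ij by (simp add: g_def scaleR_diff_right InlI InrI)
      then have "(norm (g (Inl i) - g (Inr j)))\<^sup>2 = (1 / (2 * t)) * (norm (z (Inl i) - z (Inr j)))\<^sup>2"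
        using t by (simp add: power_divide)
      also have "(norm (z (Inl i) - z (Inr j)))\<^sup>2 = M (Inl i) (Inl i) + M (Inr j) (Inr j) - 2 * M (Inl i) (Inr j)"
        by (simp add: power2_norm_eq_inner inner_diff_left inner_diff_right inner_commute flip: z)
      finally have eq: "(norm (g (Inl i) - g (Inr j)))\<^sup>2 =
          (1 / (2 * t)) * (M (Inl i) (Inl i) + M (Inr j) (Inr j) - 2 * M (Inl i) (Inr j))" .
      let ?x = "exp (- t * a i j)"
      have in_F: "Inl i \<in> F <+> F" "Inr j \<in> F <+> F" using ij by auto
      have "\<bar>(p + q - 2 * r) - 2 * (1 - x)\<bar> \<le> 4 * d"
        if "\<bar>p - 1\<bar> \<le> d" "\<bar>q - 1\<bar> \<le> d" "\<bar>r - x\<bar> \<le> d" for p q r x d :: real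
        using that by (simp add: abs_le_iff)
      from this[OF M(2)[rule_format, OF in_F(1)] M(2)[rule_format, OF in_F(2)] M(3)[rule_format, OF ij]]
      have "\<bar>(M (Inl i) (Inl i) + M (Inr j) (Inr j) - 2 * M (Inl i) (Inr j)) - 2 * (1 - ?x)\<bar> \<le> t * e"
        by simp
      then have "\<bar>(1 / (2 * t)) * ((M (Inl i) (Inl i) + M (Inr j) (Inr j) - 2 * M (Inl i) (Inr j)) - 2 * (1 - ?x))\<bar>
          \<le> (1 / (2 * t)) * (t * e)"
        using t(1) unfolding abs_mult by (intro mult_mono) auto
      also have "(1 / (2 * t)) * (t * e) = e / 2" using t(1) by simp
      also have "(1 / (2 * t)) * ((M (Inl i) (Inl i) + M (Inr j) (Inr j) - 2 * M (Inl i) (Inr j)) - 2 * (1 - ?x)) =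
          (norm (g (Inl i) - g (Inr j)))\<^sup>2 - (1 - ?x) / t"
        unfolding eq using t(1) by (simp add: field_simps)
      finally show ?thesis using t(2)[OF ij] unfolding dist_real_def by linarith
    qed
    have g0: "g (Inl i0) = 0" by (simp add: g_def)
    have gb: "(norm (g k))\<^sup>2 \<le> \<beta> k" for k
    proof (cases "k \<in> F <+> F")
      case False
      then show ?thesis using a by (auto simp: g_def \<beta>_def add_nonneg_nonneg split: sum.split)
    next
      case True
      then show ?thesis
      proof
        fix j assume j: "j \<in> F" "k = Inr j"
        show ?thesis using near[OF F(2) j(1)] e by (simp add: g0 j \<beta>_def)
      next
        fix i assume i: "i \<in> F" "k = Inl i"
        have "(norm (g (Inl i)))\<^sup>2 \<le> 2 * (norm (g (Inl i) - g (Inr i0)))\<^sup>2 + 2 * (norm (g (Inr i0) - g (Inl i0)))\<^sup>2"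
          using norm_diff_square_triangle[of "g (Inl i)" "g (Inl i0)" "g (Inr i0)"] by (simp add: g0)
        then show ?thesis
          using near[OF i(1) F(2)] near[OF F(2) F(2)] e by (simp add: norm_minus_commute i \<beta>_def)
      qed
    qed
    define G where "G = (\<lambda>(k, l). inner (g k) (g l))"
    have "G \<in> box"
      using abs_inner_le_of_square_bounds[OF gb gb] by (auto simp: box_def G_def)
    moreover have "G \<in> \<K> F e"
    proof -
      have "D G i j = (norm (g (Inl i) - g (Inr j)))\<^sup>2" for i j
        by (simp add: D_def G_def power2_norm_eq_inner inner_diff_left inner_diff_right inner_commute)
      then show ?thesis using near psd_inner[of g] by (auto simp: \<K>_def G_def curry_def)
    qed
    ultimately show ?thesis by blast
  qed
  have "box \<inter> \<Inter> {\<K> F e | F e. finite F \<and> 0 < e} \<noteq> {}"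
  proof (rule compact_imp_fip)
    show "compact box" unfolding box_def by (rule compact_box)
    have c: "continuous_on UNIV (\<lambda>G :: ('i + 'i) \<times> ('i + 'i) \<Rightarrow> real. G p)" for p
      by (rule continuous_on_product_coordinates)
    show "closed T" if TK: "T \<in> {\<K> F e | F e. finite F \<and> 0 < e}" for T
    proof -
      obtain F e where T: "T = \<K> F e" using TK by blast
      show ?thesis
        unfolding T \<K>_def D_def
        by (intro closed_Int closed_INT ballI closed_Collect_psd closed_Collect_le continuous_intros c)
    qed
    fix \<F> assume fin: "finite \<F>" and sub: "\<F> \<subseteq> {\<K> F e | F e. finite F \<and> 0 < e}"
    then have "\<forall>T\<in>\<F>. \<exists>F e. T = \<K> F e \<and> finite F \<and> 0 < e" by blast
    then obtain fF fe where f: "\<And>T. T \<in> \<F> \<Longrightarrow> T = \<K> (fF T) (fe T) \<and> finite (fF T) \<and> 0 < fe T" by metis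
    define F where "F = insert i0 (\<Union>T\<in>\<F>. fF T)"
    define e where "e = Min (insert 1 (fe ` \<F>))"
    have "box \<inter> \<K> F e \<noteq> {}"
      by (rule nonempty) (use fin f in \<open>auto simp: F_def e_def\<close>)
    moreover have "\<K> F e \<subseteq> T" if T: "T \<in> \<F>" for T
    proof -
      have "fF T \<subseteq> F" "e \<le> fe T" using T fin by (auto simp: F_def e_def)
      then have "\<K> F e \<subseteq> \<K> (fF T) (fe T)"
        unfolding \<K>_def by (intro Int_mono order_refl INT_anti_mono Collect_mono impI) auto
      then show ?thesis using f[OF T] by simp
    qed
    ultimately show "box \<inter> \<Inter> \<F> \<noteq> {}" by blast
  qed
  then obtain G where G: "\<And>F e. finite F \<Longrightarrow> 0 < e \<Longrightarrow> G \<in> \<K> F e" by blast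
  show ?thesis
  proof
    show "psd (curry G)" using G[of "{}" 1] by (simp add: \<K>_def)
    fix i j
    have "\<bar>D G i j - a i j\<bar> \<le> e" if "0 < e" for e
      using G[of "{i, j}" e] that by (simp add: \<K>_def)
    then have "D G i j = a i j" using field_le_epsilon[of "\<bar>D G i j - a i j\<bar>" 0] by simp
    then show "curry G (Inl i) (Inl i) + curry G (Inr j) (Inr j) - 2 * curry G (Inl i) (Inr j) = a i j"
      by (simp add: D_def)
  qed
qed

theorem squared_distances_of_schur_contractions:
  fixes a :: "'i \<Rightarrow> 'i \<Rightarrow> real"
  assumes a: "\<And>i j. 0 \<le> a i j"
    and contr: "\<And>t. 0 < t \<Longrightarrow> schur_contraction (\<lambda>i j. complex_of_real (exp (- t * a i j)))"
  obtains \<alpha> \<beta> :: "'i \<Rightarrow> ('i + 'i, real) ell2" where "\<And>i j. a i j = (norm (\<alpha> i - \<beta> j))\<^sup>2"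
proof -
  have dil: "\<exists>M. psd M \<and> (\<forall>k\<in>F <+> F. \<bar>M k k - 1\<bar> \<le> e) \<and>
      (\<forall>i\<in>F. \<forall>j\<in>F. \<bar>M (Inl i) (Inr j) - exp (- t * a i j)\<bar> \<le> e)"
    if t: "0 < t" and F: "finite F" and e: "0 < e" for t F e
  proof -
    show ?thesis
    proof (rule psd_dilation_approx[OF F e schur_contraction_dominated_form[OF contr[OF t] F]])
      fix M assume "psd M" "\<And>k. k \<in> F <+> F \<Longrightarrow> \<bar>M k k - 1\<bar> \<le> e"
        "\<And>i j. i \<in> F \<Longrightarrow> j \<in> F \<Longrightarrow> \<bar>M (Inl i) (Inr j) - exp (- t * a i j)\<bar> \<le> e"
      then show ?thesis by blast
    qed
  qed
  obtain G :: "'i + 'i \<Rightarrow> 'i + 'i \<Rightarrow> real" where G: "psd G"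
    "\<And>i j. G (Inl i) (Inl i) + G (Inr j) (Inr j) - 2 * G (Inl i) (Inr j) = a i j"
    using limit_kernel[OF a dil] by blast
  obtain z :: "'i + 'i \<Rightarrow> ('i + 'i, real) ell2" where z: "\<And>k l. inner (z k) (z l) = G k l"
    using psd_gram[OF G(1)] by blast
  show ?thesis
  proof
    fix i j
    have "(norm (z (Inl i) - z (Inr j)))\<^sup>2 = G (Inl i) (Inl i) + G (Inr j) (Inr j) - 2 * G (Inl i) (Inr j)"
      by (simp add: power2_norm_eq_inner inner_diff_left inner_diff_right inner_commute flip: z)
    then show "a i j = (norm (z (Inl i) - z (Inr j)))\<^sup>2" by (simp add: G(2))
  qed
qed

section \<open>The characterization of the semigroups\<close>

lemma exp_matrix_gaussian:
  assumes "\<And>i j. A i j = complex_of_real ((norm (\<alpha> i - \<beta> j))\<^sup>2)"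
  shows "exp_matrix A t i j = of_real (exp (- t * (norm (\<alpha> i - \<beta> j))\<^sup>2))"
  unfolding exp_matrix_def assms by (simp add: exp_of_real[symmetric] del: of_real_power)

lemma semigroup_of_squared_distances:
  fixes \<alpha> \<beta> :: "'i \<Rightarrow> 'h::real_inner"
  assumes A: "\<And>i j. A i j = complex_of_real ((norm (\<alpha> i - \<beta> j))\<^sup>2)"
  shows "\<exists>S. extends_exp_schur A S \<and> selfadjoint_schur_semigroup S"
proof (intro exI conjI)
  let ?S = "\<lambda>t. schur_mult (exp_matrix A t)"
  show "extends_exp_schur A ?S" by (simp add: extends_exp_schur_def)
  have cont: "schur_contraction (exp_matrix A t) \<and> continuous_map weak_star weak_star (?S t)" if t: "0 \<le> t" for t
  proof -
    obtain u v :: "'i \<Rightarrow> ('i + 'i, real) ell2" where uv: "\<And>i. norm (u i) = 1" "\<And>j. norm (v j) = 1"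
      "\<And>i j. exp (- t * (norm (\<alpha> i - \<beta> j))\<^sup>2) = inner (u i) (v j)"
      using gaussian_factorization[OF t, of \<alpha> \<beta>] by metis
    have "exp_matrix A t = (\<lambda>i j. of_real (inner (u i) (v j)))"
      by (intro ext) (simp only: exp_matrix_gaussian[OF A] uv(3))
    then show ?thesis
      using schur_contraction_factorization[of u v, OF uv(1,2)] continuous_map_schur_mult[of u v, OF uv(1,2)] by simp
  qed
  have real: "cnj (exp_matrix A t i j) = exp_matrix A t i j" for t i j
    by (simp only: exp_matrix_gaussian[OF A] complex_cnj_complex_of_real)
  show "selfadjoint_schur_semigroup ?S"
    unfolding selfadjoint_schur_semigroup_def
  proof (intro conjI allI impI ballI)
    fix t :: real assume t: "0 \<le> t"
    note C = conjunct1[OF cont[OF t]]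
    have cm: "contractive_map (?S t)" by (simp add: contractive_map_def norm_schur_mult_le[OF C])
    then show "contractive_schur (?S t)"
      unfolding contractive_schur_def using schur_dom_eq_Bl2[OF C] by blast
    show "selfadjoint_map (?S t)"
      unfolding selfadjoint_map_def
      using cm cont[OF t] Tr_schur_mult_adj[OF C real] trace_class_in_Bl2 by blast
  next
    fix B :: "'i oper" assume "B \<in> Bl2"
    then show "?S 0 B = B" by (rule schur_mult_eqI) (simp add: exp_matrix_def)
  next
    fix s t :: real and B :: "'i oper" assume st: "0 \<le> s" "0 \<le> t" and B: "B \<in> Bl2"
    note Cs = conjunct1[OF cont[OF st(1)]] and Ct = conjunct1[OF cont[OF st(2)]]
    note Bt = schur_mult_in_Bl2[OF Ct B]
    show "?S (s + t) B = ?S s (?S t B)"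
    proof (rule schur_mult_eqI[OF schur_mult_in_Bl2[OF Cs Bt]], intro ext)
      fix i j
      have "exp_matrix A (s + t) i j = exp_matrix A s i j * exp_matrix A t i j"
        by (simp add: exp_matrix_def exp_add[symmetric] algebra_simps)
      then show "opmat (?S s (?S t B)) i j = exp_matrix A (s + t) i j * opmat B i j"
        by (simp add: opmat_schur_mult[OF Cs Bt] opmat_schur_mult[OF Ct B])
    qed
  qed
qed

lemma matrix_unit_exists:
  obtains E :: "'i oper" where "E \<in> Bl2" "opmat E = (\<lambda>k l. if k = i \<and> l = j then c else 0)" "norm E \<le> norm c"
proof -
  have "form_bounded (\<lambda>k l. if k = i \<and> l = j then c else 0) (norm c)"
    unfolding form_bounded_def
  proof (intro allI impI)
    fix F :: "'i set" and x y :: "'i \<Rightarrow> complex" assume F: "finite F"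
    have le: "(norm (z k))\<^sup>2 \<le> (\<Sum>k\<in>F. (norm (z k))\<^sup>2)" if "k \<in> F" for z :: "'i \<Rightarrow> complex" and k
      by (rule member_le_sum) (use that F in auto)
    have inner: "(\<Sum>l\<in>F. (if k = i \<and> l = j then c else 0) * x l * cnj (y k)) =
        (if k = i \<and> j \<in> F then c * x j * cnj (y k) else 0)" for k
    proof -
      have "(\<Sum>l\<in>F. (if k = i \<and> l = j then c else 0) * x l * cnj (y k)) =
          (\<Sum>l\<in>F. if l = j then (if k = i then c * x l * cnj (y k) else 0) else 0)"
        by (intro sum.cong) auto
      then show ?thesis using F by simp
    qed
    have "(\<Sum>k\<in>F. \<Sum>l\<in>F. (if k = i \<and> l = j then c else 0) * x l * cnj (y k)) =
        (if i \<in> F \<and> j \<in> F then c * x j * cnj (y i) else 0)"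
      unfolding inner
    proof -
      have "(\<Sum>k\<in>F. if k = i \<and> j \<in> F then c * x j * cnj (y k) else 0) =
          (\<Sum>k\<in>F. if k = i then (if j \<in> F then c * x j * cnj (y k) else 0) else 0)"
        by (intro sum.cong) auto
      then show "(\<Sum>k\<in>F. if k = i \<and> j \<in> F then c * x j * cnj (y k) else 0) =
          (if i \<in> F \<and> j \<in> F then c * x j * cnj (y i) else 0)" using F by simp
    qed
    moreover have "Re (if i \<in> F \<and> j \<in> F then c * x j * cnj (y i) else 0) \<le>
        norm c / 2 * ((\<Sum>i\<in>F. (norm (x i))\<^sup>2) + (\<Sum>i\<in>F. (norm (y i))\<^sup>2))"
    proof (cases "i \<in> F \<and> j \<in> F")
      case True
      have "Re (c * x j * cnj (y i)) \<le> norm (c * x j * cnj (y i))" by (rule complex_Re_le_cmod)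
      also have "\<dots> = norm c * (norm (x j) * norm (y i))" by (simp add: norm_mult)
      also have "\<dots> \<le> norm c * (((norm (x j))\<^sup>2 + (norm (y i))\<^sup>2) / 2)"
        using sum_squares_bound[of "norm (x j)" "norm (y i)"] by (intro mult_left_mono) auto
      also have "\<dots> \<le> norm c * (((\<Sum>i\<in>F. (norm (x i))\<^sup>2) + (\<Sum>i\<in>F. (norm (y i))\<^sup>2)) / 2)"
        using le[of j x] le[of i y] True by (intro mult_left_mono) auto
      finally show ?thesis using True by simp
    qed (auto intro!: mult_nonneg_nonneg add_nonneg_nonneg sum_nonneg)
    ultimately show "Re (\<Sum>k\<in>F. \<Sum>l\<in>F. (if k = i \<and> l = j then c else 0) * x l * cnj (y k)) \<le>
        norm c / 2 * ((\<Sum>i\<in>F. (norm (x i))\<^sup>2) + (\<Sum>i\<in>F. (norm (y i))\<^sup>2))" by simp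
  qed
  then show ?thesis by (rule op_of_form_bounded) (use that in auto)
qed

lemma infsum_single:
  assumes "\<And>k. k \<noteq> n \<Longrightarrow> f k = 0"
  shows "(\<Sum>\<^sub>\<infinity>k. f k) = f n"
proof -
  have "(\<Sum>\<^sub>\<infinity>k. f k) = (\<Sum>\<^sub>\<infinity>k\<in>{n}. f k)" by (rule infsum_cong_neutral) (use assms in auto)
  then show ?thesis by simp
qed

text \<open>
  The absolute value of the matrix unit at \<open>(i, j)\<close> is the one at \<open>(j, j)\<close>.
\<close>
lemma matrix_unit_trace_class:
  fixes E :: "'i oper"
  assumes E: "E \<in> Bl2" "opmat E = (\<lambda>k l. if k = i \<and> l = j then 1 else 0)"
  shows "E \<in> trace_class"
proof -
  define G :: "('i \<times> 'i, complex) ell2" where "G = tensor (unit_vec j) (unit_vec j)"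
  obtain P where P: "P \<in> trace_class" "pos_op P" "\<And>k l. opmat P k l = cinner (row_vec G k) (row_vec G l)"
    using positive_of_gram[of G] by blast
  have Pm: "opmat P k l = (if k = j \<and> l = j then 1 else 0)" for k l
    by (simp add: P(3) G_def)
  note PB = trace_class_in_Bl2[OF P(1)]
  have "P o\<^sub>L P = adj E o\<^sub>L E"
  proof (rule Bl2_eqI[OF Bl2_compose[OF PB PB] Bl2_compose[OF adj_in_Bl2[OF E(1)] E(1)]], intro ext)
    fix k l
    have "opmat (P o\<^sub>L P) k l = opmat P k j * opmat P j l"
      unfolding opmat_compose[OF PB] by (rule infsum_single) (simp add: Pm)
    moreover have "opmat (adj E o\<^sub>L E) k l = opmat (adj E) k i * opmat E i l"
      unfolding opmat_compose[OF adj_in_Bl2[OF E(1)]] by (rule infsum_single) (simp add: E(2))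
    ultimately show "opmat (P o\<^sub>L P) k l = opmat (adj E o\<^sub>L E) k l"
      by (simp add: Pm opmat_adj[OF E(1)] E(2))
  qed
  then have "is_abs_op P E" using P(2) by (simp add: is_abs_op_def)
  moreover have "(\<lambda>k. Re (opmat P k k)) summable_on UNIV"
    by (rule finite_nonzero_values_imp_summable_on) (auto simp: Pm intro: finite_subset[of _ "{j}"])
  ultimately show ?thesis using E(1) by (auto simp: trace_class_def)
qed

text \<open>
  Matrix units lie in the domain of every unbounded Schur multiplier, so the matrix of the extension
  is determined entry by entry.
\<close>
lemma semigroup_schur_mult:
  assumes extn: "extends_exp_schur A S" and S: "selfadjoint_schur_semigroup S" and t: "0 \<le> t"
  shows "schur_contraction (exp_matrix A t)" and "\<And>B. B \<in> Bl2 \<Longrightarrow> S t B = schur_mult (exp_matrix A t) B"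
proof -
  obtain C where C: "schur_dom C = Bl2" "\<And>B. B \<in> Bl2 \<Longrightarrow> S t B = schur_mult C B" "contractive_map (S t)"
    using S t by (auto simp: selfadjoint_schur_semigroup_def contractive_schur_def)
  have contr: "schur_contraction C"
    unfolding schur_contraction_def
  proof
    fix B :: "'a oper" assume B: "B \<in> Bl2"
    then obtain D where D: "D \<in> Bl2" "opmat D = (\<lambda>i j. C i j * opmat B i j)"
      using C(1) by (auto simp: schur_dom_def)
    have "S t B = D" using C(2)[OF B] schur_mult_eqI[OF D] by simp
    then have "norm D \<le> norm B" using C(3) B by (auto simp: contractive_map_def)
    then show "\<exists>D\<in>Bl2. opmat D = (\<lambda>i j. C i j * opmat B i j) \<and> norm D \<le> norm B" using D by blast
  qed
  have "C i j = exp_matrix A t i j" for i j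
  proof -
    obtain E :: "'a oper" where E: "E \<in> Bl2" "opmat E = (\<lambda>k l. if k = i \<and> l = j then 1 else 0)"
      "norm E \<le> norm (1 :: complex)" by (rule matrix_unit_exists)
    obtain D :: "'a oper" where D: "D \<in> Bl2" "opmat D = (\<lambda>k l. if k = i \<and> l = j then exp_matrix A t i j else 0)"
      "norm D \<le> norm (exp_matrix A t i j)" by (rule matrix_unit_exists)
    have DE: "opmat D = (\<lambda>k l. exp_matrix A t k l * opmat E k l)"
      by (intro ext) (simp add: D E)
    then have "E \<in> schur_dom (exp_matrix A t)" using D(1) E(1) by (auto simp: schur_dom_def)
    then have "schur_mult C E = D"
      using extn t C(2)[OF E(1)] schur_mult_eqI[OF D(1) DE] by (auto simp: extends_exp_schur_def)
    then show ?thesis using opmat_schur_mult[OF contr E(1), of i j] by (simp add: D E)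
  qed
  then have "C = exp_matrix A t" by (intro ext)
  then show "schur_contraction (exp_matrix A t)" "\<And>B. B \<in> Bl2 \<Longrightarrow> S t B = schur_mult (exp_matrix A t) B"
    using contr C(2) by auto
qed

text \<open>
  Selfadjointness, tested on a matrix unit, says that \<open>exp (- t a\<^sub>i\<^sub>j)\<close> is real for all \<open>t \<ge> 0\<close>, and
  contractivity that it has modulus at most 1.
\<close>
lemma semigroup_matrix_real_nonneg:
  assumes extn: "extends_exp_schur A S" and S: "selfadjoint_schur_semigroup S"
  shows "A i j \<in> \<real>\<^sub>\<ge>\<^sub>0"
proof -
  obtain E :: "'a oper" where E: "E \<in> Bl2" "opmat E = (\<lambda>k l. if k = i \<and> l = j then 1 else 0)"
    "norm E \<le> norm (1 :: complex)" by (rule matrix_unit_exists)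
  have Tr2: "Tr (X o\<^sub>L adj Y) = opmat X i j * cnj (opmat Y i j)"
    if X: "X \<in> Bl2" "\<And>k l. \<not> (k = i \<and> l = j) \<Longrightarrow> opmat X k l = 0" and Y: "Y \<in> Bl2" for X Y :: "'a oper"
  proof -
    have "opmat (X o\<^sub>L adj Y) k k = opmat X k j * cnj (opmat Y k j)" for k
      unfolding opmat_compose[OF X(1)] opmat_adj[OF Y] by (rule infsum_single) (simp add: X)
    then show ?thesis unfolding Tr_def by simp (rule infsum_single, simp add: X)
  qed
  have facts: "exp_matrix A t i j \<in> \<real>" "norm (exp_matrix A t i j) \<le> 1" if t: "0 \<le> t" for t
  proof -
    note C = semigroup_schur_mult(1)[OF extn S t]
    note St = semigroup_schur_mult(2)[OF extn S t E(1)]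
    have SE: "S t E \<in> Bl2" "opmat (S t E) k l = exp_matrix A t k l * opmat E k l" for k l
      using schur_mult_in_Bl2[OF C E(1)] opmat_schur_mult[OF C E(1)] by (simp_all add: St)
    have "Tr (S t E o\<^sub>L adj E) = Tr (E o\<^sub>L adj (S t E))"
      using S t matrix_unit_trace_class[OF E(1,2)] by (auto simp: selfadjoint_schur_semigroup_def selfadjoint_map_def)
    moreover have "Tr (S t E o\<^sub>L adj E) = exp_matrix A t i j"
      by (subst Tr2) (auto simp: SE E)
    moreover have "Tr (E o\<^sub>L adj (S t E)) = cnj (exp_matrix A t i j)"
      by (subst Tr2) (auto simp: SE E)
    ultimately show "exp_matrix A t i j \<in> \<real>" by (simp add: complex_is_Real_iff complex_eq_iff)
    have "norm E \<le> 1" using E(3) by simp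
    then have "norm (S t E) \<le> 1" using norm_schur_mult_le[OF C E(1)] by (simp add: St)
    have "norm (exp_matrix A t i j) = norm (coord (blinfun_apply (S t E) (unit_vec j)) i)"
      using SE(2)[of i j] by (simp add: E opmat_eq_coord)
    also have "\<dots> \<le> norm (blinfun_apply (S t E) (unit_vec j))" by (rule norm_coord_le)
    also have "\<dots> \<le> norm (S t E)" using norm_blinfun[of "S t E" "unit_vec j"] by simp
    finally show "norm (exp_matrix A t i j) \<le> 1" using \<open>norm (S t E) \<le> 1\<close> by simp
  qed
  have "Re (A i j) \<ge> 0" using facts(2)[of 1] by (simp add: exp_matrix_def)
  moreover have "Im (A i j) = 0"
  proof (rule ccontr)
    assume im: "Im (A i j) \<noteq> 0"
    \<comment> \<open>At this time the imaginary part of \<open>t a\<^sub>i\<^sub>j\<close> is \<open>\<plusminus> pi / 2\<close>, where the sine does not vanish.\<close>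
    define t where "t = pi / (2 * \<bar>Im (A i j)\<bar>)"
    have "sin (t * Im (A i j)) = 0"
      using facts(1)[of t] by (simp add: exp_matrix_def complex_is_Real_iff Im_exp t_def)
    moreover have "t * Im (A i j) = pi / 2 \<or> t * Im (A i j) = - (pi / 2)"
      using im by (cases "Im (A i j) > 0") (auto simp: t_def field_simps)
    ultimately show False by (metis one_neq_zero neg_equal_0_iff_equal sin_minus sin_pi_half)
  qed
  ultimately show ?thesis by (simp add: complex_nonneg_Reals_iff)
qed

lemma squared_distances_of_semigroup:
  fixes A :: "'i \<Rightarrow> 'i \<Rightarrow> complex"
  assumes extn: "extends_exp_schur A S" and S: "selfadjoint_schur_semigroup S"
  obtains \<alpha> \<beta> :: "'i \<Rightarrow> ('i + 'i, real) ell2" where "\<And>i j. A i j = complex_of_real ((norm (\<alpha> i - \<beta> j))\<^sup>2)"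
proof -
  have A: "A i j = of_real (Re (A i j))" "0 \<le> Re (A i j)" for i j
    using semigroup_matrix_real_nonneg[OF extn S, of i j] by (auto simp: complex_nonneg_Reals_iff complex_eq_iff)
  have E: "exp_matrix A t = (\<lambda>i j. complex_of_real (exp (- t * Re (A i j))))" for t
  proof (rule ext, rule ext)
    fix i j
    have "exp_matrix A t i j = exp (- (of_real t * of_real (Re (A i j))))"
      unfolding exp_matrix_def using A(1)[of i j] by simp
    then show "exp_matrix A t i j = complex_of_real (exp (- t * Re (A i j)))"
      by (simp add: exp_of_real[symmetric])
  qed
  have contr: "schur_contraction (\<lambda>i j. complex_of_real (exp (- t * Re (A i j))))" if "0 < t" for t
    using semigroup_schur_mult(1)[OF extn S, of t] that by (simp add: E)
  obtain \<alpha> \<beta> :: "'i \<Rightarrow> ('i + 'i, real) ell2" where ab: "\<And>i j. Re (A i j) = (norm (\<alpha> i - \<beta> j))\<^sup>2"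
    using squared_distances_of_schur_contractions[OF A(2) contr] by blast
  have "A i j = complex_of_real ((norm (\<alpha> i - \<beta> j))\<^sup>2)" for i j
    using A(1)[of i j] unfolding ab .
  then show ?thesis by (rule that)
qed

lemma semigroup_weak_star_continuous:
  assumes extn: "extends_exp_schur A S" and S: "selfadjoint_schur_semigroup S"
  shows "wstar_continuous S"
  unfolding wstar_continuous_def
proof
  fix x :: "'a oper" assume x: "x \<in> Bl2"
  note C = semigroup_schur_mult(1)[OF extn S] and St = semigroup_schur_mult(2)[OF extn S _ x]
  show "continuous_map (top_of_set {0..}) weak_star (\<lambda>t. S t x)"
  proof (rule weak_star_continuous_of_entries)
    fix t :: real assume "t \<in> {0..}"
    then show "S t x \<in> Bl2" "norm (S t x) \<le> norm x"
      using schur_mult_in_Bl2[OF C x] norm_schur_mult_le[OF C x] by (simp_all add: St)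
  next
    fix i j
    have "continuous_on {0..} (\<lambda>t. exp (- (complex_of_real t * A i j)) * opmat x i j)"
      by (intro continuous_intros)
    then show "continuous_on {0..} (\<lambda>t. opmat (S t x) i j)"
    proof (rule continuous_on_eq)
      fix t :: real assume "t \<in> {0..}"
      then have t: "0 \<le> t" by simp
      show "exp (- (complex_of_real t * A i j)) * opmat x i j = opmat (S t x) i j"
        unfolding St[OF t] opmat_schur_mult[OF C[OF t] x] by (simp add: exp_matrix_def)
    qed
  qed
qed

theorem theorem4p1:
  fixes A :: "'i \<Rightarrow> 'i \<Rightarrow> complex"
  shows
    "((\<exists>S. extends_exp_schur A S \<and> selfadjoint_schur_semigroup S) \<longleftrightarrow>
        (\<exists>(\<alpha> :: 'i \<Rightarrow> ('i + 'i, complex) ell2) \<beta>.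
          \<forall>i j. A i j = complex_of_real ((norm (\<alpha> i - \<beta> j))\<^sup>2))) \<and>
     ((\<exists>(\<alpha> :: 'i \<Rightarrow> 'h::{real_inner, complete_space}) \<beta>.
          \<forall>i j. A i j = complex_of_real ((norm (\<alpha> i - \<beta> j))\<^sup>2)) \<longrightarrow>
        (\<exists>S. extends_exp_schur A S \<and> selfadjoint_schur_semigroup S)) \<and>
     ((\<exists>S. extends_exp_schur A S \<and> selfadjoint_schur_semigroup S) \<longrightarrow>
        (\<exists>(\<alpha> :: 'i \<Rightarrow> ('i + 'i, real) ell2) \<beta>.
          \<forall>i j. A i j = complex_of_real ((norm (\<alpha> i - \<beta> j))\<^sup>2))) \<and>
     (\<forall>S. extends_exp_schur A S \<and> selfadjoint_schur_semigroup S \<longrightarrow> wstar_continuous S)"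
proof (intro conjI iffI impI allI)
  assume "\<exists>S. extends_exp_schur A S \<and> selfadjoint_schur_semigroup S"
  then show r: "\<exists>(\<alpha> :: 'i \<Rightarrow> ('i + 'i, real) ell2) \<beta>. \<forall>i j. A i j = complex_of_real ((norm (\<alpha> i - \<beta> j))\<^sup>2)"
    using squared_distances_of_semigroup by metis
next
  assume "\<exists>S. extends_exp_schur A S \<and> selfadjoint_schur_semigroup S"
  then obtain \<alpha> \<beta> :: "'i \<Rightarrow> ('i + 'i, real) ell2" where "\<And>i j. A i j = complex_of_real ((norm (\<alpha> i - \<beta> j))\<^sup>2)"
    using squared_distances_of_semigroup by metis
  moreover have "norm (cplx x - cplx y) = norm (x - y)" for x y :: "('i + 'i, real) ell2"
  proof -
    have "cplx x - cplx y = cplx (x - y)" by (rule ell2_eqI) simp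
    then show ?thesis by simp
  qed
  ultimately have "\<forall>i j. A i j = complex_of_real ((norm (cplx (\<alpha> i) - cplx (\<beta> j)))\<^sup>2)" by simp
  then show "\<exists>(\<alpha> :: 'i \<Rightarrow> ('i + 'i, complex) ell2) \<beta>. \<forall>i j. A i j = complex_of_real ((norm (\<alpha> i - \<beta> j))\<^sup>2)"
    by (intro exI)
next
  assume "\<exists>(\<alpha> :: 'i \<Rightarrow> ('i + 'i, complex) ell2) \<beta>. \<forall>i j. A i j = complex_of_real ((norm (\<alpha> i - \<beta> j))\<^sup>2)"
  then obtain \<alpha> \<beta> :: "'i \<Rightarrow> ('i + 'i, complex) ell2" where "\<And>i j. A i j = complex_of_real ((norm (\<alpha> i - \<beta> j))\<^sup>2)" by auto
  then show "\<exists>S. extends_exp_schur A S \<and> selfadjoint_schur_semigroup S" by (rule semigroup_of_squared_distances)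
next
  assume "\<exists>(\<alpha> :: 'i \<Rightarrow> 'h) \<beta>. \<forall>i j. A i j = complex_of_real ((norm (\<alpha> i - \<beta> j))\<^sup>2)"
  then obtain \<alpha> \<beta> :: "'i \<Rightarrow> 'h" where "\<And>i j. A i j = complex_of_real ((norm (\<alpha> i - \<beta> j))\<^sup>2)" by auto
  then show "\<exists>S. extends_exp_schur A S \<and> selfadjoint_schur_semigroup S" by (rule semigroup_of_squared_distances)
next
  fix S assume "extends_exp_schur A S \<and> selfadjoint_schur_semigroup S"
  then show "wstar_continuous S" using semigroup_weak_star_continuous by blast
qed

end
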